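(* Let $\mathbb{G}$ be a totally ordered Abelian group with $\operatorname{Deg}(\mathbb{G})=\kappa$. For any space $X$ the following are equivalent: (a) $X$ is a $\kappa$-Lindelöf $\kappa$-additive $\mathrm{SC}_\kappa$-space; (b) $X$ is a $\kappa$-Lindelöf spherically ${<}\kappa$-complete $\mathbb{G}$-metrizable space; (c) $X$ is a $\kappa$-Lindelöf spherically complete $\mathbb{G}$-Polish space. If $\kappa$ is weakly compact, conditions (a), (b) and (c) are also equivalent to: (d) $X$ is homeomorphic to a superclosed subset of ${}^{\kappa}2$.
   Context: Work in ZFC; $\kappa$ is an uncountable regular cardinal with $2^{<\kappa}=\kappa$ (equivalently $\kappa^{<\kappa}=\kappa$). "Space" means regular Hausdorff topological space. A tree is a set $T\subseteq{}^{<\kappa}\kappa$ closed under initial segments; $[T]=\{x\in{}^{\kappa}\kappa\mid \forall\alpha<\kappa\ (x\restriction\alpha\in T)\}$. $\kappa$ is weakly compact if it is strongly inaccessible and $[T]\ne\emptyset$ for every tree $T\subseteq{}^{<\kappa}\kappa$ all of whose levels $T\cap{}^{\alpha}\kappa$, $\alpha<\kappa$, are nonempty and of size $<\kappa$. ${}^{\kappa}\kappa$ is the set of all functions $\kappa\to\kappa$ with the bounded topology, generated by the sets $\{x\in{}^{\kappa}\kappa \mid s\subseteq x\}$, $s\in{}^{<\kappa}\kappa$; ${}^{\kappa}2\subseteq{}^{\kappa}\kappa$ has the relative topology. A tree $T$ is pruned if every $s\in T$ has extensions in $T$ of every length $\alpha$ with $\operatorname{lh}(s)\le\alpha<\kappa$;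 it is ${<}\kappa$-closed if for every (nonzero) limit $\gamma<\kappa$ and $s\in{}^{\gamma}\kappa$, if $s\restriction\alpha\in T$ for all $\alpha<\gamma$ then $s\in T$; it is superclosed if it is pruned and ${<}\kappa$-closed. A closed $C\subseteq{}^{\kappa}\kappa$ (in particular $C\subseteq{}^\kappa 2$) is superclosed if $C=[T]$ for some superclosed tree $T$. A space is $\kappa$-additive if its topology is closed under intersections of fewer than $\kappa$ open sets, and $\kappa$-Lindelöf if every open cover has a subcover of size $<\kappa$. Strong $\kappa$-Choquet game $\mathrm{G}^s_\kappa(X)$: players I and II play $\kappa$-many rounds. In round $\alpha<\kappa$, I plays $(U_\alpha,x_\alpha)$ with $U_\alpha$ a relatively open subset of $\bigcap_{\beta<\alpha}V_\beta$ (which is $X$ if $\alpha=0$) and $x_\alpha\in U_\alpha$; then II plays a relatively open subset $V_\alpha$ of $\bigcap_{\beta<\alpha}V_\beta$ with $x_\alpha\in V_\alpha\subseteq U_\alpha$. II wins iff $\bigcap_{\alpha<\gamma}V_\alpha\ne\emptyset$ for every limit $\gamma\le\kappa$ (I wins as soon as such an intersection is empty). $X$ is an $\mathrm{SC}_\kappa$-space if it has weight $\le\kappa$ and II has a winning strategy in $\mathrm{G}^s_\kappa(X)$. (The empty space, where I has no legal move, counts as such.) For a totally ordered (with translation-invariant linear order) Abelian group $\mathbb{G}$, $\mathbb{G}^+=\{\varepsilon\in\mathbb{G}\mid 0<\varepsilon\}$ and $\operatorname{Deg}(\mathbb{G})$ is the coinitiality of $\mathbb{G}^+$. A $\mathbb{G}$-metric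 on $X$ is a map $d\colon X^2\to\mathbb{G}^+\cup\{0\}$ with $d(x,y)=0\iff x=y$, $d(x,y)=d(y,x)$, $d(x,z)\le d(x,y)+d(y,z)$; its topology is generated by the balls $\{y\mid d(x,y)<\varepsilon\}$, $\varepsilon\in\mathbb{G}^+$, and $d$ is compatible with a topology if it generates it. $d$ is Cauchy-complete if every $d$-Cauchy sequence of length $\kappa$ converges. $d$ is spherically complete if every sequence of open balls decreasing with respect to inclusion has nonempty intersection; it is spherically ${<}\kappa$-complete if this holds for sequences of order type $<\kappa$. $X$ is spherically ${<}\kappa$-complete $\mathbb{G}$-metrizable if it admits a compatible spherically ${<}\kappa$-complete $\mathbb{G}$-metric. $X$ is a spherically complete $\mathbb{G}$-Polish space if it has weight $\le\kappa$ and admits a compatible $\mathbb{G}$-metric which is both Cauchy-complete and spherically complete. *)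

theory Defs
  imports "HOL-Analysis.Analysis"
begin

unbundle cardinal_syntax
no_notation Set_Algebras.elt_set_eq (infix \<open>=o\<close> 50)

section \<open>The cardinal\<close>

text \<open>
  The cardinal \<open>\<kappa>\<close> is represented by a well-ordered type \<open>'k\<close> whose order is an initial
  ordinal; the points of \<open>'k\<close> are the ordinals below \<open>\<kappa>\<close>, and \<open>{..<\<alpha>}\<close> is the ordinal \<open>\<alpha>\<close>.
  All notions depending on \<open>\<kappa>\<close> take an argument of type \<open>'k itself\<close>.
\<close>

definition ord_of :: "'k::wellorder itself \<Rightarrow> 'k rel" where
  "ord_of \<kappa> = {(\<alpha>, \<beta>). \<alpha> \<le> \<beta>}"

definition zero_ord :: "'k::wellorder" where
  "zero_ord = (LEAST \<alpha>. True)"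

definition one_ord :: "'k::wellorder" where
  "one_ord = (LEAST \<alpha>. zero_ord < \<alpha>)"

definition is_limit :: "'k::wellorder \<Rightarrow> bool" where
  "is_limit \<gamma> \<longleftrightarrow> (\<exists>\<beta>. \<beta> < \<gamma>) \<and> (\<forall>\<beta><\<gamma>. \<exists>\<delta>. \<beta> < \<delta> \<and> \<delta> < \<gamma>)"

text \<open>
  A sequence of length \<open>\<alpha> < \<kappa>\<close> is a partial map with domain \<open>{..<\<alpha>}\<close>, so that restriction is
  \<open>|`\<close> and extension of sequences is \<open>\<subseteq>\<^sub>m\<close>.
\<close>

definition seqs :: "'k::wellorder itself \<Rightarrow> ('k \<rightharpoonup> 'k) set" where
  "seqs \<kappa> = {s. \<exists>\<alpha>. dom s = {..<\<alpha>}}"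

definition bin_seqs :: "'k::wellorder itself \<Rightarrow> ('k \<rightharpoonup> 'k) set" where
  "bin_seqs \<kappa> = {s \<in> seqs \<kappa>. ran s \<subseteq> {zero_ord, one_ord}}"

text \<open>\<open>2\<close> to the power \<open><\<kappa>\<close> is read as the cardinality of the set of binary sequences of length
  \<open><\<kappa>\<close>.\<close>

definition standing_assumptions :: "'k::wellorder itself \<Rightarrow> bool" where
  "standing_assumptions \<kappa> \<longleftrightarrow>
     Card_order (ord_of \<kappa>) \<and> natLeq <o ord_of \<kappa> \<and> regularCard (ord_of \<kappa>) \<and>
     |bin_seqs \<kappa>| =o ord_of \<kappa>"


section \<open>Trees, weak compactness and the generalized Baire space\<close>

definition is_tree :: "'k::wellorder itself \<Rightarrow> ('k \<rightharpoonup> 'k) set \<Rightarrow> bool" where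
  "is_tree \<kappa> T \<longleftrightarrow> T \<subseteq> seqs \<kappa> \<and> (\<forall>s\<in>T. \<forall>\<alpha>. s |` {..<\<alpha>} \<in> T)"

definition branches :: "'k::wellorder itself \<Rightarrow> ('k \<rightharpoonup> 'k) set \<Rightarrow> ('k \<Rightarrow> 'k) set" where
  "branches \<kappa> T = {x. \<forall>\<alpha>. (Some \<circ> x) |` {..<\<alpha>} \<in> T}"

definition level :: "'k::wellorder itself \<Rightarrow> ('k \<rightharpoonup> 'k) set \<Rightarrow> 'k \<Rightarrow> ('k \<rightharpoonup> 'k) set" where
  "level \<kappa> T \<alpha> = {s \<in> T. dom s = {..<\<alpha>}}"

definition strongly_inaccessible :: "'k::wellorder itself \<Rightarrow> bool" where
  "strongly_inaccessible \<kappa> \<longleftrightarrow>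
     Card_order (ord_of \<kappa>) \<and> natLeq <o ord_of \<kappa> \<and> regularCard (ord_of \<kappa>) \<and>
     (\<forall>\<alpha>::'k. |Pow {..<\<alpha>}| <o ord_of \<kappa>)"

definition weakly_compact :: "'k::wellorder itself \<Rightarrow> bool" where
  "weakly_compact \<kappa> \<longleftrightarrow> strongly_inaccessible \<kappa> \<and>
     (\<forall>T. is_tree \<kappa> T \<and> (\<forall>\<alpha>. level \<kappa> T \<alpha> \<noteq> {} \<and> |level \<kappa> T \<alpha>| <o ord_of \<kappa>)
        \<longrightarrow> branches \<kappa> T \<noteq> {})"

definition bounded_topology :: "'k::wellorder itself \<Rightarrow> ('k \<Rightarrow> 'k) topology" where
  "bounded_topology \<kappa> = topology_generated_by {{x. s \<subseteq>\<^sub>m Some \<circ> x} |s. s \<in> seqs \<kappa>}"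

definition cantor_set :: "'k::wellorder itself \<Rightarrow> ('k \<Rightarrow> 'k) set" where
  "cantor_set \<kappa> = {x. \<forall>\<alpha>. x \<alpha> \<in> {zero_ord, one_ord}}"

definition pruned :: "'k::wellorder itself \<Rightarrow> ('k \<rightharpoonup> 'k) set \<Rightarrow> bool" where
  "pruned \<kappa> T \<longleftrightarrow>
     (\<forall>s\<in>T. \<forall>\<alpha>. dom s \<subseteq> {..<\<alpha>} \<longrightarrow> (\<exists>t\<in>T. dom t = {..<\<alpha>} \<and> s \<subseteq>\<^sub>m t))"

definition lt_closed_tree :: "'k::wellorder itself \<Rightarrow> ('k \<rightharpoonup> 'k) set \<Rightarrow> bool" where
  "lt_closed_tree \<kappa> T \<longleftrightarrow>
     (\<forall>\<gamma> s. is_limit \<gamma> \<and> dom s = {..<\<gamma>} \<and> (\<forall>\<alpha><\<gamma>. s |` {..<\<alpha>} \<in> T) \<longrightarrow> s \<in> T)"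

definition superclosed_tree :: "'k::wellorder itself \<Rightarrow> ('k \<rightharpoonup> 'k) set \<Rightarrow> bool" where
  "superclosed_tree \<kappa> T \<longleftrightarrow> is_tree \<kappa> T \<and> pruned \<kappa> T \<and> lt_closed_tree \<kappa> T"

definition superclosed :: "'k::wellorder itself \<Rightarrow> ('k \<Rightarrow> 'k) set \<Rightarrow> bool" where
  "superclosed \<kappa> C \<longleftrightarrow>
     closedin (bounded_topology \<kappa>) C \<and> (\<exists>T. superclosed_tree \<kappa> T \<and> C = branches \<kappa> T)"


section \<open>Cardinal topological properties\<close>

definition weight_le :: "'k::wellorder itself \<Rightarrow> 'a topology \<Rightarrow> bool" where
  "weight_le \<kappa> X \<longleftrightarrow>
     (\<exists>\<B>. |\<B>| \<le>o ord_of \<kappa> \<and> (\<forall>V\<in>\<B>. openin X V) \<and>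
        (\<forall>U x. openin X U \<and> x \<in> U \<longrightarrow> (\<exists>V\<in>\<B>. x \<in> V \<and> V \<subseteq> U)))"

definition kappa_additive :: "'k::wellorder itself \<Rightarrow> 'a topology \<Rightarrow> bool" where
  "kappa_additive \<kappa> X \<longleftrightarrow>
     (\<forall>\<U>. \<U> \<noteq> {} \<and> |\<U>| <o ord_of \<kappa> \<and> (\<forall>U\<in>\<U>. openin X U) \<longrightarrow> openin X (\<Inter>\<U>))"

definition kappa_Lindelof :: "'k::wellorder itself \<Rightarrow> 'a topology \<Rightarrow> bool" where
  "kappa_Lindelof \<kappa> X \<longleftrightarrow>
     (\<forall>\<U>. (\<forall>U\<in>\<U>. openin X U) \<and> \<Union>\<U> = topspace X \<longrightarrow>
        (\<exists>\<V>. |\<V>| <o ord_of \<kappa> \<and> \<V> \<subseteq> \<U> \<and> \<Union>\<V> = topspace X))"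


section \<open>The strong Choquet game\<close>

text \<open>
  A move of player I is a pair \<open>(U, x)\<close>; \<open>m \<alpha>\<close> and \<open>V \<alpha>\<close> are the moves of I and II in round \<open>\<alpha>\<close>.
\<close>

text \<open>\<open>remaining X V D\<close> is the intersection of the sets played by II in the rounds in \<open>D\<close>, which is
  the whole space if \<open>D = {}\<close>.\<close>

definition remaining :: "'a topology \<Rightarrow> ('k \<Rightarrow> 'a set) \<Rightarrow> 'k set \<Rightarrow> 'a set" where
  "remaining X V D = topspace X \<inter> (\<Inter>\<beta>\<in>D. V \<beta>)"

definition legal_I ::
    "'a topology \<Rightarrow> ('k::wellorder \<Rightarrow> 'a set \<times> 'a) \<Rightarrow> ('k \<Rightarrow> 'a set) \<Rightarrow> 'k \<Rightarrow> bool" where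
  "legal_I X m V \<alpha> \<longleftrightarrow>
     openin (subtopology X (remaining X V {..<\<alpha>})) (fst (m \<alpha>)) \<and> snd (m \<alpha>) \<in> fst (m \<alpha>)"

definition legal_II ::
    "'a topology \<Rightarrow> ('k::wellorder \<Rightarrow> 'a set \<times> 'a) \<Rightarrow> ('k \<Rightarrow> 'a set) \<Rightarrow> 'k \<Rightarrow> bool" where
  "legal_II X m V \<alpha> \<longleftrightarrow>
     openin (subtopology X (remaining X V {..<\<alpha>})) (V \<alpha>) \<and>
     snd (m \<alpha>) \<in> V \<alpha> \<and> V \<alpha> \<subseteq> fst (m \<alpha>)"

text \<open>The limit ordinals \<open>\<le> \<kappa>\<close>, as sets of predecessors; \<open>UNIV\<close> stands for \<open>\<kappa>\<close> itself.\<close>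

definition limit_lengths :: "'k::wellorder set set" where
  "limit_lengths = insert UNIV {{..<\<gamma>} |\<gamma>. is_limit \<gamma>}"

text \<open>
  A strategy for II maps the moves of I up to and including the current round to a move of II (the
  earlier moves of II are determined by these). It is winning if, as long as I has played
  legally, it answers legally and no intersection at a limit stage \<open>\<le> \<kappa>\<close> is empty. The values
  of \<open>m\<close> after the first illegal move of I (in particular after I has no legal move) are irrelevant.
\<close>

definition winning_strategy_II ::
    "'k::wellorder itself \<Rightarrow> 'a topology \<Rightarrow> (('k \<rightharpoonup> 'a set \<times> 'a) \<Rightarrow> 'a set) \<Rightarrow> bool" where
  "winning_strategy_II \<kappa> X \<sigma> \<longleftrightarrow>
     (\<forall>m V. (\<forall>\<alpha>. V \<alpha> = \<sigma> ((Some \<circ> m) |` {..\<alpha>})) \<longrightarrow>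
        (\<forall>\<alpha>. (\<forall>\<beta>\<le>\<alpha>. legal_I X m V \<beta>) \<longrightarrow> legal_II X m V \<alpha>) \<and>
        (\<forall>D\<in>limit_lengths. (\<forall>\<beta>\<in>D. legal_I X m V \<beta>) \<longrightarrow> remaining X V D \<noteq> {}))"

definition SC_space :: "'k::wellorder itself \<Rightarrow> 'a topology \<Rightarrow> bool" where
  "SC_space \<kappa> X \<longleftrightarrow> weight_le \<kappa> X \<and> (\<exists>\<sigma>. winning_strategy_II \<kappa> X \<sigma>)"


section \<open>Metrics with values in an ordered group\<close>

definition coinitial_pos :: "'g::linordered_ab_group_add set \<Rightarrow> bool" where
  "coinitial_pos A \<longleftrightarrow> A \<subseteq> {\<epsilon>. 0 < \<epsilon>} \<and> (\<forall>\<epsilon>>0. \<exists>a\<in>A. a \<le> \<epsilon>)"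

definition Deg :: "'g::linordered_ab_group_add itself \<Rightarrow> 'g rel" where
  "Deg \<GG> = |SOME A :: 'g set. coinitial_pos A \<and> (\<forall>B :: 'g set. coinitial_pos B \<longrightarrow> |A| \<le>o |B| )|"

definition group_metric_on ::
    "'a set \<Rightarrow> ('a \<Rightarrow> 'a \<Rightarrow> 'g::linordered_ab_group_add) \<Rightarrow> bool" where
  "group_metric_on S d \<longleftrightarrow>
     (\<forall>x\<in>S. \<forall>y\<in>S. 0 \<le> d x y \<and> (d x y = 0 \<longleftrightarrow> x = y) \<and> d x y = d y x) \<and>
     (\<forall>x\<in>S. \<forall>y\<in>S. \<forall>z\<in>S. d x z \<le> d x y + d y z)"

definition open_balls ::
    "'a set \<Rightarrow> ('a \<Rightarrow> 'a \<Rightarrow> 'g::linordered_ab_group_add) \<Rightarrow> 'a set set" where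
  "open_balls S d = {{y\<in>S. d x y < \<epsilon>} |x \<epsilon>. x \<in> S \<and> 0 < \<epsilon>}"

definition compatible_metric ::
    "'a topology \<Rightarrow> ('a \<Rightarrow> 'a \<Rightarrow> 'g::linordered_ab_group_add) \<Rightarrow> bool" where
  "compatible_metric X d \<longleftrightarrow>
     group_metric_on (topspace X) d \<and> X = topology_generated_by (open_balls (topspace X) d)"

definition Cauchy_complete_metric ::
    "'k::wellorder itself \<Rightarrow> 'a set \<Rightarrow> ('a \<Rightarrow> 'a \<Rightarrow> 'g::linordered_ab_group_add) \<Rightarrow> bool" where
  "Cauchy_complete_metric \<kappa> S d \<longleftrightarrow>
     (\<forall>s :: 'k \<Rightarrow> 'a.
        range s \<subseteq> S \<and> (\<forall>\<epsilon>>0. \<exists>\<alpha>. \<forall>\<beta>\<ge>\<alpha>. \<forall>\<gamma>\<ge>\<alpha>. d (s \<beta>) (s \<gamma>) < \<epsilon>) \<longrightarrow>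
        (\<exists>x. limitin (topology_generated_by (open_balls S d)) s x at_top))"

text \<open>The order type of the well-order \<open>r\<close> serves as the length of a (nonempty) sequence.\<close>

definition decreasing_balls ::
    "'a set \<Rightarrow> ('a \<Rightarrow> 'a \<Rightarrow> 'g::linordered_ab_group_add) \<Rightarrow> 'i rel \<Rightarrow> ('i \<Rightarrow> 'a set) \<Rightarrow> bool" where
  "decreasing_balls S d r B \<longleftrightarrow>
     Well_order r \<and> Field r \<noteq> {} \<and> (\<forall>i\<in>Field r. B i \<in> open_balls S d) \<and>
     (\<forall>i j. (i, j) \<in> r \<longrightarrow> B j \<subseteq> B i)"

text \<open>
  Sequences of arbitrary ordinal length are indexed by well-orders on \<open>'a set\<close>; that this
  covers index types of any size is \<open>spherically_complete_any_length\<close> below.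
\<close>

definition spherically_complete ::
    "'a set \<Rightarrow> ('a \<Rightarrow> 'a \<Rightarrow> 'g::linordered_ab_group_add) \<Rightarrow> bool" where
  "spherically_complete S d \<longleftrightarrow>
     (\<forall>(r :: 'a set rel) B. decreasing_balls S d r B \<longrightarrow> (\<Inter>i\<in>Field r. B i) \<noteq> {})"

definition spherically_lt_complete ::
    "'k::wellorder itself \<Rightarrow> 'a set \<Rightarrow> ('a \<Rightarrow> 'a \<Rightarrow> 'g::linordered_ab_group_add) \<Rightarrow> bool" where
  "spherically_lt_complete \<kappa> S d \<longleftrightarrow>
     (\<forall>(r :: 'k rel) B. decreasing_balls S d r B \<and> r <o ord_of \<kappa> \<longrightarrow> (\<Inter>i\<in>Field r. B i) \<noteq> {})"

lemma spherically_complete_any_length: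
  fixes r :: "'i rel"
  assumes sc: "spherically_complete S d" and dec: "decreasing_balls S d r B"
  shows "(\<Inter>i\<in>Field r. B i) \<noteq> {}"
proof -
  have wo: "Well_order r" and ne: "Field r \<noteq> {}"
    and balls: "\<And>i. i \<in> Field r \<Longrightarrow> B i \<in> open_balls S d"
    and mono: "\<And>i j. (i, j) \<in> r \<Longrightarrow> B j \<subseteq> B i"
    using dec by (auto simp: decreasing_balls_def)
  define R where "R = {(U, V). U \<in> B ` Field r \<and> V \<in> B ` Field r \<and> V \<subseteq> U}"
  have FR: "Field R = B ` Field r"
    by (auto simp: R_def Field_def)
  have tot: "(i, j) \<in> r \<or> (j, i) \<in> r" if "i \<in> Field r" "j \<in> Field r" for i j
    using wo that by (cases "i = j") (auto simp: well_order_on_def linear_order_on_def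
        partial_order_on_def preorder_on_def refl_on_def total_on_def)
  have "wf (R - Id)"
  proof (rule wfI_min)
    fix U Q assume "U \<in> (Q :: 'a set set)"
    show "\<exists>z\<in>Q. \<forall>y. (y, z) \<in> R - Id \<longrightarrow> y \<notin> Q"
    proof (cases "Q \<inter> B ` Field r = {}")
      case True
      then show ?thesis using \<open>U \<in> Q\<close> by (auto simp: R_def)
    next
      case False
      define I where "I = {i \<in> Field r. B i \<in> Q}"
      have "I \<noteq> {}" using False by (auto simp: I_def)
      moreover have "wf (r - Id)" using wo by (simp add: well_order_on_def)
      ultimately obtain i where i: "i \<in> I" and min: "\<And>j. (j, i) \<in> r - Id \<Longrightarrow> j \<notin> I"
        by (metis wfE_min ex_in_conv)
      have "B j \<subseteq> B i" if "j \<in> I" for j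
        using min[of j] tot[of i j] i that mono[of i j] by (auto simp: I_def)
      then show ?thesis
        using i by (intro bexI[of _ "B i"]) (auto simp: I_def R_def)
    qed
  qed
  moreover have "linear_order_on (Field R) R"
    unfolding FR linear_order_on_def partial_order_on_def preorder_on_def
    using tot mono
    by (fastforce simp: R_def refl_on_def trans_def antisym_def total_on_def)
  ultimately have "decreasing_balls S d R (\<lambda>U. U)"
    using ne balls by (auto simp: decreasing_balls_def well_order_on_def FR) (auto simp: R_def)
  then have "(\<Inter>U\<in>Field R. U) \<noteq> {}"
    using sc unfolding spherically_complete_def by blast
  then show ?thesis by (simp add: FR)
qed

definition spherically_lt_complete_metrizable ::
    "'k::wellorder itself \<Rightarrow> 'g::linordered_ab_group_add itself \<Rightarrow> 'a topology \<Rightarrow> bool" where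
  "spherically_lt_complete_metrizable \<kappa> \<GG> X \<longleftrightarrow>
     (\<exists>d :: 'a \<Rightarrow> 'a \<Rightarrow> 'g. compatible_metric X d \<and> spherically_lt_complete \<kappa> (topspace X) d)"

definition spherically_complete_Polish ::
    "'k::wellorder itself \<Rightarrow> 'g::linordered_ab_group_add itself \<Rightarrow> 'a topology \<Rightarrow> bool" where
  "spherically_complete_Polish \<kappa> \<GG> X \<longleftrightarrow> weight_le \<kappa> X \<and>
     (\<exists>d :: 'a \<Rightarrow> 'a \<Rightarrow> 'g. compatible_metric X d \<and>
        Cauchy_complete_metric \<kappa> (topspace X) d \<and> spherically_complete (topspace X) d)"

end

theory Submission
  imports Defs
begin

text \<open>
  All conditions say that \<open>X\<close> is a set of sequences of length \<open>\<kappa>\<close> that is closed in a strong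
  sense: not only is every branch of its tree of initial segments a member, but also every
  sequence of limit length \<open><\<kappa>\<close> whose proper initial segments are in the tree is itself in the
  tree. The central notion is a \<open>superclosed_coding\<close>, a function \<open>h\<close> that assigns to each
  point of \<open>X\<close> a \<open>\<kappa>\<close>-sequence of labels of any type, such that the cylinders of \<open>h\<close> form an
  open base of \<open>X\<close> and the image has this closure property.

  A winning strategy of II yields a coding (\<open>SC_space_imp_superclosed_coding\<close>). In a regular
  \<open>\<kappa>\<close>-additive \<open>\<kappa>\<close>-Lindelof space every open cover can be refined to an open partition
  labelled by points, and this is done \<open>\<kappa>\<close> times, each time with the cover by II's answers to
  the cylinders obtained so far. A sequence of labels then is a record of a run of the game,
  and a winning run leaves a point that realizes it.

  A coding yields an ultrametric, the distance of two points being given by the first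
  coordinate where they differ. Its balls are cylinders, so the closure property is spherical
  completeness, and Cauchy completeness is its instance for the length \<open>\<kappa>\<close>
  (\<open>superclosed_coding_imp_metric\<close>). Conversely, when a spherically \<open><\<kappa>\<close>-complete metric is
  given, II wins by playing balls with closed sets between successive ones: completeness takes
  care of the limits below \<open>\<kappa>\<close>, and the \<open>\<kappa>\<close>-Lindelof property of the last one
  (\<open>metrizable_imp_additive_SC_space\<close>).

  For subsets of the generalized Cantor space, labels are rewritten in binary. In a
  \<open>\<kappa>\<close>-Lindelof space each coordinate takes fewer than \<open>\<kappa>\<close> values, which can be coded in unary
  in a block of fewer than \<open>\<kappa>\<close> bits; with the right choice of a value that is coded by zeros,
  no new limit nodes appear inside the blocks (\<open>superclosed_coding_imp_binary\<close>). A binary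
  coding is the same thing as a homeomorphism onto a superclosed subset of \<open>2\<close> to the power
  \<open>\<kappa>\<close>, and weak compactness makes such subsets \<open>\<kappa>\<close>-Lindelof, which leads back to the other
  conditions (\<open>weakly_compact_imp_kappa_Lindelof\<close>).
\<close>

section \<open>Sets of size less than \<open>\<kappa>\<close>\<close>

locale uncountable_regular =
  fixes \<kappa> :: "'k::wellorder itself"
  assumes Card_order_\<kappa>: "Card_order (ord_of \<kappa>)"
    and uncountable_\<kappa>: "natLeq <o ord_of \<kappa>"
    and regular_\<kappa>: "regularCard (ord_of \<kappa>)"
begin

lemma Field_ord_of [simp]: "Field (ord_of \<kappa>) = UNIV"
  by (auto simp: ord_of_def Field_def)

lemma infinite_\<kappa>: "infinite (UNIV :: 'k set)"
proof
  assume "finite (UNIV :: 'k set)"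
  then have "ord_of \<kappa> <o natLeq"
    using finite_ordLess_infinite[of "ord_of \<kappa>" natLeq] Card_order_\<kappa> natLeq_Well_order
    by (simp add: Field_natLeq card_order_on_def)
  then show False
    using uncountable_\<kappa> ordLess_transitive ordLess_irreflexive by blast
qed

lemma card_UNIV_\<kappa>: "|UNIV :: 'k set| =o ord_of \<kappa>"
  using card_of_Field_ordIso[OF Card_order_\<kappa>] by simp

lemma stable_\<kappa>: "stable (ord_of \<kappa>)"
  using regularCard_stable[OF Card_order_\<kappa> _ regular_\<kappa>] infinite_\<kappa> by simp

lemma small_lessThan: "|{..<\<alpha>::'k}| <o ord_of \<kappa>"
proof -
  have "underS (ord_of \<kappa>) \<alpha> = {..<\<alpha>}"
    by (auto simp: underS_def ord_of_def)
  then show ?thesis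
    using card_of_underS[OF Card_order_\<kappa>, of \<alpha>] by simp
qed

lemma ex_greater: "\<exists>\<beta>. (\<alpha>::'k) < \<beta>"
  using infinite_Card_order_limit[OF Card_order_\<kappa>, of \<alpha>] infinite_\<kappa> Field_ord_of
  by (fastforce simp: ord_of_def order_less_le)

lemma small_subset: "A \<subseteq> B \<Longrightarrow> |B| <o ord_of \<kappa> \<Longrightarrow> |A| <o ord_of \<kappa>"
  using card_of_mono1 ordLeq_ordLess_trans by blast

lemma small_image: "|A| <o ord_of \<kappa> \<Longrightarrow> |f ` A| <o ord_of \<kappa>"
  using card_of_image ordLeq_ordLess_trans by blast

lemma small_UN: "|A| <o ord_of \<kappa> \<Longrightarrow> (\<And>a. a \<in> A \<Longrightarrow> |F a| <o ord_of \<kappa>) \<Longrightarrow> |\<Union>a\<in>A. F a| <o ord_of \<kappa>"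
  using stable_UNION[OF stable_\<kappa>] by blast

lemma small_countable: "countable A \<Longrightarrow> |A| <o ord_of \<kappa>"
proof -
  assume "countable A"
  then have "|A| \<le>o natLeq"
    by (meson card_of_nat card_of_ordLeq countableE ordLeq_ordIso_trans subset_UNIV)
  then show ?thesis
    using uncountable_\<kappa> ordLeq_ordLess_trans by blast
qed

lemma small_Un: "|A| <o ord_of \<kappa> \<Longrightarrow> |B| <o ord_of \<kappa> \<Longrightarrow> |A \<union> B| <o ord_of \<kappa>"
  using card_of_Un_ordLess_infinite_Field[OF _ Card_order_\<kappa>] infinite_\<kappa> by simp

lemma small_atMost: "|{..\<alpha>::'k}| <o ord_of \<kappa>"
  by (meson ex_greater small_lessThan small_subset atMost_iff lessThan_iff order.strict_trans1 subsetI)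

lemma small_bounded:
  fixes A :: "'k set"
  assumes "|A| <o ord_of \<kappa>"
  shows "\<exists>\<beta>. \<forall>\<alpha>\<in>A. \<alpha> < \<beta>"
proof (rule ccontr)
  assume *: "\<not> ?thesis"
  have "\<alpha> \<in> (\<Union>\<beta>\<in>A. {..\<beta>})" for \<alpha>
    using * by (auto simp: not_less)
  then have "(\<Union>\<beta>\<in>A. {..\<beta>}) = UNIV"
    by blast
  then have "|UNIV :: 'k set| <o ord_of \<kappa>"
    using small_UN[OF assms, of "\<lambda>\<beta>. {..\<beta>}"] small_atMost by simp
  then show False
    using card_UNIV_\<kappa> not_ordLess_ordIso by blast
qed

lemma small_iff_ordLess_card: "|A| <o ord_of \<kappa> \<longleftrightarrow> |A| <o |UNIV :: 'k set|"
  using card_UNIV_\<kappa> ordIso_symmetric ordLess_ordIso_trans by blast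

lemma small_inj:
  assumes "|A| <o ord_of \<kappa>"
  shows "\<exists>f :: 'b \<Rightarrow> 'k. inj_on f A"
  using assms unfolding small_iff_ordLess_card
  by (metis card_of_ordLeq ordLess_imp_ordLeq)

lemma initial_segment_ordLess:
  fixes \<gamma> :: 'k
  shows "Well_order {(i, j). i \<le> j \<and> j < \<gamma>}" "{(i, j). i \<le> j \<and> j < \<gamma>} <o ord_of \<kappa>"
    "Field {(i, j). i \<le> j \<and> j < \<gamma>} = {..<\<gamma>}"
proof -
  have "underS (ord_of \<kappa>) \<gamma> = {..<\<gamma>}"
    by (auto simp: underS_def ord_of_def)
  moreover have "Restr (ord_of \<kappa>) {..<\<gamma>} = {(i, j). i \<le> j \<and> j < \<gamma>}"
    by (auto simp: ord_of_def intro: le_less_trans)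
  ultimately have eq: "Restr (ord_of \<kappa>) (underS (ord_of \<kappa>) \<gamma>) = {(i, j). i \<le> j \<and> j < \<gamma>}"
    by simp
  have wo: "Well_order (ord_of \<kappa>)"
    using Card_order_\<kappa> by (rule card_order_on_well_order_on)
  show "Well_order {(i, j). i \<le> j \<and> j < \<gamma>}"
    using Well_order_Restr[OF wo, of "underS (ord_of \<kappa>) \<gamma>"] unfolding eq .
  show "{(i, j). i \<le> j \<and> j < \<gamma>} <o ord_of \<kappa>"
    using underS_Restr_ordLess[OF wo, of \<gamma>] unfolding eq by simp
  show "Field {(i, j). i \<le> j \<and> j < \<gamma>} = {..<\<gamma>}"
    by (auto simp: Field_def)
qed

lemma openin_small_INT:
  assumes "kappa_additive \<kappa> X" "|I| <o ord_of \<kappa>" "\<And>i. i \<in> I \<Longrightarrow> openin X (U i)"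
  shows "openin X (topspace X \<inter> (\<Inter>i\<in>I. U i))"
proof -
  have "|insert (topspace X) (U ` I)| <o ord_of \<kappa>"
    using small_Un[of "{topspace X}" "U ` I"] small_image[OF assms(2), of U] by (simp add: small_countable)
  then have "openin X (\<Inter>(insert (topspace X) (U ` I)))"
    using assms(1)[unfolded kappa_additive_def, rule_format, of "insert (topspace X) (U ` I)"] assms(3)
    by auto
  then show ?thesis by simp
qed

lemma closedin_small_UN:
  assumes "kappa_additive \<kappa> X" "|I| <o ord_of \<kappa>" "\<And>i. i \<in> I \<Longrightarrow> closedin X (U i)"
  shows "closedin X (\<Union>i\<in>I. U i)"
proof -
  have "openin X (topspace X \<inter> (\<Inter>i\<in>I. topspace X - U i))"
    using assms by (intro openin_small_INT) auto
  moreover have "topspace X \<inter> (\<Inter>i\<in>I. topspace X - U i) = topspace X - (\<Union>i\<in>I. U i)"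
    by auto
  moreover have "(\<Union>i\<in>I. U i) \<subseteq> topspace X"
    using assms closedin_subset by blast
  ultimately show ?thesis
    by (simp add: closedin_def)
qed

end

section \<open>Codings by sequences of length \<open>\<kappa>\<close>\<close>

definition cylinder :: "'a set \<Rightarrow> ('a \<Rightarrow> 'k::wellorder \<Rightarrow> 'b) \<Rightarrow> 'a \<Rightarrow> 'k \<Rightarrow> 'a set" where
  "cylinder S h x \<alpha> = {y \<in> S. \<forall>\<beta><\<alpha>. h y \<beta> = h x \<beta>}"

text \<open>
  A coding turns a point \<open>x\<close> into a sequence \<open>h x\<close> of length \<open>\<kappa>\<close> of labels of an arbitrary
  type. The first two clauses say that \<open>h\<close> is a homeomorphism onto its image for the bounded
  topology (once \<open>X\<close> is \<open>T\<^sub>0\<close>), the third one that the tree of initial segments of the image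
  has no new node at a limit level, and no new branch at level \<open>\<kappa>\<close>: the image is a superclosed
  set of sequences of labels. The last case is \<open>D = UNIV\<close>. Having the label type free is what
  makes the notion convenient: the game produces labels that are points of \<open>X\<close>, the tree
  description needs labels in \<open>2\<close>, and the metric does not care.
\<close>

definition superclosed_coding :: "'a topology \<Rightarrow> ('a \<Rightarrow> 'k::wellorder \<Rightarrow> 'b) \<Rightarrow> bool" where
  "superclosed_coding X h \<longleftrightarrow>
     (\<forall>x\<in>topspace X. \<forall>\<alpha>. openin X (cylinder (topspace X) h x \<alpha>)) \<and>
     (\<forall>U x. openin X U \<and> x \<in> U \<longrightarrow> (\<exists>\<alpha>. cylinder (topspace X) h x \<alpha> \<subseteq> U)) \<and>
     (\<forall>D\<in>limit_lengths. \<forall>s. (\<forall>\<alpha>\<in>D. \<exists>x\<in>topspace X. \<forall>\<beta>\<le>\<alpha>. h x \<beta> = s \<beta>) \<longrightarrow>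
        (\<exists>x\<in>topspace X. \<forall>\<beta>\<in>D. h x \<beta> = s \<beta>))"

lemma self_in_cylinder: "x \<in> S \<Longrightarrow> x \<in> cylinder S h x \<alpha>"
  by (simp add: cylinder_def)

lemma cylinder_cong: "(\<And>\<beta>. \<beta> < \<alpha> \<Longrightarrow> h y \<beta> = h x \<beta>) \<Longrightarrow> cylinder S h y \<alpha> = cylinder S h x \<alpha>"
  by (auto simp: cylinder_def)

lemma cylinder_eq: "y \<in> cylinder S h x \<alpha> \<Longrightarrow> cylinder S h y \<alpha> = cylinder S h x \<alpha>"
  by (rule cylinder_cong) (simp add: cylinder_def)

lemma cylinder_antimono: "\<alpha> \<le> \<beta> \<Longrightarrow> cylinder S h x \<beta> \<subseteq> cylinder S h x \<alpha>"
  by (auto simp: cylinder_def)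

section \<open>Clopen sets in \<open>\<kappa>\<close>-additive spaces\<close>

context uncountable_regular
begin

lemma limit_lengthsD:
  assumes "D \<in> limit_lengths" "(\<alpha>::'k) \<in> D"
  shows "\<exists>\<beta>\<in>D. \<alpha> < \<beta>" and "\<beta> \<le> \<alpha> \<Longrightarrow> \<beta> \<in> D"
  using assms ex_greater by (auto simp: limit_lengths_def is_limit_def)

text \<open>
  Regularity gives a decreasing sequence of open neighbourhoods of \<open>x\<close>, each containing the
  closure of the next one. Its intersection is closed, and open because \<open>\<omega> < \<kappa>\<close>.
\<close>

lemma ex_clopen_nbhd:
  assumes "regular_space X" "kappa_additive \<kappa> X" "openin X U" "x \<in> U"
  shows "\<exists>K. openin X K \<and> closedin X K \<and> x \<in> K \<and> K \<subseteq> U"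
proof -
  have step: "\<exists>V C. openin X V \<and> closedin X C \<and> x \<in> V \<and> V \<subseteq> C \<and> C \<subseteq> W"
    if "openin X W" "x \<in> W" for W
    using assms(1) that unfolding neighbourhood_base_of_closedin[symmetric] neighbourhood_base_of
    by blast
  have "\<exists>u. \<forall>n. (openin X (u n) \<and> x \<in> u n \<and> u n \<subseteq> U) \<and>
          (\<exists>C. closedin X C \<and> u (Suc n) \<subseteq> C \<and> C \<subseteq> u n)"
  proof (rule dependent_nat_choice)
    show "\<exists>V. openin X V \<and> x \<in> V \<and> V \<subseteq> U"
      using assms by blast
    show "\<exists>V'. (openin X V' \<and> x \<in> V' \<and> V' \<subseteq> U) \<and> (\<exists>C. closedin X C \<and> V' \<subseteq> C \<and> C \<subseteq> V)"
      if "openin X V \<and> x \<in> V \<and> V \<subseteq> U" for V and n :: nat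
      using step[of V] that by (meson subset_trans)
  qed
  then obtain u where *: "\<forall>n. (openin X (u n) \<and> x \<in> u n \<and> u n \<subseteq> U) \<and>
          (\<exists>C. closedin X C \<and> u (Suc n) \<subseteq> C \<and> C \<subseteq> u n)" ..
  then have u: "\<And>n. openin X (u n)" "\<And>n. x \<in> u n" "\<And>n. u n \<subseteq> U"
    by simp_all
  have "\<forall>n. \<exists>C. closedin X C \<and> u (Suc n) \<subseteq> C \<and> C \<subseteq> u n"
    using * by simp
  then obtain C where C: "\<And>n. closedin X (C n)" "\<And>n. u (Suc n) \<subseteq> C n" "\<And>n. C n \<subseteq> u n"
    by metis
  have eq: "topspace X \<inter> (\<Inter>n\<in>UNIV. u n) = (\<Inter>n\<in>UNIV. C n)"
  proof (intro equalityI subsetI)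
    fix y assume "y \<in> topspace X \<inter> (\<Inter>n\<in>UNIV. u n)"
    then have "y \<in> u (Suc n)" for n by simp
    then show "y \<in> (\<Inter>n\<in>UNIV. C n)"
      using C(2) by (auto dest: subsetD)
  next
    fix y assume "y \<in> (\<Inter>n\<in>UNIV. C n)"
    then have y: "y \<in> u n" for n
      using C(3)[of n] by auto
    then show "y \<in> topspace X \<inter> (\<Inter>n\<in>UNIV. u n)"
      using openin_subset[OF u(1)[of 0]] by auto
  qed
  have "openin X (topspace X \<inter> (\<Inter>n\<in>UNIV. u n))"
    using u by (intro openin_small_INT[OF assms(2)] small_countable) auto
  moreover have "closedin X (\<Inter>n\<in>UNIV. C n)"
    using C by (intro closedin_INT) auto
  moreover have "x \<in> topspace X"
    using assms openin_subset by blast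
  moreover have "(\<Inter>n\<in>UNIV. u n) \<subseteq> U"
    using u(3) by (rule INF_lower2[OF UNIV_I])
  ultimately show ?thesis
    using u(2) unfolding eq[symmetric]
    by (intro exI[of _ "topspace X \<inter> (\<Inter>n\<in>UNIV. u n)"]) blast
qed

text \<open>
  The fibres of \<open>q\<close> partition \<open>X\<close> into open sets subordinate to the cover \<open>W\<close>, and each piece
  is labelled by a point \<open>p\<close> whose neighbourhood \<open>W p\<close> contains it. Such a partition exists
  because a clopen cover of size \<open><\<kappa>\<close> can be made disjoint: subtracting from each member the
  union of the earlier ones keeps it open, since unions of fewer than \<open>\<kappa>\<close> closed sets are
  closed.
\<close>

lemma ex_open_partition_selector:
  assumes "regular_space X" "kappa_additive \<kappa> X" "kappa_Lindelof \<kappa> X"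
    and W: "\<And>p. p \<in> topspace X \<Longrightarrow> openin X (W p) \<and> p \<in> W p"
  obtains q where "\<And>x. x \<in> topspace X \<Longrightarrow> q x \<in> topspace X \<and> x \<in> W (q x)"
    and "\<And>p. p \<in> topspace X \<Longrightarrow> openin X {y \<in> topspace X. q y = p}"
proof -
  let ?S = "topspace X"
  have "\<forall>p\<in>?S. \<exists>K. openin X K \<and> closedin X K \<and> p \<in> K \<and> K \<subseteq> W p"
    using ex_clopen_nbhd[OF assms(1,2)] W by blast
  then obtain K where K: "\<And>p. p \<in> ?S \<Longrightarrow> openin X (K p) \<and> closedin X (K p) \<and> p \<in> K p \<and> K p \<subseteq> W p"
    by metis
  have "(\<forall>U\<in>K ` ?S. openin X U) \<and> \<Union>(K ` ?S) = ?S"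
    using K openin_subset by blast
  then obtain \<V> where \<V>: "|\<V>| <o ord_of \<kappa>" "\<V> \<subseteq> K ` ?S" "\<Union>\<V> = ?S"
    using assms(3)[unfolded kappa_Lindelof_def, rule_format, of "K ` ?S"] by auto
  then obtain A where A: "A \<subseteq> ?S" "inj_on K A" "\<V> = K ` A"
    using subset_image_inj by metis
  then have smallA: "|A| <o ord_of \<kappa>"
    using small_image[OF \<V>(1), of "inv_into A K"] by simp
  then obtain f :: "'a \<Rightarrow> 'k" where f: "inj_on f A"
    using small_inj by blast
  have "\<exists>p. p \<in> A \<and> x \<in> K p \<and> (\<forall>p'\<in>A. x \<in> K p' \<longrightarrow> f p \<le> f p')" if x: "x \<in> ?S" for x
  proof -
    let ?Q = "\<lambda>\<xi>. \<exists>p\<in>A. x \<in> K p \<and> f p = \<xi>"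
    have "\<exists>\<xi>. ?Q \<xi>"
      using x \<V>(3) A(3) by blast
    then have "?Q (LEAST \<xi>. ?Q \<xi>)"
      by (rule LeastI_ex)
    then show ?thesis
      using Least_le[of ?Q] by metis
  qed
  then obtain q where q: "\<And>x. x \<in> ?S \<Longrightarrow> q x \<in> A \<and> x \<in> K (q x) \<and> (\<forall>p'\<in>A. x \<in> K p' \<longrightarrow> f (q x) \<le> f p')"
    by metis
  have "openin X {y \<in> ?S. q y = p}" if "p \<in> A" for p
  proof -
    let ?B = "{p' \<in> A. f p' < f p}"
    have "{y \<in> ?S. q y = p} = K p - (\<Union>p'\<in>?B. K p')"
    proof (intro set_eqI iffI)
      fix y assume "y \<in> K p - (\<Union>p'\<in>?B. K p')"
      moreover from this have y: "y \<in> ?S"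
        using K A \<open>p \<in> A\<close> openin_subset by blast
      ultimately have "f (q y) = f p"
        using q[OF y] \<open>p \<in> A\<close> by (auto simp: not_less order_antisym)
      then show "y \<in> {y \<in> ?S. q y = p}"
        using q[OF y] f \<open>p \<in> A\<close> y by (auto dest: inj_onD)
    qed (use q in fastforce)
    moreover have "closedin X (\<Union>p'\<in>?B. K p')"
      using K A small_subset[OF _ smallA, of ?B] by (intro closedin_small_UN[OF assms(2)]) auto
    moreover have "openin X (K p)"
      using K A(1) \<open>p \<in> A\<close> by blast
    ultimately show ?thesis
      by (simp add: openin_diff)
  qed
  then have "openin X {y \<in> ?S. q y = p}" for p
  proof (cases "p \<in> A")
    case False
    then have "{y \<in> ?S. q y = p} = {}"
      using q by blast
    then show ?thesis by (simp only: openin_empty)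
  qed simp
  moreover have "q x \<in> ?S \<and> x \<in> W (q x)" if "x \<in> ?S" for x
    using q[OF that] K[of "q x"] A(1) by blast
  ultimately show thesis
    using that[of q] by simp
qed

text \<open>
  Given a base of size \<open>\<kappa>\<close>, it suffices to choose one clopen set between \<open>A\<close> and \<open>B\<close> for each
  pair \<open>(A, B)\<close> of basic sets that admits one.
\<close>

lemma ex_clopen_base:
  assumes "regular_space X" "kappa_additive \<kappa> X" "weight_le \<kappa> X"
  shows "\<exists>K :: 'k \<Rightarrow> 'a set. (\<forall>\<alpha>. openin X (K \<alpha>) \<and> closedin X (K \<alpha>)) \<and>
           (\<forall>U x. openin X U \<and> x \<in> U \<longrightarrow> (\<exists>\<alpha>. x \<in> K \<alpha> \<and> K \<alpha> \<subseteq> U))"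
proof -
  obtain \<B> where \<B>: "|\<B>| \<le>o ord_of \<kappa>" and op: "\<forall>V\<in>\<B>. openin X V"
    and base: "\<forall>U x. openin X U \<and> x \<in> U \<longrightarrow> (\<exists>V\<in>\<B>. x \<in> V \<and> V \<subseteq> U)"
    using assms(3) unfolding weight_le_def by blast
  have "|\<B>| \<le>o |UNIV :: 'k set|"
    using \<B> card_UNIV_\<kappa> ordIso_symmetric ordLeq_ordIso_trans by blast
  then obtain g :: "'a set \<Rightarrow> 'k" where g: "inj_on g \<B>"
    by (metis card_of_ordLeq)
  have "|UNIV :: ('k \<times> 'k) set| =o |UNIV :: 'k set|"
    using card_of_Times_same_infinite[OF infinite_\<kappa>] by (simp add: UNIV_Times_UNIV[symmetric] del: UNIV_Times_UNIV)
  then obtain e :: "'k \<Rightarrow> 'k \<times> 'k" where e: "surj e"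
    by (metis card_of_ordIso bij_betw_def ordIso_symmetric)
  define b where "b = inv_into \<B> g"
  define between where "between A B K \<longleftrightarrow> openin X K \<and> closedin X K \<and> A \<subseteq> K \<and> K \<subseteq> B" for A B K
  define K where "K \<alpha> = (if \<exists>K. between (b (fst (e \<alpha>))) (b (snd (e \<alpha>))) K
      then SOME K. between (b (fst (e \<alpha>))) (b (snd (e \<alpha>))) K else {})" for \<alpha>
  have "between (b (fst (e \<alpha>))) (b (snd (e \<alpha>))) (K \<alpha>)" if "\<exists>K. between (b (fst (e \<alpha>))) (b (snd (e \<alpha>))) K" for \<alpha>
    using someI_ex[OF that] that by (simp add: K_def)
  note K = this
  have "openin X (K \<alpha>) \<and> closedin X (K \<alpha>)" for \<alpha>
  proof (cases "\<exists>K. between (b (fst (e \<alpha>))) (b (snd (e \<alpha>))) K")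
    case True
    then show ?thesis
      using K[of \<alpha>] by (simp add: between_def)
  next
    case False
    then have "K \<alpha> = {}"
      by (simp add: K_def)
    then show ?thesis by simp
  qed
  moreover have "\<exists>\<alpha>. x \<in> K \<alpha> \<and> K \<alpha> \<subseteq> U" if U: "openin X U" "x \<in> U" for U x
  proof -
    obtain B where B: "B \<in> \<B>" "x \<in> B" "B \<subseteq> U"
      using base U by blast
    then obtain C where C: "openin X C" "closedin X C" "x \<in> C" "C \<subseteq> B"
      using ex_clopen_nbhd[OF assms(1,2), of B x] op by blast
    then obtain A where A: "A \<in> \<B>" "x \<in> A" "A \<subseteq> C"
      using base by blast
    obtain \<alpha> where "e \<alpha> = (g A, g B)"
      using e by (metis surjD)
    then have "b (fst (e \<alpha>)) = A" "b (snd (e \<alpha>)) = B"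
      using A B g by (simp_all add: b_def)
    moreover have "between A B C"
      using A C by (simp add: between_def)
    ultimately have "between A B (K \<alpha>)"
      using K[of \<alpha>] by metis
    then show ?thesis
      using A(2) B(3) unfolding between_def by blast
  qed
  ultimately show ?thesis by blast
qed

end

section \<open>From a winning strategy to a superclosed coding\<close>

context uncountable_regular
begin

text \<open>
  The recursion that follows builds the coding one coordinate at a time: \<open>F \<beta>\<close> is the \<open>\<beta>\<close>-th
  coordinate as a function on the space. A sequence \<open>s\<close> of labels determines a run of the
  game, in which player I announces in round \<open>\<alpha>\<close> the cylinder of points that follow \<open>s\<close> below
  \<open>\<alpha>\<close>, together with the label \<open>s \<alpha>\<close> as the distinguished point of that cylinder.
\<close>

definition agreeing :: "'a set \<Rightarrow> ('k \<Rightarrow> 'a \<Rightarrow> 'a) \<Rightarrow> ('k \<Rightarrow> 'a) \<Rightarrow> 'k \<Rightarrow> 'a set" where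
  "agreeing S F s \<alpha> = {y \<in> S. \<forall>\<beta><\<alpha>. F \<beta> y = s \<beta>}"

definition play :: "'a set \<Rightarrow> ('k \<Rightarrow> 'a \<Rightarrow> 'a) \<Rightarrow> ('k \<Rightarrow> 'a) \<Rightarrow> 'k \<Rightarrow> 'a set \<times> 'a" where
  "play S F s \<alpha> = (agreeing S F s \<alpha>, s \<alpha>)"

definition answer ::
    "(('k \<rightharpoonup> 'a set \<times> 'a) \<Rightarrow> 'a set) \<Rightarrow> 'a set \<Rightarrow> ('k \<Rightarrow> 'a \<Rightarrow> 'a) \<Rightarrow> ('k \<Rightarrow> 'a) \<Rightarrow> 'k \<Rightarrow> 'a set" where
  "answer \<sigma> S F s \<alpha> = \<sigma> ((Some \<circ> play S F s) |` {..\<alpha>})"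

lemma agreeing_cong:
  assumes "\<And>\<beta>. \<beta> < \<alpha> \<Longrightarrow> F \<beta> = G \<beta>" "\<And>\<beta>. \<beta> < \<alpha> \<Longrightarrow> s \<beta> = t \<beta>"
  shows "agreeing S F s \<alpha> = agreeing S G t \<alpha>"
  using assms by (auto simp: agreeing_def)

lemma answer_cong:
  assumes "\<And>\<beta>. \<beta> < \<alpha> \<Longrightarrow> F \<beta> = G \<beta>" "\<And>\<beta>. \<beta> \<le> \<alpha> \<Longrightarrow> s \<beta> = t \<beta>"
  shows "answer \<sigma> S F s \<alpha> = answer \<sigma> S G t \<alpha>"
proof -
  have "play S F s \<beta> = play S G t \<beta>" if "\<beta> \<le> \<alpha>" for \<beta>
    using assms that agreeing_cong[of \<beta> F G s t S] by (auto simp: play_def)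
  then have "(Some \<circ> play S F s) |` {..\<alpha>} = (Some \<circ> play S G t) |` {..\<alpha>}"
    by (auto simp: restrict_map_def fun_eq_iff)
  then show ?thesis by (simp add: answer_def)
qed

text \<open>
  The requirement on the coordinate \<open>q = F \<alpha>\<close>, given the earlier ones: its fibres are open;
  the label of \<open>x\<close> lies in the cylinder of \<open>x\<close>, so that it is a legal point for player I; \<open>x\<close>
  lies in the answer of II when player I plays this label; and the label decides whether \<open>x\<close>
  is in the \<open>\<alpha>\<close>-th member of a clopen base.
\<close>

definition follows ::
    "(('k \<rightharpoonup> 'a set \<times> 'a) \<Rightarrow> 'a set) \<Rightarrow> 'a topology \<Rightarrow> ('k \<Rightarrow> 'a set) \<Rightarrow>
     ('k \<Rightarrow> 'a \<Rightarrow> 'a) \<Rightarrow> 'k \<Rightarrow> ('a \<Rightarrow> 'a) \<Rightarrow> bool" where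
  "follows \<sigma> X K F \<alpha> q \<longleftrightarrow> (\<forall>x\<in>topspace X.
     openin X {y \<in> topspace X. q y = q x} \<and>
     q x \<in> agreeing (topspace X) F (\<lambda>\<beta>. F \<beta> x) \<alpha> \<and>
     x \<in> answer \<sigma> (topspace X) F (\<lambda>\<beta>. if \<beta> < \<alpha> then F \<beta> (q x) else q x) \<alpha> \<and>
     (x \<in> K \<alpha> \<longleftrightarrow> q x \<in> K \<alpha>))"

lemma follows_cong:
  assumes "\<And>\<beta>. \<beta> < \<alpha> \<Longrightarrow> F \<beta> = G \<beta>"
  shows "follows \<sigma> X K F \<alpha> q = follows \<sigma> X K G \<alpha> q"
proof -
  have "agreeing (topspace X) F (\<lambda>\<beta>. F \<beta> x) \<alpha> = agreeing (topspace X) G (\<lambda>\<beta>. G \<beta> x) \<alpha>" for x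
    using assms by (intro agreeing_cong) auto
  moreover have "answer \<sigma> (topspace X) F (\<lambda>\<beta>. if \<beta> < \<alpha> then F \<beta> p else p) \<alpha>
      = answer \<sigma> (topspace X) G (\<lambda>\<beta>. if \<beta> < \<alpha> then G \<beta> p else p) \<alpha>" for p
    using assms by (intro answer_cong) auto
  ultimately show ?thesis by (simp add: follows_def)
qed

lemma openin_agreeing:
  assumes "kappa_additive \<kappa> X" "\<And>\<beta>. \<beta> < \<alpha> \<Longrightarrow> follows \<sigma> X K F \<beta> (F \<beta>)"
    and "x \<in> agreeing (topspace X) F s \<alpha>"
  shows "openin X (agreeing (topspace X) F s \<alpha>)"
proof -
  have x: "x \<in> topspace X" "\<And>\<beta>. \<beta> < \<alpha> \<Longrightarrow> F \<beta> x = s \<beta>"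
    using assms(3) by (auto simp: agreeing_def)
  have "openin X {y \<in> topspace X. F \<beta> y = s \<beta>}" if "\<beta> < \<alpha>" for \<beta>
    using assms(2)[OF that] x that unfolding follows_def by metis
  then have "openin X (topspace X \<inter> (\<Inter>\<beta>\<in>{..<\<alpha>}. {y \<in> topspace X. F \<beta> y = s \<beta>}))"
    using assms small_lessThan by (intro openin_small_INT) auto
  moreover have "topspace X \<inter> (\<Inter>\<beta>\<in>{..<\<alpha>}. {y \<in> topspace X. F \<beta> y = s \<beta>}) = agreeing (topspace X) F s \<alpha>"
    by (auto simp: agreeing_def)
  ultimately show ?thesis by simp
qed

lemma answer_follows:
  assumes f: "follows \<sigma> X K F \<beta> (F \<beta>)" and y: "y \<in> topspace X" "\<And>\<delta>. \<delta> \<le> \<beta> \<Longrightarrow> F \<delta> y = s \<delta>"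
  shows "y \<in> answer \<sigma> (topspace X) F s \<beta>" "s \<beta> \<in> agreeing (topspace X) F s \<beta>"
proof -
  have "F \<beta> y \<in> agreeing (topspace X) F (\<lambda>\<beta>. F \<beta> y) \<beta>"
    and ans: "y \<in> answer \<sigma> (topspace X) F (\<lambda>\<delta>. if \<delta> < \<beta> then F \<delta> (F \<beta> y) else F \<beta> y) \<beta>"
    using f y unfolding follows_def by blast+
  then show *: "s \<beta> \<in> agreeing (topspace X) F s \<beta>"
    using y by (simp add: agreeing_def)
  have "answer \<sigma> (topspace X) F (\<lambda>\<delta>. if \<delta> < \<beta> then F \<delta> (F \<beta> y) else F \<beta> y) \<beta> = answer \<sigma> (topspace X) F s \<beta>"
    using * y by (intro answer_cong) (auto simp: agreeing_def)
  then show "y \<in> answer \<sigma> (topspace X) F s \<beta>"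
    using ans by simp
qed

text \<open>
  The cylinders shrink at least as fast as the answers of II, because a point with label \<open>s \<beta>\<close>
  in round \<open>\<beta>\<close> belongs to II's answer in that round. Hence player I may play them.
\<close>

lemma play_legal:
  assumes add: "kappa_additive \<kappa> X" and f: "\<And>\<beta>. \<beta> < \<alpha> \<Longrightarrow> follows \<sigma> X K F \<beta> (F \<beta>)"
    and x: "x \<in> agreeing (topspace X) F s \<alpha>" and s\<alpha>: "s \<alpha> \<in> agreeing (topspace X) F s \<alpha>"
    and "\<beta> \<le> \<alpha>"
  shows "openin X (agreeing (topspace X) F s \<beta>)"
    and "agreeing (topspace X) F s \<beta> \<subseteq> remaining X (answer \<sigma> (topspace X) F s) {..<\<beta>}"
    and "legal_I X (play (topspace X) F s) (answer \<sigma> (topspace X) F s) \<beta>"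
proof -
  let ?C = "agreeing (topspace X) F s \<beta>"
  have "x \<in> ?C"
    using x \<open>\<beta> \<le> \<alpha>\<close> by (auto simp: agreeing_def)
  have f': "follows \<sigma> X K F \<delta> (F \<delta>)" if "\<delta> < \<beta>" for \<delta>
    using f that \<open>\<beta> \<le> \<alpha>\<close> by simp
  show op: "openin X ?C"
    using openin_agreeing[OF add f' \<open>x \<in> ?C\<close>] .
  show sub: "?C \<subseteq> remaining X (answer \<sigma> (topspace X) F s) {..<\<beta>}"
  proof
    fix y assume "y \<in> ?C"
    then have y: "y \<in> topspace X" "\<And>\<delta>. \<delta> < \<beta> \<Longrightarrow> F \<delta> y = s \<delta>"
      by (auto simp: agreeing_def)
    have "y \<in> answer \<sigma> (topspace X) F s \<delta>" if "\<delta> < \<beta>" for \<delta>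
      using that y by (intro answer_follows(1)[OF f']) auto
    then show "y \<in> remaining X (answer \<sigma> (topspace X) F s) {..<\<beta>}"
      using y by (simp add: remaining_def)
  qed
  have "s \<beta> \<in> ?C"
  proof (cases "\<beta> = \<alpha>")
    case False
    then show ?thesis
      using x \<open>\<beta> \<le> \<alpha>\<close> by (intro answer_follows(2)[OF f, of _ x]) (auto simp: agreeing_def)
  qed (use s\<alpha> in simp)
  moreover have "openin (subtopology X (remaining X (answer \<sigma> (topspace X) F s) {..<\<beta>})) ?C"
    using op sub by (auto simp: openin_subtopology)
  ultimately show "legal_I X (play (topspace X) F s) (answer \<sigma> (topspace X) F s) \<beta>"
    by (simp add: legal_I_def play_def)
qed

lemma winning_answers:
  assumes "winning_strategy_II \<kappa> X \<sigma>"
  shows "(\<And>\<beta>. \<beta> \<le> \<alpha> \<Longrightarrow> legal_I X (play (topspace X) F s) (answer \<sigma> (topspace X) F s) \<beta>) \<Longrightarrow>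
           legal_II X (play (topspace X) F s) (answer \<sigma> (topspace X) F s) \<alpha>"
    and "D \<in> limit_lengths \<Longrightarrow>
          (\<And>\<beta>. \<beta> \<in> D \<Longrightarrow> legal_I X (play (topspace X) F s) (answer \<sigma> (topspace X) F s) \<beta>) \<Longrightarrow>
          remaining X (answer \<sigma> (topspace X) F s) D \<noteq> {}"
proof -
  let ?m = "play (topspace X) F s" and ?V = "answer \<sigma> (topspace X) F s"
  have "(\<forall>\<alpha>. (\<forall>\<beta>\<le>\<alpha>. legal_I X ?m ?V \<beta>) \<longrightarrow> legal_II X ?m ?V \<alpha>) \<and>
        (\<forall>D\<in>limit_lengths. (\<forall>\<beta>\<in>D. legal_I X ?m ?V \<beta>) \<longrightarrow> remaining X ?V D \<noteq> {})"
    using assms[unfolded winning_strategy_II_def, rule_format, of ?V ?m] by (simp add: answer_def)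
  then show "(\<And>\<beta>. \<beta> \<le> \<alpha> \<Longrightarrow> legal_I X ?m ?V \<beta>) \<Longrightarrow> legal_II X ?m ?V \<alpha>"
    and "D \<in> limit_lengths \<Longrightarrow> (\<And>\<beta>. \<beta> \<in> D \<Longrightarrow> legal_I X ?m ?V \<beta>) \<Longrightarrow> remaining X ?V D \<noteq> {}"
    by simp_all
qed

text \<open>
  Coordinates are chosen by transfinite recursion. In round \<open>\<alpha>\<close>, every point \<open>p\<close> gets as
  neighbourhood \<open>W p\<close> the answer of II when player I plays \<open>p\<close> in the cylinder of \<open>p\<close>, cut
  down by the \<open>\<alpha>\<close>-th clopen set or its complement; a selector of an open partition subordinate
  to \<open>W\<close> is the new coordinate. The clopen sets of a base are all decided, so the cylinders
  form a base. If all initial parts of a sequence \<open>s\<close> of limit length are realized, then the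
  run determined by \<open>s\<close> is legal, and since II wins there is a point in all answers; it lies
  in all cylinders, hence realizes \<open>s\<close>.
\<close>

theorem SC_space_imp_superclosed_coding:
  fixes X :: "'a topology"
  assumes reg: "regular_space X" and add: "kappa_additive \<kappa> X" and Lin: "kappa_Lindelof \<kappa> X"
    and SC: "SC_space \<kappa> X"
  shows "\<exists>h :: 'a \<Rightarrow> 'k \<Rightarrow> 'a. superclosed_coding X h"
proof -
  let ?S = "topspace X"
  have "weight_le \<kappa> X"
    using SC by (simp add: SC_space_def)
  from ex_clopen_base[OF reg add this] obtain K :: "'k \<Rightarrow> 'a set" where *: "(\<forall>\<alpha>. openin X (K \<alpha>) \<and> closedin X (K \<alpha>)) \<and>
           (\<forall>U x. openin X U \<and> x \<in> U \<longrightarrow> (\<exists>\<alpha>. x \<in> K \<alpha> \<and> K \<alpha> \<subseteq> U))" ..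
  then have K: "\<And>\<alpha>. openin X (K \<alpha>) \<and> closedin X (K \<alpha>)"
    and base: "\<And>U x. openin X U \<Longrightarrow> x \<in> U \<Longrightarrow> \<exists>\<alpha>. x \<in> K \<alpha> \<and> K \<alpha> \<subseteq> U"
    by simp_all
  obtain \<sigma> where \<sigma>: "winning_strategy_II \<kappa> X \<sigma>"
    using SC by (auto simp: SC_space_def)
  have "\<exists>F. \<forall>\<alpha>. follows \<sigma> X K F \<alpha> (F \<alpha>)"
  proof (rule dependent_wellorder_choice)
    show "follows \<sigma> X K F \<alpha> q = follows \<sigma> X K G \<alpha> q" if "\<And>\<beta>. \<beta> < \<alpha> \<Longrightarrow> F \<beta> = G \<beta>" for q F G \<alpha>
      using that by (rule follows_cong)
  next
    fix \<alpha> F assume f: "\<And>\<beta>. \<beta> < \<alpha> \<Longrightarrow> follows \<sigma> X K F \<beta> (F \<beta>)"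
    \<comment> \<open>the run in which \<open>p\<close> is its own label in round \<open>\<alpha>\<close>\<close>
    define s where "s p = (\<lambda>\<beta>. if \<beta> < \<alpha> then F \<beta> p else p)" for p
    define V where "V p = answer \<sigma> ?S F (s p) \<alpha>" for p
    define W where "W p = V p \<inter> (if p \<in> K \<alpha> then K \<alpha> else ?S - K \<alpha>)" for p
    have V: "openin X (V p)" "p \<in> V p" "V p \<subseteq> agreeing ?S F (s p) \<alpha>" if p: "p \<in> ?S" for p
    proof -
      have p': "p \<in> agreeing ?S F (s p) \<alpha>" "s p \<alpha> = p" "s p \<alpha> \<in> agreeing ?S F (s p) \<alpha>"
        using p by (auto simp: agreeing_def s_def)
      note pl = play_legal[OF add f p'(1) p'(3)]
      have "legal_II X (play ?S F (s p)) (answer \<sigma> ?S F (s p)) \<alpha>"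
        using p' pl(3) by (intro winning_answers(1)[OF \<sigma>]) auto
      then have *: "openin (subtopology X (remaining X (answer \<sigma> ?S F (s p)) {..<\<alpha>})) (V p)"
        "p \<in> V p" "V p \<subseteq> agreeing ?S F (s p) \<alpha>"
        using p' by (auto simp: legal_II_def play_def V_def)
      obtain T where T: "openin X T" "V p = T \<inter> remaining X (answer \<sigma> ?S F (s p)) {..<\<alpha>}"
        using *(1) by (auto simp: openin_subtopology)
      have "V p = T \<inter> agreeing ?S F (s p) \<alpha>"
        using T(2) *(3) pl(2)[of \<alpha>] p' by auto
      then show "openin X (V p)"
        using T(1) pl(1)[of \<alpha>] p' by auto
      show "p \<in> V p" "V p \<subseteq> agreeing ?S F (s p) \<alpha>"
        using * by auto
    qed
    have "openin X (W p) \<and> p \<in> W p" if "p \<in> ?S" for p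
      using V[OF that] K[of \<alpha>] that by (auto simp: W_def)
    then obtain q where q: "\<And>x. x \<in> ?S \<Longrightarrow> q x \<in> ?S \<and> x \<in> W (q x)"
      "\<And>p. p \<in> ?S \<Longrightarrow> openin X {y \<in> ?S. q y = p}"
      using ex_open_partition_selector[OF reg add Lin, of W] by metis
    have "follows \<sigma> X K F \<alpha> q"
      unfolding follows_def
    proof (intro ballI conjI)
      fix x assume x: "x \<in> ?S"
      show "openin X {y \<in> ?S. q y = q x}"
        using q x by blast
      have "x \<in> agreeing ?S F (s (q x)) \<alpha>"
        using q(1)[OF x] V(3)[of "q x"] by (auto simp: W_def)
      then show "q x \<in> agreeing ?S F (\<lambda>\<beta>. F \<beta> x) \<alpha>"
        using q(1)[OF x] by (simp add: agreeing_def s_def)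
      show "x \<in> answer \<sigma> ?S F (\<lambda>\<beta>. if \<beta> < \<alpha> then F \<beta> (q x) else q x) \<alpha>"
        using q(1)[OF x] by (simp add: W_def V_def s_def)
      show "x \<in> K \<alpha> \<longleftrightarrow> q x \<in> K \<alpha>"
        using q(1)[OF x] by (auto simp: W_def split: if_splits)
    qed
    then show "\<exists>q. follows \<sigma> X K F \<alpha> q"
      by fast
  qed
  then obtain F where "\<forall>\<alpha>. follows \<sigma> X K F \<alpha> (F \<alpha>)" ..
  then have F: "\<And>\<alpha>. follows \<sigma> X K F \<alpha> (F \<alpha>)"
    by simp
  define h where "h x \<alpha> = F \<alpha> x" for x \<alpha>
  have cylinder: "cylinder ?S h x \<alpha> = agreeing ?S F (h x) \<alpha>" for x \<alpha>
    by (auto simp: cylinder_def agreeing_def h_def)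
  have "openin X (cylinder ?S h x \<alpha>)" if "x \<in> ?S" for x \<alpha>
    unfolding cylinder using that by (intro openin_agreeing[OF add F, of x]) (simp add: agreeing_def h_def)
  moreover have "\<exists>\<alpha>. cylinder ?S h x \<alpha> \<subseteq> U" if U: "openin X U" "x \<in> U" for U x
  proof -
    obtain \<alpha> where \<alpha>: "x \<in> K \<alpha>" "K \<alpha> \<subseteq> U"
      using base U by blast
    obtain \<beta> where \<beta>: "\<alpha> < \<beta>"
      using ex_greater by blast
    \<comment> \<open>a point and its label are on the same side of \<open>K \<alpha>\<close>, so points with the same label are, too\<close>
    have decide: "z \<in> K \<alpha> \<longleftrightarrow> F \<alpha> z \<in> K \<alpha>" if "z \<in> ?S" for z
      using F[of \<alpha>] that by (auto simp: follows_def)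
    have x: "x \<in> ?S"
      using U openin_subset by blast
    have "cylinder ?S h x \<beta> \<subseteq> K \<alpha>"
    proof
      fix z assume "z \<in> cylinder ?S h x \<beta>"
      then have "z \<in> ?S" "F \<alpha> z = F \<alpha> x"
        using \<beta> by (auto simp: cylinder_def h_def)
      then show "z \<in> K \<alpha>"
        using decide[of z] decide[OF x] \<alpha>(1) by metis
    qed
    then show ?thesis using \<alpha>(2) by (intro exI[of _ \<beta>]) (rule subset_trans)
  qed
  moreover have "\<exists>x\<in>?S. \<forall>\<beta>\<in>D. h x \<beta> = s \<beta>"
    if D: "D \<in> limit_lengths" and s: "\<forall>\<alpha>\<in>D. \<exists>x\<in>?S. \<forall>\<beta>\<le>\<alpha>. h x \<beta> = s \<beta>" for D s
  proof -
    have leg: "legal_I X (play ?S F s) (answer \<sigma> ?S F s) \<beta>"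
      if "\<alpha> \<in> D" and \<beta>: "\<beta> \<le> \<alpha>" for \<alpha> \<beta>
    proof -
      obtain x where x: "x \<in> ?S" "\<forall>\<beta>\<le>\<alpha>. F \<beta> x = s \<beta>"
        using bspec[OF s \<open>\<alpha> \<in> D\<close>] by (auto simp: h_def)
      then have "x \<in> agreeing ?S F s \<alpha>"
        by (auto simp: agreeing_def)
      moreover have "s \<alpha> \<in> agreeing ?S F s \<alpha>"
        using x by (intro answer_follows(2)[OF F, of x]) auto
      ultimately show ?thesis
        using \<beta> by (rule play_legal(3)[OF add F])
    qed
    then have "remaining X (answer \<sigma> ?S F s) D \<noteq> {}"
      by (intro winning_answers(2)[OF \<sigma> D]) simp
    then obtain z where z: "z \<in> ?S" "\<And>\<beta>. \<beta> \<in> D \<Longrightarrow> z \<in> answer \<sigma> ?S F s \<beta>"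
      by (auto simp: remaining_def)
    have "h z \<beta> = s \<beta>" if "\<beta> \<in> D" for \<beta>
    proof -
      obtain \<gamma> where \<gamma>: "\<gamma> \<in> D" "\<beta> < \<gamma>"
        using limit_lengthsD(1)[OF D \<open>\<beta> \<in> D\<close>] by blast
      have "legal_II X (play ?S F s) (answer \<sigma> ?S F s) \<gamma>"
        using leg[OF \<gamma>(1)] by (rule winning_answers(1)[OF \<sigma>])
      then have "answer \<sigma> ?S F s \<gamma> \<subseteq> agreeing ?S F s \<gamma>"
        by (simp add: legal_II_def play_def)
      then have "z \<in> agreeing ?S F s \<gamma>"
        using z(2)[OF \<gamma>(1)] by blast
      then show ?thesis
        using \<gamma> by (simp add: agreeing_def h_def)
    qed
    then show ?thesis using z(1) by (intro bexI[of _ z]) auto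
  qed
  ultimately have "superclosed_coding X h"
    by (simp add: superclosed_coding_def)
  then show ?thesis by fast
qed

end

section \<open>Metrics with values in an ordered group\<close>

definition gball :: "'a set \<Rightarrow> ('a \<Rightarrow> 'a \<Rightarrow> 'g::linordered_ab_group_add) \<Rightarrow> 'a \<Rightarrow> 'g \<Rightarrow> 'a set" where
  "gball S d x \<epsilon> = {y \<in> S. d x y < \<epsilon>}"

lemma open_balls_eq: "open_balls S d = {gball S d x \<epsilon> |x \<epsilon>. x \<in> S \<and> 0 < \<epsilon>}"
  by (simp add: open_balls_def gball_def)

lemma gball_mono: "\<delta> \<le> \<epsilon> \<Longrightarrow> gball S d x \<delta> \<subseteq> gball S d x \<epsilon>"
  by (auto simp: gball_def)

lemma self_in_gball:
  assumes "group_metric_on S d" "x \<in> S" "0 < \<epsilon>"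
  shows "x \<in> gball S d x \<epsilon>"
proof -
  have "d x x = 0"
    using assms(1,2) by (simp add: group_metric_on_def)
  then show ?thesis
    using assms by (simp add: gball_def)
qed

lemma gball_inside:
  assumes "group_metric_on S d" "x \<in> S" "y \<in> gball S d x \<epsilon>"
  shows "\<exists>\<delta>>0. gball S d y \<delta> \<subseteq> gball S d x \<epsilon>"
proof (intro exI[of _ "\<epsilon> - d x y"] conjI subsetI)
  show "0 < \<epsilon> - d x y"
    using assms(3) by (simp add: gball_def)
  fix z assume z: "z \<in> gball S d y (\<epsilon> - d x y)"
  then have "d x z \<le> d x y + d y z"
    using assms by (auto simp: gball_def group_metric_on_def)
  also have "\<dots> < \<epsilon>"
    using z by (simp add: gball_def less_diff_eq add.commute)
  finally show "z \<in> gball S d x \<epsilon>"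
    using z by (simp add: gball_def)
qed

lemma openin_ball_topology:
  fixes d :: "'a \<Rightarrow> 'a \<Rightarrow> 'g::linordered_ab_group_add"
  assumes d: "group_metric_on S d" and pos: "\<exists>\<epsilon>::'g. 0 < \<epsilon>"
  shows "openin (topology_generated_by (open_balls S d)) U \<longleftrightarrow>
           U \<subseteq> S \<and> (\<forall>x\<in>U. \<exists>\<epsilon>>0. gball S d x \<epsilon> \<subseteq> U)"
proof
  assume "openin (topology_generated_by (open_balls S d)) U"
  then have "generate_topology_on (open_balls S d) U"
    by (simp add: openin_topology_generated_by_iff)
  then show "U \<subseteq> S \<and> (\<forall>x\<in>U. \<exists>\<epsilon>>0. gball S d x \<epsilon> \<subseteq> U)"
  proof induction
    case (Int U V)
    have "\<exists>\<epsilon>>0. gball S d x \<epsilon> \<subseteq> U \<inter> V" if x: "x \<in> U \<inter> V" for x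
    proof -
      obtain \<epsilon> where "0 < \<epsilon>" "gball S d x \<epsilon> \<subseteq> U"
        using Int.IH(1) x by auto
      moreover obtain \<delta> where "0 < \<delta>" "gball S d x \<delta> \<subseteq> V"
        using Int.IH(2) x by auto
      moreover have "gball S d x (min \<epsilon> \<delta>) \<subseteq> gball S d x \<epsilon> \<inter> gball S d x \<delta>"
        by (auto simp: gball_def)
      ultimately show ?thesis
        by (intro exI[of _ "min \<epsilon> \<delta>"]) auto
    qed
    then show ?case using Int by auto
  next
    case (UN \<U>)
    show ?case
    proof (intro conjI ballI)
      show "\<Union>\<U> \<subseteq> S" using UN by auto
      fix x assume "x \<in> \<Union>\<U>"
      then obtain V where V: "V \<in> \<U>" "x \<in> V" by blast
      then obtain \<epsilon> where "0 < \<epsilon>" "gball S d x \<epsilon> \<subseteq> V"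
        using UN.IH[OF V(1)] by blast
      then show "\<exists>\<epsilon>>0. gball S d x \<epsilon> \<subseteq> \<Union>\<U>"
        using V(1) by (intro exI[of _ \<epsilon>]) auto
    qed
  next
    case (Basis U)
    then obtain x \<epsilon> where "U = gball S d x \<epsilon>" "x \<in> S"
      by (auto simp: open_balls_eq)
    then show ?case
      using gball_inside[OF d] by (auto simp: gball_def)
  qed simp
next
  assume U: "U \<subseteq> S \<and> (\<forall>x\<in>U. \<exists>\<epsilon>>0. gball S d x \<epsilon> \<subseteq> U)"
  show "openin (topology_generated_by (open_balls S d)) U"
  proof (subst openin_subopen, intro ballI)
    fix x assume x: "x \<in> U"
    then obtain \<epsilon> where \<epsilon>: "0 < \<epsilon>" "gball S d x \<epsilon> \<subseteq> U"
      using U by blast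
    have "x \<in> gball S d x \<epsilon>"
      using x U \<epsilon>(1) by (intro self_in_gball[OF d]) auto
    moreover have "openin (topology_generated_by (open_balls S d)) (gball S d x \<epsilon>)"
      using x U \<epsilon> by (intro topology_generated_by_Basis) (auto simp: open_balls_eq)
    ultimately show "\<exists>T. openin (topology_generated_by (open_balls S d)) T \<and> x \<in> T \<and> T \<subseteq> U"
      using \<epsilon>(2) by (intro exI[of _ "gball S d x \<epsilon>"]) simp
  qed
qed

lemma compatible_metric_iff:
  fixes d :: "'a \<Rightarrow> 'a \<Rightarrow> 'g::linordered_ab_group_add"
  assumes pos: "\<exists>\<epsilon>::'g. 0 < \<epsilon>"
  shows "compatible_metric X d \<longleftrightarrow> group_metric_on (topspace X) d \<and>
     (\<forall>U. openin X U \<longleftrightarrow> U \<subseteq> topspace X \<and> (\<forall>x\<in>U. \<exists>\<epsilon>>0. gball (topspace X) d x \<epsilon> \<subseteq> U))"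
proof (cases "group_metric_on (topspace X) d")
  case True
  then show ?thesis
    by (simp add: compatible_metric_def topology_eq[of X] openin_ball_topology[OF _ pos])
qed (simp add: compatible_metric_def)

context uncountable_regular
begin

lemma ex_minimal_coinitial:
  "\<exists>A :: 'g::linordered_ab_group_add set. coinitial_pos A \<and> (\<forall>B :: 'g set. coinitial_pos B \<longrightarrow> |A| \<le>o |B| )"
proof -
  let ?R = "card_of ` {A :: 'g set. coinitial_pos A}"
  have "coinitial_pos {\<epsilon>::'g. 0 < \<epsilon>}"
    by (auto simp: coinitial_pos_def)
  then have "?R \<noteq> {}" by blast
  moreover have "\<forall>r\<in>?R. Card_order r"
    by (auto intro: card_of_Card_order)
  ultimately have "\<exists>r\<in>?R. \<forall>r'\<in>?R. r \<le>o r'"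
    by (rule exists_minim_Card_order)
  then show ?thesis by simp
qed

lemma Deg_eq:
  fixes \<GG> :: "'g::linordered_ab_group_add itself"
  assumes "Deg \<GG> =o ord_of \<kappa>"
  shows "\<exists>A :: 'g set. coinitial_pos A \<and> (\<forall>B :: 'g set. coinitial_pos B \<longrightarrow> |A| \<le>o |B| ) \<and> |A| =o ord_of \<kappa>"
proof -
  define A where "A = (SOME A :: 'g set. coinitial_pos A \<and> (\<forall>B :: 'g set. coinitial_pos B \<longrightarrow> |A| \<le>o |B| ))"
  have "coinitial_pos A \<and> (\<forall>B :: 'g set. coinitial_pos B \<longrightarrow> |A| \<le>o |B| )"
    unfolding A_def by (rule someI_ex[OF ex_minimal_coinitial])
  moreover have "|A| =o ord_of \<kappa>"
    using assms by (simp add: Deg_def A_def)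
  ultimately show ?thesis by (intro exI[of _ A]) simp
qed

text \<open>
  A set of positive elements without a smaller positive element is coinitial, hence has size
  at least \<open>\<kappa>\<close>.
\<close>

lemma ex_below_small:
  fixes \<GG> :: "'g::linordered_ab_group_add itself" and B :: "'g set"
  assumes \<GG>: "Deg \<GG> =o ord_of \<kappa>" and B: "|B| <o ord_of \<kappa>" "\<And>b. b \<in> B \<Longrightarrow> 0 < b"
  shows "\<exists>\<epsilon>>0. \<forall>b\<in>B. \<epsilon> < b"
proof (rule ccontr)
  assume "\<not> ?thesis"
  then have co: "coinitial_pos B"
    using B(2) by (auto simp: coinitial_pos_def) (meson not_less)
  obtain A :: "'g set" where A: "\<And>B :: 'g set. coinitial_pos B \<Longrightarrow> |A| \<le>o |B|" "|A| =o ord_of \<kappa>"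
    using Deg_eq[OF \<GG>] by metis
  have "ord_of \<kappa> \<le>o |B|"
    using A(1)[OF co] A(2) ordIso_symmetric ordIso_ordLeq_trans by blast
  then show False
    using B(1) not_ordLess_ordLeq by blast
qed

lemma ex_coinitial_sequence:
  fixes \<GG> :: "'g::linordered_ab_group_add itself"
  assumes \<GG>: "Deg \<GG> =o ord_of \<kappa>"
  shows "\<exists>\<epsilon> :: 'k \<Rightarrow> 'g. (\<forall>\<alpha>. 0 < \<epsilon> \<alpha>) \<and> (\<forall>\<alpha> \<beta>. \<alpha> < \<beta> \<longrightarrow> \<epsilon> \<beta> < \<epsilon> \<alpha>) \<and> (\<forall>\<delta>>0. \<exists>\<alpha>. \<epsilon> \<alpha> < \<delta>)"
proof -
  obtain A :: "'g set" where A: "coinitial_pos A" "|A| =o ord_of \<kappa>"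
    using Deg_eq[OF \<GG>] by metis
  then have "|UNIV :: 'k set| =o |A|"
    using card_UNIV_\<kappa> ordIso_symmetric ordIso_transitive by blast
  then obtain a :: "'k \<Rightarrow> 'g" where "bij_betw a UNIV A"
    by (auto simp: card_of_ordIso[symmetric])
  then have a: "range a = A"
    by (simp add: bij_betw_def)
  define P where "P f \<alpha> r \<longleftrightarrow> 0 < r \<and> r < a \<alpha> \<and> (\<forall>\<beta><\<alpha>. r < f \<beta>)" for f :: "'k \<Rightarrow> 'g" and \<alpha> r
  have "\<exists>\<epsilon>. \<forall>\<alpha>. P \<epsilon> \<alpha> (\<epsilon> \<alpha>)"
  proof (rule dependent_wellorder_choice)
    fix \<alpha> f assume "\<And>\<beta>. \<beta> < \<alpha> \<Longrightarrow> P f \<beta> (f \<beta>)"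
    then have f: "\<And>\<beta>. \<beta> < \<alpha> \<Longrightarrow> 0 < f \<beta>"
      by (simp add: P_def)
    have "0 < a \<alpha>"
      using a A(1) by (auto simp: coinitial_pos_def)
    moreover have "|insert (a \<alpha>) (f ` {..<\<alpha>})| <o ord_of \<kappa>"
      using small_Un[OF small_countable[of "{a \<alpha>}"] small_image[OF small_lessThan, of f \<alpha>]] by simp
    ultimately have "\<exists>\<epsilon>>0. \<forall>b\<in>insert (a \<alpha>) (f ` {..<\<alpha>}). \<epsilon> < b"
      using f by (intro ex_below_small[OF \<GG>]) auto
    then show "\<exists>r. P f \<alpha> r"
      by (auto simp: P_def)
  qed (auto simp: P_def)
  then obtain \<epsilon> where "\<forall>\<alpha>. P \<epsilon> \<alpha> (\<epsilon> \<alpha>)" ..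
  then have \<epsilon>: "\<And>\<alpha>. 0 < \<epsilon> \<alpha>" "\<And>\<alpha>. \<epsilon> \<alpha> < a \<alpha>" "\<And>\<alpha> \<beta>. \<alpha> < \<beta> \<Longrightarrow> \<epsilon> \<beta> < \<epsilon> \<alpha>"
    by (simp_all add: P_def)
  have "\<exists>\<alpha>. \<epsilon> \<alpha> < \<delta>" if \<delta>: "0 < \<delta>" for \<delta>
  proof -
    obtain \<alpha> where "a \<alpha> \<le> \<delta>"
      using A(1) a \<delta> unfolding coinitial_pos_def by blast
    then show ?thesis
      using \<epsilon>(2)[of \<alpha>] by (intro exI[of _ \<alpha>]) simp
  qed
  then show ?thesis
    using \<epsilon> by (intro exI[of _ \<epsilon>]) simp
qed

end

section \<open>From a superclosed coding to a spherically complete metric\<close>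

text \<open>
  The ultrametric that measures where two sequences split. The scale \<open>\<epsilon>\<close> will be a decreasing
  coinitial sequence of positive elements.
\<close>

definition first_diff_metric ::
    "('k::wellorder \<Rightarrow> 'g::zero) \<Rightarrow> ('a \<Rightarrow> 'k \<Rightarrow> 'b) \<Rightarrow> 'a \<Rightarrow> 'a \<Rightarrow> 'g" where
  "first_diff_metric \<epsilon> h x y = (if h x = h y then 0 else \<epsilon> (LEAST \<beta>. h x \<beta> \<noteq> h y \<beta>))"

lemma first_diff_metric_less:
  fixes \<epsilon> :: "'k::wellorder \<Rightarrow> 'g::linordered_ab_group_add"
  assumes \<epsilon>: "\<And>\<alpha> \<beta>. \<alpha> < \<beta> \<Longrightarrow> \<epsilon> \<beta> < \<epsilon> \<alpha>" and "0 < \<delta>"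
    and above: "\<And>\<beta>. \<beta> < \<alpha> \<Longrightarrow> \<delta> \<le> \<epsilon> \<beta>" and below: "\<epsilon> \<alpha> < \<delta>"
  shows "first_diff_metric \<epsilon> h x y < \<delta> \<longleftrightarrow> (\<forall>\<beta><\<alpha>. h y \<beta> = h x \<beta>)"
proof (cases "h x = h y")
  case True
  then show ?thesis
    using \<open>0 < \<delta>\<close> by (simp add: first_diff_metric_def)
next
  case False
  define \<mu> where "\<mu> = (LEAST \<beta>. h x \<beta> \<noteq> h y \<beta>)"
  have ex: "\<exists>\<beta>. h x \<beta> \<noteq> h y \<beta>"
    using False by auto
  have d: "first_diff_metric \<epsilon> h x y = \<epsilon> \<mu>"
    using False by (simp add: first_diff_metric_def \<mu>_def)
  have ne: "h x \<mu> \<noteq> h y \<mu>"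
    unfolding \<mu>_def by (rule LeastI_ex[OF ex])
  have eq: "h x \<beta> = h y \<beta>" if "\<beta> < \<mu>" for \<beta>
    using not_less_Least that unfolding \<mu>_def by blast
  show ?thesis
  proof (cases "\<mu> < \<alpha>")
    case True
    then have "\<not> first_diff_metric \<epsilon> h x y < \<delta>"
      using above[OF True] d by simp
    then show ?thesis
      using True ne by force
  next
    case False
    then have "\<epsilon> \<mu> \<le> \<epsilon> \<alpha>"
      using \<epsilon>[of \<alpha> \<mu>] by (auto simp: not_less order_le_less)
    then have "first_diff_metric \<epsilon> h x y < \<delta>"
      using d below by simp
    moreover have "h y \<beta> = h x \<beta>" if "\<beta> < \<alpha>" for \<beta>
      using eq[of \<beta>] that False by simp
    ultimately show ?thesis by simp
  qed
qed

text \<open>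
  The height of the cylinder is the first \<open>\<alpha>\<close> with \<open>\<epsilon> \<alpha> < \<delta>\<close>. This is how completeness of the
  metric becomes a statement about the coding.
\<close>

lemma first_diff_metric_gball:
  fixes \<epsilon> :: "'k::wellorder \<Rightarrow> 'g::linordered_ab_group_add"
  assumes \<epsilon>: "\<And>\<alpha> \<beta>. \<alpha> < \<beta> \<Longrightarrow> \<epsilon> \<beta> < \<epsilon> \<alpha>" "\<And>\<delta>. 0 < \<delta> \<Longrightarrow> \<exists>\<alpha>. \<epsilon> \<alpha> < \<delta>"
    and "0 < \<delta>"
  shows "\<exists>\<alpha>. \<forall>x. gball S (first_diff_metric \<epsilon> h) x \<delta> = cylinder S h x \<alpha>"
proof -
  define \<alpha> where "\<alpha> = (LEAST \<alpha>. \<epsilon> \<alpha> < \<delta>)"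
  have "\<epsilon> \<alpha> < \<delta>"
    unfolding \<alpha>_def by (rule LeastI_ex[OF \<epsilon>(2)[OF \<open>0 < \<delta>\<close>]])
  moreover have "\<delta> \<le> \<epsilon> \<beta>" if "\<beta> < \<alpha>" for \<beta>
    using not_less_Least[of \<beta> "\<lambda>\<alpha>. \<epsilon> \<alpha> < \<delta>"] that unfolding \<alpha>_def by simp
  ultimately have "gball S (first_diff_metric \<epsilon> h) x \<delta> = cylinder S h x \<alpha>" for x
    using first_diff_metric_less[of \<epsilon> \<delta> \<alpha> h x, OF \<epsilon>(1) \<open>0 < \<delta>\<close>] by (simp add: gball_def cylinder_def)
  then show ?thesis by blast
qed

lemma gball_subset_cylinder:
  fixes \<epsilon> :: "'k::wellorder \<Rightarrow> 'g::linordered_ab_group_add"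
  assumes "\<And>\<alpha> \<beta>. \<alpha> < \<beta> \<Longrightarrow> \<epsilon> \<beta> < \<epsilon> \<alpha>" "\<And>\<delta>. 0 < \<delta> \<Longrightarrow> \<exists>\<alpha>. \<epsilon> \<alpha> < \<delta>" "\<And>\<alpha>. 0 < \<epsilon> \<alpha>"
  shows "gball S (first_diff_metric \<epsilon> h) x (\<epsilon> \<alpha>) \<subseteq> cylinder S h x \<alpha>"
proof
  fix y assume y: "y \<in> gball S (first_diff_metric \<epsilon> h) x (\<epsilon> \<alpha>)"
  have "h y \<beta> = h x \<beta>" if "\<beta> < \<alpha>" for \<beta>
  proof (rule ccontr)
    assume *: "h y \<beta> \<noteq> h x \<beta>"
    then have "(LEAST \<beta>. h x \<beta> \<noteq> h y \<beta>) \<le> \<beta>"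
      by (intro Least_le) simp
    then have "\<epsilon> \<alpha> < \<epsilon> (LEAST \<beta>. h x \<beta> \<noteq> h y \<beta>)"
      using that by (intro assms(1)) simp
    moreover have "h x \<noteq> h y"
      using * by auto
    ultimately show False
      using y by (auto simp: gball_def first_diff_metric_def dest: less_asym)
  qed
  then show "y \<in> cylinder S h x \<alpha>"
    using y by (simp add: cylinder_def gball_def)
qed

lemma first_diff_metric_group_metric:
  fixes \<epsilon> :: "'k::wellorder \<Rightarrow> 'g::linordered_ab_group_add"
  assumes anti: "\<And>\<alpha> \<beta>. \<alpha> < \<beta> \<Longrightarrow> \<epsilon> \<beta> < \<epsilon> \<alpha>" and pos: "\<And>\<alpha>. 0 < \<epsilon> \<alpha>"
    and inj: "\<And>x y. x \<in> S \<Longrightarrow> y \<in> S \<Longrightarrow> h x = h y \<Longrightarrow> x = y"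
  shows "group_metric_on S (first_diff_metric \<epsilon> h)"
proof -
  let ?d = "first_diff_metric \<epsilon> h"
  have nonneg: "0 \<le> ?d x y" for x y
    using pos by (simp add: first_diff_metric_def less_imp_le)
  have zero: "?d x y = 0 \<longleftrightarrow> h x = h y" for x y
    using pos by (simp add: first_diff_metric_def less_imp_neq[symmetric])
  have sym: "?d x y = ?d y x" for x y
    unfolding first_diff_metric_def by (simp add: eq_commute)
  have far: "\<epsilon> \<beta> \<le> ?d x y" if "h x \<beta> \<noteq> h y \<beta>" for x y \<beta>
  proof -
    let ?\<mu> = "LEAST \<beta>. h x \<beta> \<noteq> h y \<beta>"
    have "?\<mu> \<le> \<beta>"
      using that by (rule Least_le)
    then have "\<epsilon> \<beta> \<le> \<epsilon> ?\<mu>"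
      using anti[of ?\<mu> \<beta>] by (auto simp: order_le_less)
    moreover have "h x \<noteq> h y"
      using that by auto
    ultimately show ?thesis
      by (simp add: first_diff_metric_def)
  qed
  have "?d x z \<le> ?d x y + ?d y z" for x y z
  proof (cases "h x = h z")
    case True
    then have "?d x z = 0"
      by (simp add: zero)
    then show ?thesis
      using nonneg[of x y] nonneg[of y z] by simp
  next
    case False
    then have ex: "\<exists>\<beta>. h x \<beta> \<noteq> h z \<beta>"
      by auto
    let ?\<mu> = "LEAST \<beta>. h x \<beta> \<noteq> h z \<beta>"
    have "h x ?\<mu> \<noteq> h z ?\<mu>"
      by (rule LeastI_ex[OF ex])
    then have "h x ?\<mu> \<noteq> h y ?\<mu> \<or> h y ?\<mu> \<noteq> h z ?\<mu>"
      by metis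
    then have "\<epsilon> ?\<mu> \<le> ?d x y \<or> \<epsilon> ?\<mu> \<le> ?d y z"
      using far by blast
    then have "\<epsilon> ?\<mu> \<le> ?d x y + ?d y z"
      using nonneg[of x y] nonneg[of y z] add_mono[of "\<epsilon> ?\<mu>" "?d x y" 0 "?d y z"]
        add_mono[of 0 "?d x y" "\<epsilon> ?\<mu>" "?d y z"] by auto
    then show ?thesis
      using False by (simp add: first_diff_metric_def[of \<epsilon> h x z])
  qed
  moreover have "?d x y = 0 \<longleftrightarrow> x = y" if "x \<in> S" "y \<in> S" for x y
    using inj[OF that] by (auto simp: zero)
  ultimately show ?thesis
    unfolding group_metric_on_def using nonneg sym by (intro conjI ballI)
qed

context uncountable_regular
begin

text \<open>
  An initial segment of \<open>\<kappa>\<close> is empty, or has a maximum, or is a limit length; only the last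
  case uses the closure property of the coding.
\<close>

lemma superclosed_coding_initial_segment:
  fixes h :: "'a \<Rightarrow> 'k \<Rightarrow> 'b"
  assumes h: "superclosed_coding X h" and ne: "topspace X \<noteq> {}"
    and down: "\<And>\<alpha> \<beta>. \<alpha> \<in> D \<Longrightarrow> \<beta> \<le> \<alpha> \<Longrightarrow> \<beta> \<in> D"
    and s: "\<And>\<alpha>. \<alpha> \<in> D \<Longrightarrow> \<exists>x\<in>topspace X. \<forall>\<beta>\<le>\<alpha>. h x \<beta> = s \<beta>"
  shows "\<exists>x\<in>topspace X. \<forall>\<beta>\<in>D. h x \<beta> = s \<beta>"
proof (cases "\<exists>\<alpha>\<in>D. \<forall>\<beta>\<in>D. \<beta> \<le> \<alpha>")
  case True
  then obtain \<alpha> where \<alpha>: "\<alpha> \<in> D" "\<And>\<beta>. \<beta> \<in> D \<Longrightarrow> \<beta> \<le> \<alpha>"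
    by auto
  obtain x where "x \<in> topspace X" "\<forall>\<beta>\<le>\<alpha>. h x \<beta> = s \<beta>"
    using s[OF \<alpha>(1)] by auto
  then show ?thesis
    using \<alpha>(2) by (intro bexI[of _ x]) auto
next
  case no_max: False
  show ?thesis
  proof (cases "D = {}")
    case True
    then show ?thesis using ne by blast
  next
    case False
    have "D \<in> limit_lengths"
    proof (cases "D = UNIV")
      case True
      then show ?thesis by (simp add: limit_lengths_def)
    next
      case False
      then have ex: "\<exists>\<gamma>. \<gamma> \<notin> D" by auto
      define \<gamma> where "\<gamma> = (LEAST \<gamma>. \<gamma> \<notin> D)"
      have \<gamma>: "\<gamma> \<notin> D"
        unfolding \<gamma>_def by (rule LeastI_ex[OF ex])
      have D: "D = {..<\<gamma>}"
      proof (intro set_eqI iffI)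
        fix \<beta> assume "\<beta> \<in> D"
        then show "\<beta> \<in> {..<\<gamma>}"
          using \<gamma> down[of \<beta> \<gamma>] by (metis lessThan_iff not_le)
      next
        fix \<beta> assume "\<beta> \<in> {..<\<gamma>}"
        then show "\<beta> \<in> D"
          using not_less_Least[of \<beta> "\<lambda>\<gamma>. \<gamma> \<notin> D"] by (simp add: \<gamma>_def)
      qed
      have "\<exists>\<beta>. \<beta> < \<gamma>"
        using \<open>D \<noteq> {}\<close> D by auto
      moreover have "\<exists>\<delta>. \<beta> < \<delta> \<and> \<delta> < \<gamma>" if "\<beta> < \<gamma>" for \<beta>
        using no_max that unfolding D by (auto simp: not_le)
      ultimately have "is_limit \<gamma>"
        by (simp add: is_limit_def)
      then show ?thesis
        using D by (auto simp: limit_lengths_def)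
    qed
    then show ?thesis
      using h s unfolding superclosed_coding_def by simp
  qed
qed

text \<open>
  Two comparable cylinders prescribe the same labels on the coordinates that both of them fix.
  So a chain of cylinders prescribes a single sequence, on an initial segment of \<open>\<kappa>\<close>, all of
  whose proper parts are realized by the centres; a point that realizes the whole sequence is
  in the intersection. The chain may have any length.
\<close>

lemma cylinder_chain_Inter_nonempty:
  fixes h :: "'a \<Rightarrow> 'k \<Rightarrow> 'b"
  assumes h: "superclosed_coding X h" and ne: "I \<noteq> {}"
    and B: "\<And>i. i \<in> I \<Longrightarrow> \<exists>x\<in>topspace X. \<exists>\<alpha>. B i = cylinder (topspace X) h x \<alpha>"
    and chain: "\<And>i j. i \<in> I \<Longrightarrow> j \<in> I \<Longrightarrow> B i \<subseteq> B j \<or> B j \<subseteq> B i"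
  shows "(\<Inter>i\<in>I. B i) \<noteq> {}"
proof -
  obtain x where x: "\<And>i. i \<in> I \<Longrightarrow> x i \<in> topspace X \<and> (\<exists>\<alpha>. B i = cylinder (topspace X) h (x i) \<alpha>)"
    using B by metis
  then obtain \<alpha> where \<alpha>: "\<And>i. i \<in> I \<Longrightarrow> B i = cylinder (topspace X) h (x i) (\<alpha> i)"
    by metis
  have mem: "x i \<in> B i" if "i \<in> I" for i
    using x[OF that] \<alpha>[OF that] by (simp add: self_in_cylinder)
  have agree: "h (x i) \<beta> = h (x j) \<beta>" if ij: "i \<in> I" "j \<in> I" "\<beta> < \<alpha> i" "\<beta> < \<alpha> j" for i j \<beta>
    using chain[OF ij(1,2)]
  proof
    assume "B i \<subseteq> B j"
    then have "x i \<in> cylinder (topspace X) h (x j) (\<alpha> j)"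
      using mem[OF ij(1)] \<alpha>[OF ij(2)] by auto
    then show ?thesis using ij by (simp add: cylinder_def)
  next
    assume "B j \<subseteq> B i"
    then have "x j \<in> cylinder (topspace X) h (x i) (\<alpha> i)"
      using mem[OF ij(2)] \<alpha>[OF ij(1)] by auto
    then show ?thesis using ij by (simp add: cylinder_def)
  qed
  define D where "D = (\<Union>i\<in>I. {..<\<alpha> i})"
  define s where "s \<beta> = h (x (SOME i. i \<in> I \<and> \<beta> < \<alpha> i)) \<beta>" for \<beta>
  have s: "s \<beta> = h (x i) \<beta>" if i: "i \<in> I" "\<beta> < \<alpha> i" for i \<beta>
  proof -
    have "(SOME i. i \<in> I \<and> \<beta> < \<alpha> i) \<in> I \<and> \<beta> < \<alpha> (SOME i. i \<in> I \<and> \<beta> < \<alpha> i)"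
      by (rule someI[of _ i]) (use i in simp)
    then show ?thesis
      unfolding s_def using agree i by metis
  qed
  have "\<exists>z\<in>topspace X. \<forall>\<beta>\<in>D. h z \<beta> = s \<beta>"
  proof (rule superclosed_coding_initial_segment[OF h])
    show "topspace X \<noteq> {}"
      using ne x by auto
    show "\<beta> \<in> D" if "\<gamma> \<in> D" "\<beta> \<le> \<gamma>" for \<beta> \<gamma>
      using that by (auto simp: D_def intro: le_less_trans)
    fix \<beta> assume "\<beta> \<in> D"
    then obtain i where i: "i \<in> I" "\<beta> < \<alpha> i"
      by (auto simp: D_def)
    then have "\<forall>\<gamma>\<le>\<beta>. h (x i) \<gamma> = s \<gamma>"
      using s[OF i(1)] by auto
    then show "\<exists>z\<in>topspace X. \<forall>\<gamma>\<le>\<beta>. h z \<gamma> = s \<gamma>"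
      using x[OF i(1)] by auto
  qed
  then obtain z where z: "z \<in> topspace X" "\<And>\<beta>. \<beta> \<in> D \<Longrightarrow> h z \<beta> = s \<beta>"
    by auto
  have "z \<in> B i" if i: "i \<in> I" for i
  proof -
    have "h z \<beta> = h (x i) \<beta>" if "\<beta> < \<alpha> i" for \<beta>
      using z(2)[of \<beta>] s[OF i that] i that by (auto simp: D_def)
    then show ?thesis
      using z(1) \<alpha>[OF i] by (simp add: cylinder_def)
  qed
  then show ?thesis by auto
qed

lemma coding_inj:
  assumes "superclosed_coding X h" "Hausdorff_space X" "x \<in> topspace X" "y \<in> topspace X" "h x = h y"
  shows "x = y"
proof (rule ccontr)
  assume "x \<noteq> y"
  then obtain U where U: "openin X U" "x \<in> U" "y \<notin> U"
    using assms(2-4) unfolding Hausdorff_space_def disjnt_def by (metis disjoint_iff)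
  then obtain \<alpha> where "cylinder (topspace X) h x \<alpha> \<subseteq> U"
    using assms(1) unfolding superclosed_coding_def by metis
  moreover have "y \<in> cylinder (topspace X) h x \<alpha>"
    using assms(4,5) by (simp add: cylinder_def)
  ultimately show False using U by auto
qed

lemma superclosed_coding_UNIV:
  fixes h :: "'a \<Rightarrow> 'k \<Rightarrow> 'b"
  assumes "superclosed_coding X h" "\<And>\<alpha>. \<exists>x\<in>topspace X. \<forall>\<beta>\<le>\<alpha>. h x \<beta> = s \<beta>"
  shows "\<exists>x\<in>topspace X. h x = s"
proof -
  have "\<exists>x\<in>topspace X. \<forall>\<beta>\<in>UNIV. h x \<beta> = s \<beta>"
    using assms by (intro superclosed_coding_initial_segment) auto
  then show ?thesis by (auto simp: fun_eq_iff)
qed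

text \<open>
  Spherical completeness is the statement about chains of cylinders. A Cauchy sequence has
  eventually constant coordinates; the limits of the coordinates are realized up to any
  \<open>\<alpha> < \<kappa>\<close>, hence by a point.
\<close>

theorem superclosed_coding_imp_metric:
  fixes \<GG> :: "'g::linordered_ab_group_add itself" and h :: "'a \<Rightarrow> 'k \<Rightarrow> 'b"
  assumes \<GG>: "Deg \<GG> =o ord_of \<kappa>" and h: "superclosed_coding X h" and haus: "Hausdorff_space X"
  shows "\<exists>d :: 'a \<Rightarrow> 'a \<Rightarrow> 'g. compatible_metric X d \<and> Cauchy_complete_metric \<kappa> (topspace X) d \<and>
           spherically_complete (topspace X) d"
proof -
  let ?S = "topspace X"
  from ex_coinitial_sequence[OF \<GG>] obtain \<epsilon> :: "'k \<Rightarrow> 'g" where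
    *: "(\<forall>\<alpha>. 0 < \<epsilon> \<alpha>) \<and> (\<forall>\<alpha> \<beta>. \<alpha> < \<beta> \<longrightarrow> \<epsilon> \<beta> < \<epsilon> \<alpha>) \<and> (\<forall>\<delta>>0. \<exists>\<alpha>. \<epsilon> \<alpha> < \<delta>)" ..
  then have pos: "\<And>\<alpha>. 0 < \<epsilon> \<alpha>" and anti: "\<And>\<alpha> \<beta>. \<alpha> < \<beta> \<Longrightarrow> \<epsilon> \<beta> < \<epsilon> \<alpha>"
    and coin: "\<And>\<delta>. 0 < \<delta> \<Longrightarrow> \<exists>\<alpha>. \<epsilon> \<alpha> < \<delta>"
    by simp_all
  define d where "d = first_diff_metric \<epsilon> h"
  have ball_cylinder: "\<exists>\<alpha>. \<forall>x. gball ?S d x \<delta> = cylinder ?S h x \<alpha>" if "0 < \<delta>" for \<delta>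
    unfolding d_def by (rule first_diff_metric_gball[OF anti coin that])
  have small_ball: "gball ?S d x (\<epsilon> \<alpha>) \<subseteq> cylinder ?S h x \<alpha>" for x \<alpha>
    unfolding d_def by (rule gball_subset_cylinder[OF anti coin pos])
  have metric: "group_metric_on ?S d"
    unfolding d_def by (rule first_diff_metric_group_metric[OF anti pos coding_inj[OF h haus]])
  have "openin X U \<longleftrightarrow> U \<subseteq> ?S \<and> (\<forall>x\<in>U. \<exists>\<delta>>0. gball ?S d x \<delta> \<subseteq> U)" for U
  proof
    assume U: "openin X U"
    have "\<exists>\<delta>>0. gball ?S d x \<delta> \<subseteq> U" if x: "x \<in> U" for x
    proof -
      obtain \<alpha> where "cylinder ?S h x \<alpha> \<subseteq> U"
        using h U x unfolding superclosed_coding_def by metis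
      then show ?thesis
        using small_ball[of x \<alpha>] pos[of \<alpha>] by (intro exI[of _ "\<epsilon> \<alpha>"]) simp
    qed
    then show "U \<subseteq> ?S \<and> (\<forall>x\<in>U. \<exists>\<delta>>0. gball ?S d x \<delta> \<subseteq> U)"
      using openin_subset[OF U] by simp
  next
    assume U: "U \<subseteq> ?S \<and> (\<forall>x\<in>U. \<exists>\<delta>>0. gball ?S d x \<delta> \<subseteq> U)"
    show "openin X U"
    proof (subst openin_subopen, intro ballI)
      fix x assume x: "x \<in> U"
      then obtain \<delta> where \<delta>: "0 < \<delta>" "gball ?S d x \<delta> \<subseteq> U"
        using U by auto
      obtain \<alpha> where \<alpha>: "gball ?S d x \<delta> = cylinder ?S h x \<alpha>"
        using ball_cylinder[OF \<delta>(1)] by auto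
      have xS: "x \<in> ?S" using U x by auto
      then have "openin X (cylinder ?S h x \<alpha>)"
        using h by (simp add: superclosed_coding_def)
      then show "\<exists>T. openin X T \<and> x \<in> T \<and> T \<subseteq> U"
        using \<delta>(2) \<alpha> self_in_cylinder[OF xS] by (intro exI[of _ "cylinder ?S h x \<alpha>"]) simp
    qed
  qed
  moreover have "\<exists>\<epsilon>::'g. 0 < \<epsilon>"
    using pos by (rule exI)
  ultimately have compat: "compatible_metric X d"
    using metric by (subst compatible_metric_iff) simp_all
  have "Cauchy_complete_metric \<kappa> ?S d"
    unfolding Cauchy_complete_metric_def
  proof (intro allI impI)
    fix t :: "'k \<Rightarrow> 'a"
    assume t: "range t \<subseteq> ?S \<and> (\<forall>\<epsilon>>0. \<exists>\<alpha>. \<forall>\<beta>\<ge>\<alpha>. \<forall>\<gamma>\<ge>\<alpha>. d (t \<beta>) (t \<gamma>) < \<epsilon>)"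
    have tS: "t \<beta> \<in> ?S" for \<beta>
      using t by auto
    have "\<exists>\<beta>. \<forall>\<gamma>\<ge>\<beta>. \<forall>\<xi>\<le>\<alpha>. h (t \<gamma>) \<xi> = h (t \<beta>) \<xi>" for \<alpha>
    proof -
      \<comment> \<open>cylinders of height \<open>\<alpha>'\<close> only fix coordinates strictly below \<open>\<alpha>'\<close>\<close>
      obtain \<alpha>' where \<alpha>': "\<alpha> < \<alpha>'"
        using ex_greater by auto
      obtain \<beta> where \<beta>: "\<forall>\<delta>\<ge>\<beta>. \<forall>\<gamma>\<ge>\<beta>. d (t \<delta>) (t \<gamma>) < \<epsilon> \<alpha>'"
        using t pos[of \<alpha>'] by auto
      have "h (t \<gamma>) \<xi> = h (t \<beta>) \<xi>" if "\<beta> \<le> \<gamma>" "\<xi> \<le> \<alpha>" for \<gamma> \<xi>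
      proof -
        have "t \<gamma> \<in> gball ?S d (t \<beta>) (\<epsilon> \<alpha>')"
          using \<beta> that tS by (simp add: gball_def)
        then have "t \<gamma> \<in> cylinder ?S h (t \<beta>) \<alpha>'"
          using small_ball by auto
        then show ?thesis
          using that \<alpha>' by (simp add: cylinder_def)
      qed
      then show ?thesis by (intro exI[of _ \<beta>] allI impI)
    qed
    then have "\<forall>\<alpha>. \<exists>\<beta>. \<forall>\<gamma>\<ge>\<beta>. \<forall>\<xi>\<le>\<alpha>. h (t \<gamma>) \<xi> = h (t \<beta>) \<xi>" ..
    from choice[OF this] obtain b where "\<forall>\<alpha>. \<forall>\<gamma>\<ge>b \<alpha>. \<forall>\<xi>\<le>\<alpha>. h (t \<gamma>) \<xi> = h (t (b \<alpha>)) \<xi>" ..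
    then have b: "\<And>\<alpha> \<gamma> \<xi>. b \<alpha> \<le> \<gamma> \<Longrightarrow> \<xi> \<le> \<alpha> \<Longrightarrow> h (t \<gamma>) \<xi> = h (t (b \<alpha>)) \<xi>"
      by blast
    define s where "s \<xi> = h (t (b \<xi>)) \<xi>" for \<xi>
    have s: "h (t \<gamma>) \<xi> = s \<xi>" if "b \<alpha> \<le> \<gamma>" "\<xi> \<le> \<alpha>" for \<alpha> \<gamma> \<xi>
    proof -
      have "h (t \<gamma>) \<xi> = h (t (max \<gamma> (b \<xi>))) \<xi>"
        using b[OF that] b[of \<alpha> "max \<gamma> (b \<xi>)" \<xi>] that by (simp add: le_max_iff_disj)
      also have "\<dots> = s \<xi>"
        using b[of \<xi> "max \<gamma> (b \<xi>)" \<xi>] by (simp add: s_def)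
      finally show ?thesis .
    qed
    have "\<exists>z\<in>?S. h z = s"
    proof (rule superclosed_coding_UNIV[OF h])
      fix \<alpha>
      show "\<exists>x\<in>?S. \<forall>\<beta>\<le>\<alpha>. h x \<beta> = s \<beta>"
        using s[OF order_refl] tS by (intro bexI[of _ "t (b \<alpha>)"]) simp_all
    qed
    then obtain z where z: "z \<in> ?S" "h z = s"
      by auto
    have "limitin X t z at_top"
      unfolding limitin_def
    proof (intro conjI allI impI)
      show "z \<in> ?S" by (rule z)
      fix U assume U: "openin X U \<and> z \<in> U"
      then obtain \<alpha> where \<alpha>: "cylinder ?S h z \<alpha> \<subseteq> U"
        using h unfolding superclosed_coding_def by metis
      have "t \<gamma> \<in> U" if "b \<alpha> \<le> \<gamma>" for \<gamma>
      proof -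
        have "t \<gamma> \<in> cylinder ?S h z \<alpha>"
          using s[OF that] tS z by (simp add: cylinder_def)
        then show ?thesis using \<alpha> by auto
      qed
      then show "\<forall>\<^sub>F \<gamma> in at_top. t \<gamma> \<in> U"
        unfolding eventually_at_top_linorder by auto
    qed
    moreover have "topology_generated_by (open_balls ?S d) = X"
      using compat by (simp add: compatible_metric_def)
    ultimately show "\<exists>x. limitin (topology_generated_by (open_balls ?S d)) t x at_top"
      by auto
  qed
  moreover have "spherically_complete ?S d"
    unfolding spherically_complete_def
  proof (intro allI impI)
    fix r :: "'a set rel" and B assume dec: "decreasing_balls ?S d r B"
    show "(\<Inter>i\<in>Field r. B i) \<noteq> {}"
    proof (rule cylinder_chain_Inter_nonempty[OF h])
      show "Field r \<noteq> {}"
        using dec by (simp add: decreasing_balls_def)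
      fix i assume i: "i \<in> Field r"
      then have "B i \<in> open_balls ?S d"
        using dec by (simp add: decreasing_balls_def)
      then obtain x \<delta> where x: "x \<in> ?S" "0 < \<delta>" "B i = gball ?S d x \<delta>"
        by (auto simp: open_balls_eq)
      then show "\<exists>x\<in>?S. \<exists>\<alpha>. B i = cylinder ?S h x \<alpha>"
        using ball_cylinder[OF x(2)] by metis
      fix j assume j: "j \<in> Field r"
      have "(i, j) \<in> r \<or> (j, i) \<in> r"
        using dec i j by (cases "i = j") (auto simp: decreasing_balls_def well_order_on_def
            linear_order_on_def partial_order_on_def preorder_on_def refl_on_def total_on_def)
      then show "B i \<subseteq> B j \<or> B j \<subseteq> B i"
        using dec by (auto simp: decreasing_balls_def)
    qed
  qed
  ultimately show ?thesis
    using compat by auto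
qed

end

section \<open>From a metric to a winning strategy\<close>

context uncountable_regular
begin

lemma ex_smaller_pos:
  fixes \<GG> :: "'g::linordered_ab_group_add itself"
  assumes "Deg \<GG> =o ord_of \<kappa>" "0 < (\<epsilon>::'g)"
  shows "\<exists>\<delta>>0. \<delta> < \<epsilon>"
  using ex_below_small[OF assms(1) small_countable[of "{\<epsilon>}"]] assms(2) by simp

lemma ex_half:
  fixes \<GG> :: "'g::linordered_ab_group_add itself"
  assumes \<GG>: "Deg \<GG> =o ord_of \<kappa>" and "0 < (\<epsilon>::'g)"
  shows "\<exists>\<delta>>0. \<delta> + \<delta> \<le> \<epsilon>"
proof -
  obtain \<delta> where \<delta>: "0 < \<delta>" "\<delta> < \<epsilon>"
    using ex_smaller_pos[OF assms] by auto
  have "min \<delta> (\<epsilon> - \<delta>) + min \<delta> (\<epsilon> - \<delta>) \<le> \<delta> + (\<epsilon> - \<delta>)"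
    by (intro add_mono) simp_all
  then show ?thesis
    using \<delta> by (intro exI[of _ "min \<delta> (\<epsilon> - \<delta>)"]) simp
qed

context
  fixes \<GG> :: "'g::linordered_ab_group_add itself" and X :: "'a topology" and d :: "'a \<Rightarrow> 'a \<Rightarrow> 'g"
  assumes \<GG>: "Deg \<GG> =o ord_of \<kappa>" and compat: "compatible_metric X d"
begin

lemma group_metric: "group_metric_on (topspace X) d"
  using compat by (simp add: compatible_metric_def)

lemma openin_metric:
  "openin X U \<longleftrightarrow> U \<subseteq> topspace X \<and> (\<forall>x\<in>U. \<exists>\<epsilon>>0. gball (topspace X) d x \<epsilon> \<subseteq> U)"
proof -
  have "\<exists>\<epsilon>::'g. 0 < \<epsilon>"
    using ex_below_small[OF \<GG> small_countable[of "{}"]] by auto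
  then show ?thesis
    using compat by (simp add: compatible_metric_iff)
qed

lemma metric_triangle:
  "x \<in> topspace X \<Longrightarrow> y \<in> topspace X \<Longrightarrow> z \<in> topspace X \<Longrightarrow> d x z \<le> d x y + d y z"
  using group_metric by (simp add: group_metric_on_def)

lemma metric_sym: "x \<in> topspace X \<Longrightarrow> y \<in> topspace X \<Longrightarrow> d x y = d y x"
  using group_metric by (simp add: group_metric_on_def)

lemma openin_gball: "x \<in> topspace X \<Longrightarrow> openin X (gball (topspace X) d x \<epsilon>)"
  unfolding openin_metric using gball_inside[OF group_metric] by (auto simp: gball_def)

text \<open>
  Open balls need not be closed; player II will nest them with closed balls in between.
\<close>

lemma closedin_closed_ball:
  assumes x: "x \<in> topspace X"
  shows "closedin X {y \<in> topspace X. d x y \<le> \<delta>}"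
proof -
  let ?U = "{y \<in> topspace X. \<delta> < d x y}"
  have "\<exists>\<epsilon>>0. gball (topspace X) d y \<epsilon> \<subseteq> ?U" if y: "y \<in> ?U" for y
  proof (intro exI[of _ "d x y - \<delta>"] conjI subsetI)
    show "0 < d x y - \<delta>"
      using y by simp
    fix z assume "z \<in> gball (topspace X) d y (d x y - \<delta>)"
    then have z: "z \<in> topspace X" "d y z < d x y - \<delta>"
      by (simp_all add: gball_def)
    have "d x y \<le> d x z + d y z"
      using metric_triangle[of x z y] metric_sym[of z y] x y z by simp
    also have "\<dots> < d x z + (d x y - \<delta>)"
      using z(2) by (rule add_strict_left_mono)
    finally have "\<delta> < d x z"
      by (simp add: algebra_simps)
    then show "z \<in> ?U" using z(1) by simp
  qed
  then have "openin X ?U"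
    unfolding openin_metric[of ?U] by auto
  moreover have "topspace X - {y \<in> topspace X. d x y \<le> \<delta>} = ?U"
    by (auto simp: not_le)
  ultimately show ?thesis
    unfolding closedin_def by auto
qed

lemma metric_additive: "kappa_additive \<kappa> X"
  unfolding kappa_additive_def
proof (intro allI impI)
  fix \<U> assume \<U>: "\<U> \<noteq> {} \<and> |\<U>| <o ord_of \<kappa> \<and> (\<forall>U\<in>\<U>. openin X U)"
  have "\<exists>\<epsilon>>0. gball (topspace X) d x \<epsilon> \<subseteq> \<Inter>\<U>" if x: "x \<in> \<Inter>\<U>" for x
  proof -
    have "\<forall>U\<in>\<U>. \<exists>\<epsilon>>0. gball (topspace X) d x \<epsilon> \<subseteq> U"
      using \<U> x openin_metric by auto
    then obtain e where e: "\<forall>U\<in>\<U>. 0 < e U \<and> gball (topspace X) d x (e U) \<subseteq> U"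
      by metis
    then have "\<exists>\<epsilon>>0. \<forall>b\<in>e ` \<U>. \<epsilon> < b"
      using \<U> by (intro ex_below_small[OF \<GG>] small_image) auto
    then obtain \<epsilon> where \<epsilon>: "0 < \<epsilon>" "\<And>U. U \<in> \<U> \<Longrightarrow> \<epsilon> < e U"
      by auto
    have "gball (topspace X) d x \<epsilon> \<subseteq> U" if U: "U \<in> \<U>" for U
      using gball_mono[OF less_imp_le[OF \<epsilon>(2)[OF U]], of "topspace X" d x] e U by (meson subset_trans)
    then show ?thesis
      using \<epsilon>(1) by (intro exI[of _ \<epsilon>]) auto
  qed
  moreover have "\<Inter>\<U> \<subseteq> topspace X"
    using \<U> openin_subset by auto
  ultimately show "openin X (\<Inter>\<U>)"
    unfolding openin_metric[of "\<Inter>\<U>"] by simp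
qed

text \<open>
  For each scale \<open>\<epsilon> \<alpha>\<close> fewer than \<open>\<kappa>\<close> balls of that radius cover the space.
\<close>

lemma metric_weight:
  assumes Lin: "kappa_Lindelof \<kappa> X"
  shows "weight_le \<kappa> X"
proof -
  let ?S = "topspace X"
  from ex_coinitial_sequence[OF \<GG>] obtain \<epsilon> :: "'k \<Rightarrow> 'g" where
    *: "(\<forall>\<alpha>. 0 < \<epsilon> \<alpha>) \<and> (\<forall>\<alpha> \<beta>. \<alpha> < \<beta> \<longrightarrow> \<epsilon> \<beta> < \<epsilon> \<alpha>) \<and> (\<forall>\<delta>>0. \<exists>\<alpha>. \<epsilon> \<alpha> < \<delta>)" ..
  then have pos: "\<And>\<alpha>. 0 < \<epsilon> \<alpha>" and coin: "\<And>\<delta>. 0 < \<delta> \<Longrightarrow> \<exists>\<alpha>. \<epsilon> \<alpha> < \<delta>"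
    by simp_all
  define \<C> where "\<C> \<alpha> = (\<lambda>x. gball ?S d x (\<epsilon> \<alpha>)) ` ?S" for \<alpha>
  have "\<exists>\<V>. |\<V>| <o ord_of \<kappa> \<and> \<V> \<subseteq> \<C> \<alpha> \<and> \<Union>\<V> = ?S" for \<alpha>
  proof -
    have "\<Union>(\<C> \<alpha>) = ?S"
      using self_in_gball[OF group_metric _ pos[of \<alpha>]] by (auto simp: \<C>_def gball_def)
    moreover have "\<forall>U\<in>\<C> \<alpha>. openin X U"
      using openin_gball by (auto simp: \<C>_def)
    ultimately show ?thesis
      using Lin[unfolded kappa_Lindelof_def, rule_format, of "\<C> \<alpha>"] by simp
  qed
  then obtain \<V> where \<V>: "\<And>\<alpha>. |\<V> \<alpha>| <o ord_of \<kappa>" "\<And>\<alpha>. \<V> \<alpha> \<subseteq> \<C> \<alpha>" "\<And>\<alpha>. \<Union>(\<V> \<alpha>) = ?S"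
    by metis
  let ?\<B> = "\<Union>\<alpha>\<in>UNIV. \<V> \<alpha>"
  have "|?\<B>| \<le>o ord_of \<kappa>"
  proof (rule card_of_UNION_ordLeq_infinite_Field[OF _ Card_order_\<kappa>])
    show "infinite (Field (ord_of \<kappa>))"
      using infinite_\<kappa> by simp
    show "|UNIV :: 'k set| \<le>o ord_of \<kappa>"
      using card_UNIV_\<kappa> ordIso_iff_ordLeq by blast
    show "\<forall>\<alpha>\<in>UNIV. |\<V> \<alpha>| \<le>o ord_of \<kappa>"
      using \<V>(1) ordLess_imp_ordLeq by blast
  qed
  moreover have "openin X V" if "V \<in> ?\<B>" for V
    using that \<V>(2) openin_gball unfolding \<C>_def by blast
  moreover have "\<exists>V\<in>?\<B>. x \<in> V \<and> V \<subseteq> U" if U: "openin X U" "x \<in> U" for U x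
  proof -
    obtain \<delta> where \<delta>: "0 < \<delta>" "gball ?S d x \<delta> \<subseteq> U"
      using U openin_metric[of U] by auto
    obtain \<delta>' where \<delta>': "0 < \<delta>'" "\<delta>' + \<delta>' \<le> \<delta>"
      using ex_half[OF \<GG> \<delta>(1)] by auto
    obtain \<alpha> where \<alpha>: "\<epsilon> \<alpha> < \<delta>'"
      using coin[OF \<delta>'(1)] by auto
    have xS: "x \<in> ?S"
      using U openin_subset by blast
    then obtain V where V: "V \<in> \<V> \<alpha>" "x \<in> V"
      using \<V>(3)[of \<alpha>] by blast
    then obtain y where y: "y \<in> ?S" "V = gball ?S d y (\<epsilon> \<alpha>)"
      using \<V>(2)[of \<alpha>] by (auto simp: \<C>_def)
    have "z \<in> gball ?S d x \<delta>" if z: "z \<in> V" for z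
    proof -
      have zS: "z \<in> ?S" "d y z < \<delta>'" "d y x < \<delta>'"
        using z V(2) y(2) \<alpha> by (auto simp: gball_def)
      have "d x z \<le> d y x + d y z"
        using metric_triangle[OF xS y(1) zS(1)] metric_sym[OF xS y(1)] by simp
      also have "\<dots> < \<delta>' + \<delta>'"
        using zS by (intro add_strict_mono)
      finally show ?thesis
        using \<delta>'(2) zS(1) by (simp add: gball_def)
    qed
    then have "V \<subseteq> U" using \<delta>(2) by auto
    then show ?thesis
      using V by (intro bexI[of _ V]) auto
  qed
  ultimately show ?thesis
    unfolding weight_le_def by (intro exI[of _ ?\<B>]) simp
qed

text \<open>
  II answers the move \<open>m\<close> with a ball around the point played whose closed version still fits
  into the open set played. The intermediate closed set \<open>C\<close> serves at stage \<open>\<kappa>\<close>.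
\<close>

definition shrunken_ball :: "'a set \<times> 'a \<Rightarrow> 'a set \<Rightarrow> bool" where
  "shrunken_ball m V \<longleftrightarrow> V \<in> open_balls (topspace X) d \<and> snd m \<in> V \<and>
     (\<exists>C. closedin X C \<and> V \<subseteq> C \<and> C \<subseteq> fst m)"

lemma ex_shrunken_ball:
  assumes "openin X (fst m)" "snd m \<in> fst m"
  shows "\<exists>V. shrunken_ball m V"
proof -
  let ?S = "topspace X" and ?x = "snd m"
  have x: "?x \<in> ?S"
    using assms openin_subset by blast
  obtain \<epsilon> where \<epsilon>: "0 < \<epsilon>" "gball ?S d ?x \<epsilon> \<subseteq> fst m"
    using assms openin_metric[of "fst m"] by auto
  obtain \<delta> where \<delta>: "0 < \<delta>" "\<delta> < \<epsilon>"
    using ex_smaller_pos[OF \<GG> \<epsilon>(1)] by auto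
  have "gball ?S d ?x \<delta> \<in> open_balls ?S d"
    using x \<delta>(1) by (auto simp: open_balls_eq)
  moreover have "?x \<in> gball ?S d ?x \<delta>"
    by (rule self_in_gball[OF group_metric x \<delta>(1)])
  moreover have "{y \<in> ?S. d ?x y \<le> \<delta>} \<subseteq> fst m"
    using \<epsilon>(2) \<delta>(2) by (auto simp: gball_def)
  moreover have "gball ?S d ?x \<delta> \<subseteq> {y \<in> ?S. d ?x y \<le> \<delta>}"
    by (auto simp: gball_def)
  ultimately have "shrunken_ball m (gball ?S d ?x \<delta>)"
    unfolding shrunken_ball_def using closedin_closed_ball[OF x, of \<delta>] by blast
  then show ?thesis by fast
qed

lemma shrunken_balls_legal:
  fixes m :: "'k \<Rightarrow> 'a set \<times> 'a"
  assumes V: "\<And>\<alpha>. \<exists>W. shrunken_ball (m \<alpha>) W \<Longrightarrow> shrunken_ball (m \<alpha>) (V \<alpha>)"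
    and legal: "\<And>\<beta>. \<beta> \<le> \<alpha> \<Longrightarrow> legal_I X m V \<beta>"
  shows "shrunken_ball (m \<alpha>) (V \<alpha>)" and "fst (m \<alpha>) \<subseteq> remaining X V {..<\<alpha>}"
    and "legal_II X m V \<alpha>"
proof -
  have ball: "shrunken_ball (m \<alpha>) (V \<alpha>) \<and> openin X (fst (m \<alpha>)) \<and> fst (m \<alpha>) \<subseteq> remaining X V {..<\<alpha>}"
    using legal
  proof (induction \<alpha> rule: less_induct)
    case (less \<alpha>)
    have "openin X (V \<beta>)" if "\<beta> < \<alpha>" for \<beta>
    proof -
      have "shrunken_ball (m \<beta>) (V \<beta>)"
        using less.IH[OF that] less.prems that by simp
      then show ?thesis
        using openin_gball by (auto simp: shrunken_ball_def open_balls_eq)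
    qed
    then have "openin X (remaining X V {..<\<alpha>})"
      unfolding remaining_def by (intro openin_small_INT[OF metric_additive small_lessThan]) simp
    moreover have *: "openin (subtopology X (remaining X V {..<\<alpha>})) (fst (m \<alpha>))" "snd (m \<alpha>) \<in> fst (m \<alpha>)"
      using less.prems[of \<alpha>] by (simp_all add: legal_I_def)
    ultimately have op: "openin X (fst (m \<alpha>))"
      using openin_trans_full by blast
    moreover have "shrunken_ball (m \<alpha>) (V \<alpha>)"
      by (rule V[OF ex_shrunken_ball[OF op *(2)]])
    moreover have "fst (m \<alpha>) \<subseteq> remaining X V {..<\<alpha>}"
      using openin_subset[OF *(1)] by auto
    ultimately show ?case by simp
  qed
  then show "shrunken_ball (m \<alpha>) (V \<alpha>)" and "fst (m \<alpha>) \<subseteq> remaining X V {..<\<alpha>}"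
    by simp_all
  have sub: "V \<alpha> \<subseteq> fst (m \<alpha>)" and "snd (m \<alpha>) \<in> V \<alpha>" and "openin X (V \<alpha>)"
    using ball openin_gball by (auto simp: shrunken_ball_def open_balls_eq)
  moreover have "V \<alpha> = V \<alpha> \<inter> remaining X V {..<\<alpha>}"
    using sub ball by auto
  ultimately show "legal_II X m V \<alpha>"
    unfolding legal_II_def openin_subtopology by auto
qed

text \<open>
  At limits below \<open>\<kappa>\<close> the answers form a short decreasing sequence of balls. At \<open>\<kappa>\<close> they
  interleave with closed sets, whose complements would form an increasing open cover if the
  intersection were empty; a subcover of size \<open><\<kappa>\<close> uses a bounded set of rounds, and does not
  meet the answers of later rounds, which are nonempty.
\<close>

lemma remaining_nonempty:
  fixes m :: "'k \<Rightarrow> 'a set \<times> 'a"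
  assumes Lin: "kappa_Lindelof \<kappa> X" and sph: "spherically_lt_complete \<kappa> (topspace X) d"
    and V: "\<And>\<alpha>. \<exists>W. shrunken_ball (m \<alpha>) W \<Longrightarrow> shrunken_ball (m \<alpha>) (V \<alpha>)"
    and D: "D \<in> limit_lengths" and legal: "\<And>\<beta>. \<beta> \<in> D \<Longrightarrow> legal_I X m V \<beta>"
  shows "remaining X V D \<noteq> {}"
proof -
  let ?S = "topspace X"
  have ball: "shrunken_ball (m \<alpha>) (V \<alpha>)" and sub: "fst (m \<alpha>) \<subseteq> remaining X V {..<\<alpha>}" if \<alpha>: "\<alpha> \<in> D" for \<alpha>
  proof -
    have leg: "legal_I X m V \<beta>" if "\<beta> \<le> \<alpha>" for \<beta>
      by (rule legal[OF limit_lengthsD(2)[OF D \<alpha> that]])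
    show "shrunken_ball (m \<alpha>) (V \<alpha>)" and "fst (m \<alpha>) \<subseteq> remaining X V {..<\<alpha>}"
      by (rule shrunken_balls_legal[OF V leg]; assumption)+
  qed
  have VS: "V \<alpha> \<subseteq> fst (m \<alpha>)" "V \<alpha> \<in> open_balls ?S d" "V \<alpha> \<noteq> {}" if "\<alpha> \<in> D" for \<alpha>
    using ball[OF that] by (auto simp: shrunken_ball_def)
  have dec: "fst (m \<beta>) \<subseteq> V \<alpha>" if "\<alpha> < \<beta>" "\<beta> \<in> D" for \<alpha> \<beta>
    using sub[OF that(2)] that(1) by (auto simp: remaining_def)
  show ?thesis
  proof (cases "D = UNIV")
    case False
    then obtain \<gamma> where \<gamma>: "is_limit \<gamma>" "D = {..<\<gamma>}"
      using D by (auto simp: limit_lengths_def)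
    define r where "r = {(i, j). i \<le> j \<and> j < \<gamma>}"
    have "V j \<subseteq> V i" if "(i, j) \<in> r" for i j
    proof (cases "i = j")
      case False
      then have "i < j" "j \<in> D"
        using that \<gamma>(2) by (auto simp: r_def)
      then show ?thesis
        using dec[of i j] VS(1)[of j] by auto
    qed simp
    moreover have Fr: "Field r = D"
      unfolding r_def using initial_segment_ordLess(3) \<gamma>(2) by simp
    moreover have ne: "D \<noteq> {}"
      using \<gamma> by (auto simp: is_limit_def)
    ultimately have "decreasing_balls ?S d r V"
      unfolding decreasing_balls_def using VS(2) initial_segment_ordLess(1)[of \<gamma>, folded r_def] by simp
    moreover have "r <o ord_of \<kappa>"
      unfolding r_def by (rule initial_segment_ordLess(2))
    ultimately have "(\<Inter>i\<in>Field r. V i) \<noteq> {}"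
      using sph[unfolded spherically_lt_complete_def, rule_format, of r V] by simp
    then obtain z where z: "\<And>i. i \<in> D \<Longrightarrow> z \<in> V i"
      unfolding Fr by auto
    obtain i where "i \<in> D" using ne by auto
    then have "z \<in> ?S"
      using z VS(2) by (auto simp: open_balls_eq gball_def)
    then show ?thesis
      using z by (auto simp: remaining_def)
  next
    case True
    note D = this
    have "\<forall>\<alpha>. \<exists>C. closedin X C \<and> V \<alpha> \<subseteq> C \<and> C \<subseteq> fst (m \<alpha>)"
      using ball by (simp add: D shrunken_ball_def)
    then obtain C where C: "\<And>\<alpha>. closedin X (C \<alpha>)" "\<And>\<alpha>. V \<alpha> \<subseteq> C \<alpha>" "\<And>\<alpha>. C \<alpha> \<subseteq> fst (m \<alpha>)"
      by metis
    show ?thesis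
    proof
      assume empty: "remaining X V D = {}"
      \<comment> \<open>\<open>C \<beta>\<close> is contained in all earlier answers, so the sets \<open>C \<alpha>\<close> have the same intersection as the answers\<close>
      let ?\<U> = "range (\<lambda>\<alpha>. ?S - C \<alpha>)"
      have "x \<in> \<Union>?\<U>" if x: "x \<in> ?S" for x
      proof -
        obtain \<alpha> where \<alpha>: "x \<notin> V \<alpha>"
          using empty x by (auto simp: remaining_def)
        obtain \<beta> where "\<alpha> < \<beta>"
          using ex_greater by auto
        then have "x \<notin> C \<beta>"
          using dec[of \<alpha> \<beta>] C(3)[of \<beta>] \<alpha> D by auto
        then show ?thesis using x by auto
      qed
      then have "\<Union>?\<U> = ?S" by auto
      moreover have "\<forall>U\<in>?\<U>. openin X U"
        using C(1) by auto
      ultimately obtain \<V> where \<V>: "|\<V>| <o ord_of \<kappa>" "\<V> \<subseteq> ?\<U>" "\<Union>\<V> = ?S"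
        using Lin[unfolded kappa_Lindelof_def, rule_format, of ?\<U>] by auto
      obtain A where A: "inj_on (\<lambda>\<alpha>. ?S - C \<alpha>) A" "\<V> = (\<lambda>\<alpha>. ?S - C \<alpha>) ` A"
        using \<V>(2) subset_image_inj[of \<V> "\<lambda>\<alpha>. ?S - C \<alpha>" UNIV] by auto
      then have "|A| <o ord_of \<kappa>"
        using small_image[OF \<V>(1), of "inv_into A (\<lambda>\<alpha>. ?S - C \<alpha>)"] by simp
      then obtain \<beta> where \<beta>: "\<And>\<alpha>. \<alpha> \<in> A \<Longrightarrow> \<alpha> < \<beta>"
        using small_bounded[of A] by auto
      obtain z where z: "z \<in> V \<beta>"
        using VS(3)[of \<beta>] D by auto
      then have "z \<in> ?S"
        using VS(2)[of \<beta>] D by (auto simp: open_balls_eq gball_def)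
      then obtain \<alpha> where \<alpha>: "\<alpha> \<in> A" "z \<notin> C \<alpha>"
        using \<V>(3) A(2) by auto
      have "V \<beta> \<subseteq> C \<alpha>"
        using dec[OF \<beta>[OF \<alpha>(1)]] VS(1)[of \<beta>] C(2)[of \<alpha>] D by auto
      then show False using z \<alpha>(2) by auto
    qed
  qed
qed

lemma metric_winning_strategy:
  assumes Lin: "kappa_Lindelof \<kappa> X" and sph: "spherically_lt_complete \<kappa> (topspace X) d"
  shows "\<exists>\<sigma>. winning_strategy_II \<kappa> X \<sigma>"
proof -
  define pick where "pick m = (SOME V. shrunken_ball m V)" for m
  define \<sigma> where "\<sigma> s = pick (the (s (THE \<alpha>. dom s = {..\<alpha>})))" for s :: "'k \<rightharpoonup> 'a set \<times> 'a"
  have \<sigma>: "\<sigma> ((Some \<circ> m) |` {..\<alpha>}) = pick (m \<alpha>)" for m \<alpha>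
  proof -
    have "dom ((Some \<circ> m) |` {..\<alpha>}) = {..\<alpha>}"
      by (auto simp: restrict_map_def split: if_splits)
    then have "(THE \<beta>. dom ((Some \<circ> m) |` {..\<alpha>}) = {..\<beta>}) = \<alpha>"
      by (auto intro: the_equality)
    then show ?thesis by (simp add: \<sigma>_def)
  qed
  have pick: "shrunken_ball m (pick m)" if "\<exists>W. shrunken_ball m W" for m
    unfolding pick_def using that by (rule someI_ex)
  have "winning_strategy_II \<kappa> X \<sigma>"
    unfolding winning_strategy_II_def \<sigma>
  proof (intro allI impI conjI ballI)
    fix m :: "'k \<Rightarrow> 'a set \<times> 'a" and V \<alpha>
    assume V: "\<forall>\<alpha>. V \<alpha> = pick (m \<alpha>)" and legal: "\<forall>\<beta>\<le>\<alpha>. legal_I X m V \<beta>"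
    have balls: "shrunken_ball (m \<alpha>) (V \<alpha>)" if "\<exists>W. shrunken_ball (m \<alpha>) W" for \<alpha>
      using pick[OF that] V by simp
    show "legal_II X m V \<alpha>"
      by (rule shrunken_balls_legal(3)[OF balls]) (use legal in simp_all)
  next
    fix m :: "'k \<Rightarrow> 'a set \<times> 'a" and V D
    assume V: "\<forall>\<alpha>. V \<alpha> = pick (m \<alpha>)" and D: "D \<in> limit_lengths"
      and legal: "\<forall>\<beta>\<in>D. legal_I X m V \<beta>"
    have balls: "shrunken_ball (m \<alpha>) (V \<alpha>)" if "\<exists>W. shrunken_ball (m \<alpha>) W" for \<alpha>
      using pick[OF that] V by simp
    show "remaining X V D \<noteq> {}"
      by (rule remaining_nonempty[OF Lin sph balls D]) (use legal in simp_all)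
  qed
  then show ?thesis by fast
qed

end

theorem metrizable_imp_additive_SC_space:
  fixes \<GG> :: "'g::linordered_ab_group_add itself"
  assumes \<GG>: "Deg \<GG> =o ord_of \<kappa>" and Lin: "kappa_Lindelof \<kappa> X"
    and met: "spherically_lt_complete_metrizable \<kappa> \<GG> X"
  shows "kappa_additive \<kappa> X \<and> SC_space \<kappa> X"
proof -
  obtain d :: "'a \<Rightarrow> 'a \<Rightarrow> 'g" where d: "compatible_metric X d" "spherically_lt_complete \<kappa> (topspace X) d"
    using met unfolding spherically_lt_complete_metrizable_def by auto
  show ?thesis
    unfolding SC_space_def
    using metric_additive[OF \<GG> d(1)] metric_weight[OF \<GG> d(1) Lin]
      metric_winning_strategy[OF \<GG> d(1) Lin d(2)] by simp
qed

end

section \<open>Superclosed subsets of the generalized Cantor space\<close>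

abbreviation trunc :: "('k::wellorder \<Rightarrow> 'b) \<Rightarrow> 'k \<Rightarrow> ('k \<rightharpoonup> 'b)" where
  "trunc y \<alpha> \<equiv> (Some \<circ> y) |` {..<\<alpha>}"

lemma dom_trunc: "dom (trunc y \<alpha>) = {..<\<alpha>}"
  by (auto simp: restrict_map_def split: if_splits)

lemma trunc_eq_iff: "trunc y \<alpha> = trunc z \<beta> \<longleftrightarrow> \<alpha> = \<beta> \<and> (\<forall>\<xi><\<alpha>. y \<xi> = z \<xi>)"
proof
  assume eq: "trunc y \<alpha> = trunc z \<beta>"
  then have "{..<\<alpha>} = {..<\<beta>}"
    using dom_trunc by metis
  then have "\<alpha> = \<beta>"
    by (metis lessThan_iff less_irrefl neqE)
  moreover have "y \<xi> = z \<xi>" if "\<xi> < \<alpha>" for \<xi>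
    using fun_cong[OF eq, of \<xi>] that \<open>\<alpha> = \<beta>\<close> by (simp add: restrict_map_def)
  ultimately show "\<alpha> = \<beta> \<and> (\<forall>\<xi><\<alpha>. y \<xi> = z \<xi>)" by simp
qed (auto simp: restrict_map_def fun_eq_iff)

lemma restrict_trunc: "trunc y \<alpha> |` {..<\<beta>} = trunc y (min \<alpha> \<beta>)"
  by (auto simp: restrict_map_def fun_eq_iff)

lemma trunc_le_iff: "trunc y \<alpha> \<subseteq>\<^sub>m Some \<circ> z \<longleftrightarrow> (\<forall>\<xi><\<alpha>. z \<xi> = y \<xi>)"
  unfolding map_le_def dom_trunc by (auto simp: restrict_map_def)

lemma trunc_in_seqs: "trunc y \<alpha> \<in> seqs \<kappa>"
  using dom_trunc by (auto simp: seqs_def)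

lemma openin_bounded_topology:
  fixes \<kappa> :: "'k::wellorder itself"
  shows "openin (bounded_topology \<kappa>) U \<longleftrightarrow> (\<forall>x\<in>U. \<exists>\<alpha>. \<forall>y. (\<forall>\<beta><\<alpha>. y \<beta> = x \<beta>) \<longrightarrow> y \<in> U)"
proof
  assume "openin (bounded_topology \<kappa>) U"
  then have "generate_topology_on {{x. s \<subseteq>\<^sub>m Some \<circ> x} |s. s \<in> seqs \<kappa>} U"
    by (simp add: bounded_topology_def openin_topology_generated_by_iff)
  then show "\<forall>x\<in>U. \<exists>\<alpha>. \<forall>y. (\<forall>\<beta><\<alpha>. y \<beta> = x \<beta>) \<longrightarrow> y \<in> U"
  proof induction
    case (Int U V)
    show ?case
    proof
      fix x assume x: "x \<in> U \<inter> V"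
      obtain \<alpha> where \<alpha>: "\<forall>y. (\<forall>\<beta><\<alpha>. y \<beta> = x \<beta>) \<longrightarrow> y \<in> U"
        using Int.IH(1) x by auto
      obtain \<alpha>' where \<alpha>': "\<forall>y. (\<forall>\<beta><\<alpha>'. y \<beta> = x \<beta>) \<longrightarrow> y \<in> V"
        using Int.IH(2) x by auto
      show "\<exists>\<alpha>. \<forall>y. (\<forall>\<beta><\<alpha>. y \<beta> = x \<beta>) \<longrightarrow> y \<in> U \<inter> V"
        using \<alpha> \<alpha>' by (intro exI[of _ "max \<alpha> \<alpha>'"]) (simp add: less_max_iff_disj)
    qed
  next
    case (UN \<U>)
    show ?case
    proof
      fix x assume "x \<in> \<Union>\<U>"
      then obtain V where V: "V \<in> \<U>" "x \<in> V" by auto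
      obtain \<alpha> where "\<forall>y. (\<forall>\<beta><\<alpha>. y \<beta> = x \<beta>) \<longrightarrow> y \<in> V"
        using UN.IH[OF V(1)] V(2) by auto
      then show "\<exists>\<alpha>. \<forall>y. (\<forall>\<beta><\<alpha>. y \<beta> = x \<beta>) \<longrightarrow> y \<in> \<Union>\<U>"
        using V(1) by (intro exI[of _ \<alpha>]) auto
    qed
  next
    case (Basis U)
    then obtain s \<alpha> where s: "dom s = {..<\<alpha>}" "U = {x. s \<subseteq>\<^sub>m Some \<circ> x}"
      by (auto simp: seqs_def)
    show ?case
      unfolding s(2) by (intro ballI exI[of _ \<alpha>]) (simp add: map_le_def s(1))
  qed simp
next
  assume U: "\<forall>x\<in>U. \<exists>\<alpha>. \<forall>y. (\<forall>\<beta><\<alpha>. y \<beta> = x \<beta>) \<longrightarrow> y \<in> U"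
  show "openin (bounded_topology \<kappa>) U"
  proof (subst openin_subopen, intro ballI)
    fix x assume "x \<in> U"
    then obtain \<alpha> where \<alpha>: "\<forall>y. (\<forall>\<beta><\<alpha>. y \<beta> = x \<beta>) \<longrightarrow> y \<in> U"
      using U by auto
    have "openin (bounded_topology \<kappa>) {y. trunc x \<alpha> \<subseteq>\<^sub>m Some \<circ> y}"
      unfolding bounded_topology_def using trunc_in_seqs[of x \<alpha> \<kappa>]
      by (intro topology_generated_by_Basis) auto
    then show "\<exists>V. openin (bounded_topology \<kappa>) V \<and> x \<in> V \<and> V \<subseteq> U"
      using \<alpha> by (intro exI[of _ "{y. trunc x \<alpha> \<subseteq>\<^sub>m Some \<circ> y}"]) (auto simp: trunc_le_iff)
  qed
qed

lemma topspace_bounded_topology: "topspace (bounded_topology \<kappa>) = UNIV"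
  using openin_bounded_topology[of \<kappa> UNIV] openin_subset by auto

lemma closedin_branches: "closedin (bounded_topology \<kappa>) (branches \<kappa> T)"
proof -
  have "openin (bounded_topology \<kappa>) (- branches \<kappa> T)"
    unfolding openin_bounded_topology
  proof
    fix x assume "x \<in> - branches \<kappa> T"
    then obtain \<alpha> where \<alpha>: "trunc x \<alpha> \<notin> T"
      by (auto simp: branches_def)
    have "y \<in> - branches \<kappa> T" if "\<forall>\<beta><\<alpha>. y \<beta> = x \<beta>" for y
    proof -
      have "trunc y \<alpha> = trunc x \<alpha>"
        using that by (simp add: trunc_eq_iff)
      then show ?thesis
        using \<alpha> by (auto simp: branches_def intro!: exI[of _ \<alpha>])
    qed
    then show "\<exists>\<alpha>. \<forall>y. (\<forall>\<beta><\<alpha>. y \<beta> = x \<beta>) \<longrightarrow> y \<in> - branches \<kappa> T"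
      by auto
  qed
  then show ?thesis
    by (simp add: closedin_def topspace_bounded_topology Compl_eq_Diff_UNIV)
qed

context uncountable_regular
begin

lemma zero_less_one_ord: "(zero_ord :: 'k) < one_ord"
  unfolding one_ord_def by (rule LeastI_ex) (rule ex_greater)

lemma ex_succ: "\<exists>\<alpha>'. {..<\<alpha>'} = {..\<alpha>::'k}"
proof
  let ?\<alpha>' = "LEAST \<alpha>'. \<alpha> < \<alpha>'"
  have "\<alpha> < ?\<alpha>'"
    by (rule LeastI_ex) (rule ex_greater)
  moreover have "\<beta> \<le> \<alpha>" if "\<beta> < ?\<alpha>'" for \<beta>
    using not_less_Least[OF that] by simp
  ultimately show "{..<?\<alpha>'} = {..\<alpha>}"
    by (auto intro: le_less_trans)
qed

text \<open>
  The set is the image of \<open>g\<close>, with the bits read as the two least ordinals, and its tree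
  consists of the initial segments of its members. At a limit level below \<open>\<kappa>\<close>, the closure
  property of the coding puts a sequence into the tree; at level \<open>\<kappa>\<close>, it makes every branch a
  member of the set.
\<close>

theorem superclosed_coding_imp_superclosed_embedding:
  fixes g :: "'a \<Rightarrow> 'k \<Rightarrow> bool"
  assumes g: "superclosed_coding X g" and haus: "Hausdorff_space X"
  shows "\<exists>C. C \<subseteq> cantor_set \<kappa> \<and> superclosed \<kappa> C \<and>
           X homeomorphic_space subtopology (bounded_topology \<kappa>) C"
proof -
  let ?S = "topspace X"
  define f where "f x \<alpha> = (if g x \<alpha> then one_ord else zero_ord :: 'k)" for x \<alpha>
  have f_eq: "f x \<alpha> = f y \<beta> \<longleftrightarrow> g x \<alpha> = g y \<beta>" for x y \<alpha> \<beta>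
    using zero_less_one_ord by (auto simp: f_def)
  have f_one: "(f x \<alpha> = one_ord) = g x \<alpha>" for x \<alpha>
    using zero_less_one_ord by (auto simp: f_def)
  have cyl: "cylinder ?S g x \<alpha> = {y \<in> ?S. \<forall>\<beta><\<alpha>. f y \<beta> = f x \<beta>}" for x \<alpha>
    by (simp add: cylinder_def f_eq)
  define T where "T = {trunc (f x) \<alpha> |x \<alpha>. x \<in> ?S}"
  have T_D: "\<exists>x\<in>?S. \<forall>\<beta><\<alpha>. y \<beta> = f x \<beta>" if "trunc y \<alpha> \<in> T" for y \<alpha>
    using that by (auto simp: T_def trunc_eq_iff)
  have limit: "\<exists>z\<in>?S. \<forall>\<beta>\<in>D. y \<beta> = f z \<beta>"
    if D: "D \<in> limit_lengths" and y: "\<And>\<alpha>. \<alpha> \<in> D \<Longrightarrow> trunc y \<alpha> \<in> T" for D y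
  proof -
    have ex: "\<exists>x\<in>?S. \<forall>\<beta>\<le>\<alpha>. y \<beta> = f x \<beta>" if \<alpha>: "\<alpha> \<in> D" for \<alpha>
    proof -
      obtain \<alpha>' where "\<alpha>' \<in> D" "\<alpha> < \<alpha>'"
        using limit_lengthsD(1)[OF D \<alpha>] by auto
      then show ?thesis
        using T_D[OF y[of \<alpha>']] by (meson le_less_trans)
    qed
    have "\<exists>x\<in>?S. \<forall>\<beta>\<le>\<alpha>. g x \<beta> = (y \<beta> = one_ord)" if "\<alpha> \<in> D" for \<alpha>
      using ex[OF that] f_one by metis
    then have "\<exists>z\<in>?S. \<forall>\<beta>\<in>D. g z \<beta> = (y \<beta> = one_ord)"
      using g D unfolding superclosed_coding_def by simp
    then obtain z where z: "z \<in> ?S" "\<And>\<beta>. \<beta> \<in> D \<Longrightarrow> g z \<beta> = (y \<beta> = one_ord)"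
      by auto
    have "y \<beta> = f z \<beta>" if \<beta>: "\<beta> \<in> D" for \<beta>
    proof -
      obtain x where "y \<beta> = f x \<beta>"
        using ex[OF \<beta>] by auto
      then show ?thesis
        using z(2)[OF \<beta>] f_one f_eq by metis
    qed
    then show ?thesis using z(1) by auto
  qed
  have "is_tree \<kappa> T"
    unfolding is_tree_def
  proof (intro conjI ballI allI)
    show "T \<subseteq> seqs \<kappa>"
      using trunc_in_seqs by (auto simp: T_def)
    fix s \<alpha> assume "s \<in> T"
    then obtain x \<beta> where x: "x \<in> ?S" "s = trunc (f x) \<beta>"
      by (auto simp: T_def)
    show "s |` {..<\<alpha>} \<in> T"
      unfolding x(2) restrict_trunc using x(1) by (auto simp: T_def)
  qed
  moreover have "pruned \<kappa> T"
    unfolding pruned_def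
  proof (intro ballI allI impI)
    fix s \<alpha> assume s: "s \<in> T" "dom s \<subseteq> {..<\<alpha>}"
    then obtain x \<beta> where x: "x \<in> ?S" "s = trunc (f x) \<beta>"
      by (auto simp: T_def)
    then have "{..<\<beta>} \<subseteq> {..<\<alpha>}"
      using s(2) dom_trunc by metis
    then have "s \<subseteq>\<^sub>m trunc (f x) \<alpha>"
      unfolding map_le_def x(2) dom_trunc by (auto simp: restrict_map_def)
    moreover have "trunc (f x) \<alpha> \<in> T"
      using x(1) by (auto simp: T_def)
    ultimately show "\<exists>t\<in>T. dom t = {..<\<alpha>} \<and> s \<subseteq>\<^sub>m t"
      by (intro bexI[of _ "trunc (f x) \<alpha>"] conjI dom_trunc)
  qed
  moreover have "lt_closed_tree \<kappa> T"
    unfolding lt_closed_tree_def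
  proof (intro allI impI)
    fix \<gamma> s assume s: "is_limit \<gamma> \<and> dom s = {..<\<gamma>} \<and> (\<forall>\<alpha><\<gamma>. s |` {..<\<alpha>} \<in> T)"
    define y where "y \<beta> = the (s \<beta>)" for \<beta>
    have "s \<beta> = Some (y \<beta>)" if "\<beta> < \<gamma>" for \<beta>
    proof -
      have "\<beta> \<in> dom s"
        using s that by auto
      then show ?thesis by (auto simp: y_def)
    qed
    moreover have "s \<beta> = None" if "\<not> \<beta> < \<gamma>" for \<beta>
      using s that by (metis domIff lessThan_iff)
    ultimately have sy: "s = trunc y \<gamma>"
      by (auto simp: fun_eq_iff restrict_map_def)
    have "trunc y \<alpha> \<in> T" if "\<alpha> \<in> {..<\<gamma>}" for \<alpha>
    proof -
      have "s |` {..<\<alpha>} = trunc y \<alpha>"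
        unfolding sy restrict_trunc using that by (simp add: min_absorb2)
      then show ?thesis
        using s that by (metis lessThan_iff)
    qed
    moreover have "{..<\<gamma>} \<in> limit_lengths"
      using s by (auto simp: limit_lengths_def)
    ultimately obtain z where "z \<in> ?S" "\<forall>\<beta>\<in>{..<\<gamma>}. y \<beta> = f z \<beta>"
      using limit[of "{..<\<gamma>}" y] by auto
    then have "s = trunc (f z) \<gamma>"
      unfolding sy by (simp add: trunc_eq_iff)
    then show "s \<in> T"
      using \<open>z \<in> ?S\<close> by (auto simp: T_def)
  qed
  ultimately have tree: "superclosed_tree \<kappa> T"
    by (simp add: superclosed_tree_def)
  have br: "f ` ?S = branches \<kappa> T"
  proof (intro equalityI subsetI)
    fix y assume "y \<in> branches \<kappa> T"
    then have "\<exists>z\<in>?S. \<forall>\<beta>\<in>UNIV. y \<beta> = f z \<beta>"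
      by (intro limit) (auto simp: limit_lengths_def branches_def)
    then show "y \<in> f ` ?S" by auto
  qed (auto simp: branches_def T_def)
  have "superclosed \<kappa> (f ` ?S)"
    unfolding superclosed_def br using tree closedin_branches by auto
  moreover have "f ` ?S \<subseteq> cantor_set \<kappa>"
    by (auto simp: cantor_set_def f_def)
  moreover have "homeomorphic_map X (subtopology (bounded_topology \<kappa>) (f ` ?S)) f"
  proof (rule bijective_open_imp_homeomorphic_map)
    show "f ` ?S = topspace (subtopology (bounded_topology \<kappa>) (f ` ?S))"
      by (simp add: topspace_bounded_topology)
    show "inj_on f ?S"
    proof (rule inj_onI)
      fix x y assume xy: "x \<in> ?S" "y \<in> ?S" "f x = f y"
      then have "g x \<alpha> = g y \<alpha>" for \<alpha>
        using f_eq[of x \<alpha> y \<alpha>] by simp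
      then have "g x = g y"
        by (rule ext)
      then show "x = y"
        using coding_inj[OF g haus xy(1,2)] by simp
    qed
    have "openin X {x \<in> ?S. f x \<in> U}" if U: "openin (bounded_topology \<kappa>) U" for U
    proof (subst openin_subopen, intro ballI)
      fix x assume x: "x \<in> {x \<in> ?S. f x \<in> U}"
      then obtain \<alpha> where "\<forall>y. (\<forall>\<beta><\<alpha>. y \<beta> = f x \<beta>) \<longrightarrow> y \<in> U"
        using U unfolding openin_bounded_topology by auto
      then have "cylinder ?S g x \<alpha> \<subseteq> {x \<in> ?S. f x \<in> U}"
        unfolding cyl by auto
      moreover have "openin X (cylinder ?S g x \<alpha>)"
        using g x by (simp add: superclosed_coding_def)
      ultimately show "\<exists>V. openin X V \<and> x \<in> V \<and> V \<subseteq> {x \<in> ?S. f x \<in> U}"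
        using x by (intro exI[of _ "cylinder ?S g x \<alpha>"]) (simp add: self_in_cylinder)
    qed
    then have "continuous_map X (bounded_topology \<kappa>) f"
      by (simp add: continuous_map_def topspace_bounded_topology)
    then show "continuous_map X (subtopology (bounded_topology \<kappa>) (f ` ?S)) f"
      unfolding continuous_map_in_subtopology by auto
    show "open_map X (subtopology (bounded_topology \<kappa>) (f ` ?S)) f"
      unfolding open_map_def
    proof (intro allI impI)
      fix U assume U: "openin X U"
      define W where "W = {y. \<exists>x\<in>U. \<exists>\<alpha>. cylinder ?S g x \<alpha> \<subseteq> U \<and> (\<forall>\<beta><\<alpha>. y \<beta> = f x \<beta>)}"
      have US: "U \<subseteq> ?S"
        by (rule openin_subset[OF U])
      have "openin (bounded_topology \<kappa>) W"
        unfolding openin_bounded_topology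
      proof
        fix y assume "y \<in> W"
        then obtain x \<alpha> where x: "x \<in> U" "cylinder ?S g x \<alpha> \<subseteq> U" "\<forall>\<beta><\<alpha>. y \<beta> = f x \<beta>"
          by (auto simp: W_def)
        have "y' \<in> W" if "\<forall>\<beta><\<alpha>. y' \<beta> = y \<beta>" for y'
          unfolding W_def using x that by auto
        then show "\<exists>\<alpha>. \<forall>y'. (\<forall>\<beta><\<alpha>. y' \<beta> = y \<beta>) \<longrightarrow> y' \<in> W"
          by auto
      qed
      moreover have "f ` U = W \<inter> f ` ?S"
      proof (intro equalityI subsetI)
        fix y assume "y \<in> f ` U"
        then obtain x where x: "x \<in> U" "y = f x" by auto
        then obtain \<alpha> where "cylinder ?S g x \<alpha> \<subseteq> U"
          using g U unfolding superclosed_coding_def by metis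
        then show "y \<in> W \<inter> f ` ?S"
          using x US unfolding W_def by auto
      next
        fix y assume "y \<in> W \<inter> f ` ?S"
        then obtain x \<alpha> z where x: "x \<in> U" "cylinder ?S g x \<alpha> \<subseteq> U" "\<forall>\<beta><\<alpha>. y \<beta> = f x \<beta>" "z \<in> ?S" "y = f z"
          by (auto simp: W_def)
        then have "z \<in> cylinder ?S g x \<alpha>"
          unfolding cyl by simp
        then show "y \<in> f ` U" using x by auto
      qed
      ultimately show "openin (subtopology (bounded_topology \<kappa>) (f ` ?S)) (f ` U)"
        by (auto simp: openin_subtopology)
    qed
  qed
  ultimately show ?thesis
    using homeomorphic_map_imp_homeomorphic_space by blast
qed

text \<open>
  Prunedness extends a node by one step, and closure at limits lets the extension go on; the
  recursion copies \<open>t\<close> as long as it is defined.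
\<close>

lemma superclosed_tree_extend:
  assumes T: "superclosed_tree \<kappa> T" and t: "t \<in> T"
  shows "\<exists>x\<in>branches \<kappa> T. t \<subseteq>\<^sub>m Some \<circ> x"
proof -
  have tree: "s |` {..<\<alpha>} \<in> T" if "s \<in> T" for s \<alpha>
    using T that by (simp add: superclosed_tree_def is_tree_def)
  have seqs: "T \<subseteq> seqs \<kappa>"
    using T by (simp add: superclosed_tree_def is_tree_def)
  have pr: "\<exists>v\<in>T. dom v = {..<\<alpha>} \<and> s \<subseteq>\<^sub>m v" if "s \<in> T" "dom s \<subseteq> {..<\<alpha>}" for s \<alpha>
    using T that by (simp add: superclosed_tree_def pruned_def)
  have lim: "s \<in> T" if "is_limit \<gamma>" "dom s = {..<\<gamma>}" "\<And>\<alpha>. \<alpha> < \<gamma> \<Longrightarrow> s |` {..<\<alpha>} \<in> T" for s \<gamma>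
  proof -
    have "lt_closed_tree \<kappa> T"
      using T by (simp add: superclosed_tree_def)
    then show ?thesis
      using that by (auto simp: lt_closed_tree_def)
  qed
  obtain \<gamma> where \<gamma>: "dom t = {..<\<gamma>}"
    using t seqs by (auto simp: seqs_def)
  define P where "P f \<alpha> r \<longleftrightarrow> (trunc f \<alpha>)(\<alpha> \<mapsto> r) \<in> T \<and> (\<alpha> \<in> dom t \<longrightarrow> t \<alpha> = Some r)"
    for f :: "'k \<Rightarrow> 'k" and \<alpha> r
  have "\<exists>x. \<forall>\<alpha>. P x \<alpha> (x \<alpha>)"
  proof (rule dependent_wellorder_choice)
    fix f g :: "'k \<Rightarrow> 'k" and \<alpha> r assume "\<And>\<beta>. \<beta> < \<alpha> \<Longrightarrow> f \<beta> = g \<beta>"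
    then have "trunc f \<alpha> = trunc g \<alpha>"
      by (simp add: trunc_eq_iff)
    then show "P f \<alpha> r = P g \<alpha> r"
      by (simp add: P_def)
  next
    fix \<alpha> f assume f: "\<And>\<beta>. \<beta> < \<alpha> \<Longrightarrow> P f \<beta> (f \<beta>)"
    have step: "(trunc f \<beta>)(\<beta> \<mapsto> f \<beta>) \<in> T" if "\<beta> < \<alpha>" for \<beta>
      using f[OF that] by (simp add: P_def)
    have u: "trunc f \<alpha> \<in> T"
    proof (cases "\<exists>\<beta><\<alpha>. \<forall>\<delta><\<alpha>. \<delta> \<le> \<beta>")
      case True
      then obtain \<beta> where \<beta>: "\<beta> < \<alpha>" "\<And>\<delta>. \<delta> < \<alpha> \<longleftrightarrow> \<delta> \<le> \<beta>"
        by (metis le_less_trans)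
      have "(trunc f \<beta>)(\<beta> \<mapsto> f \<beta>) = trunc f \<alpha>"
        by (auto simp: fun_eq_iff restrict_map_def \<beta>(2))
      then show ?thesis
        using step[OF \<beta>(1)] by simp
    next
      case no_max: False
      show ?thesis
      proof (cases "\<exists>\<beta>. \<beta> < \<alpha>")
        case True
        show ?thesis
        proof (rule lim)
          show "is_limit \<alpha>"
            using True no_max unfolding is_limit_def by (meson not_le)
          show "dom (trunc f \<alpha>) = {..<\<alpha>}"
            by (rule dom_trunc)
          fix \<delta> assume \<delta>: "\<delta> < \<alpha>"
          have "trunc f \<alpha> |` {..<\<delta>} = ((trunc f \<delta>)(\<delta> \<mapsto> f \<delta>)) |` {..<\<delta>}"
            using \<delta> by (auto simp: fun_eq_iff restrict_map_def)
          then show "trunc f \<alpha> |` {..<\<delta>} \<in> T"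
            using tree[OF step[OF \<delta>], of \<delta>] by (simp only:)
        qed
      next
        case False
        then have "trunc f \<alpha> = t |` {..<\<alpha>}"
          by (auto simp: fun_eq_iff restrict_map_def)
        then show ?thesis
          using tree[OF t, of \<alpha>] by (simp only:)
      qed
    qed
    obtain \<alpha>' where \<alpha>': "{..<\<alpha>'} = {..\<alpha>}"
      using ex_succ by auto
    then have less_\<alpha>': "\<xi> < \<alpha>' \<longleftrightarrow> \<xi> \<le> \<alpha>" for \<xi>
      by auto
    show "\<exists>r. P f \<alpha> r"
    proof (cases "\<alpha> \<in> dom t")
      case True
      then obtain r where r: "t \<alpha> = Some r" by auto
      have "((trunc f \<alpha>)(\<alpha> \<mapsto> r)) \<xi> = (t |` {..<\<alpha>'}) \<xi>" for \<xi>
      proof (cases "\<xi> < \<alpha>")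
        case True
        then have "\<xi> \<in> dom t"
          using \<open>\<alpha> \<in> dom t\<close> unfolding \<gamma> by (auto intro: less_trans)
        then have "t \<xi> = Some (f \<xi>)"
          using f[OF True] by (simp add: P_def)
        then show ?thesis
          using True by (auto simp: restrict_map_def less_\<alpha>')
      next
        case False
        then show ?thesis
          using r by (auto simp: restrict_map_def less_\<alpha>')
      qed
      then have "(trunc f \<alpha>)(\<alpha> \<mapsto> r) = t |` {..<\<alpha>'}"
        by (rule ext)
      then have "P f \<alpha> r"
        unfolding P_def using tree[OF t, of \<alpha>'] r by simp
      then show ?thesis by fast
    next
      case False
      have "dom (trunc f \<alpha>) \<subseteq> {..<\<alpha>'}"
        unfolding dom_trunc \<alpha>' by auto
      then obtain v where v: "v \<in> T" "dom v = {..<\<alpha>'}" "trunc f \<alpha> \<subseteq>\<^sub>m v"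
        using pr[OF u, of \<alpha>'] by blast
      have "\<alpha> \<in> dom v"
        unfolding v(2) \<alpha>' by simp
      then obtain r where r: "v \<alpha> = Some r" by auto
      have "((trunc f \<alpha>)(\<alpha> \<mapsto> r)) \<xi> = v \<xi>" for \<xi>
      proof (cases "\<xi> \<le> \<alpha>")
        case True
        then show ?thesis
          using v(3) r unfolding map_le_def dom_trunc by auto
      next
        case False
        then have "\<xi> \<notin> dom v"
          unfolding v(2) \<alpha>' by simp
        then show ?thesis
          using False by (auto simp: restrict_map_def domIff)
      qed
      then have "(trunc f \<alpha>)(\<alpha> \<mapsto> r) = v"
        by (rule ext)
      then have "P f \<alpha> r"
        unfolding P_def using v(1) False by simp
      then show ?thesis by fast
    qed
  qed
  then obtain x where "\<forall>\<alpha>. P x \<alpha> (x \<alpha>)" ..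
  then have x: "\<And>\<alpha>. (trunc x \<alpha>)(\<alpha> \<mapsto> x \<alpha>) \<in> T" "\<And>\<alpha>. \<alpha> \<in> dom t \<Longrightarrow> t \<alpha> = Some (x \<alpha>)"
    by (simp_all add: P_def)
  have "trunc x \<alpha> \<in> T" for \<alpha>
  proof -
    have "((trunc x \<alpha>)(\<alpha> \<mapsto> x \<alpha>)) |` {..<\<alpha>} = trunc x \<alpha>"
      by (auto simp: fun_eq_iff restrict_map_def)
    then show ?thesis
      using tree[OF x(1)[of \<alpha>], of \<alpha>] by (simp only:)
  qed
  then have "x \<in> branches \<kappa> T"
    by (simp add: branches_def)
  moreover have "t \<subseteq>\<^sub>m Some \<circ> x"
    using x(2) by (simp add: map_le_def)
  ultimately show ?thesis by auto
qed

text \<open>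
  A node at a limit level below \<open>\<kappa>\<close> belongs to the tree by closure, and then lies on a branch.
\<close>

theorem superclosed_homeomorph_imp_superclosed_coding:
  assumes C: "superclosed \<kappa> C" and f: "homeomorphic_map X (subtopology (bounded_topology \<kappa>) C) f"
  shows "superclosed_coding X f"
proof -
  let ?S = "topspace X" and ?Y = "subtopology (bounded_topology \<kappa>) C"
  obtain T where T: "superclosed_tree \<kappa> T" "C = branches \<kappa> T"
    using C by (auto simp: superclosed_def)
  have img: "f ` ?S = C"
    using homeomorphic_imp_surjective_map[OF f] by (simp add: topspace_bounded_topology)
  have inj: "inj_on f ?S"
    by (rule homeomorphic_imp_injective_map[OF f])
  have "openin X (cylinder ?S f x \<alpha>)" for x \<alpha>
  proof -
    have "openin (bounded_topology \<kappa>) {y. \<forall>\<beta><\<alpha>. y \<beta> = f x \<beta>}"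
      unfolding openin_bounded_topology by (intro ballI exI[of _ \<alpha>]) simp
    then have "openin ?Y ({y. \<forall>\<beta><\<alpha>. y \<beta> = f x \<beta>} \<inter> C)"
      by (auto simp: openin_subtopology)
    then have "openin X {z \<in> ?S. f z \<in> {y. \<forall>\<beta><\<alpha>. y \<beta> = f x \<beta>} \<inter> C}"
      using homeomorphic_imp_continuous_map[OF f] openin_continuous_map_preimage by blast
    moreover have "{z \<in> ?S. f z \<in> {y. \<forall>\<beta><\<alpha>. y \<beta> = f x \<beta>} \<inter> C} = cylinder ?S f x \<alpha>"
      using img by (auto simp: cylinder_def)
    ultimately show ?thesis by simp
  qed
  moreover have "\<exists>\<alpha>. cylinder ?S f x \<alpha> \<subseteq> U" if U: "openin X U" "x \<in> U" for U x
  proof -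
    have "openin ?Y (f ` U)"
      using homeomorphic_imp_open_map[OF f] U(1) by (simp add: open_map_def)
    then obtain W where W: "openin (bounded_topology \<kappa>) W" "f ` U = W \<inter> C"
      by (auto simp: openin_subtopology)
    then obtain \<alpha> where \<alpha>: "\<forall>y. (\<forall>\<beta><\<alpha>. y \<beta> = f x \<beta>) \<longrightarrow> y \<in> W"
      using U(2) unfolding openin_bounded_topology by blast
    have "z \<in> U" if "z \<in> cylinder ?S f x \<alpha>" for z
    proof -
      have z: "z \<in> ?S" "f z \<in> W"
        using that \<alpha> by (auto simp: cylinder_def)
      then have "f z \<in> f ` U"
        using W(2) img by auto
      then show ?thesis
        using inj z(1) openin_subset[OF U(1)] by (auto dest: inj_onD)
    qed
    then show ?thesis by auto
  qed
  moreover have "\<exists>x\<in>?S. \<forall>\<beta>\<in>D. f x \<beta> = s \<beta>"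
    if D: "D \<in> limit_lengths" and s: "\<forall>\<alpha>\<in>D. \<exists>x\<in>?S. \<forall>\<beta>\<le>\<alpha>. f x \<beta> = s \<beta>" for D s
  proof -
    have tr: "trunc s \<alpha> \<in> T" if \<alpha>: "\<alpha> \<in> D" for \<alpha>
    proof -
      obtain x where x: "x \<in> ?S" "\<forall>\<beta>\<le>\<alpha>. f x \<beta> = s \<beta>"
        using s \<alpha> by auto
      then have "trunc s \<alpha> = trunc (f x) \<alpha>"
        by (simp add: trunc_eq_iff)
      moreover have "f x \<in> branches \<kappa> T"
        using x(1) img T(2) by auto
      ultimately show ?thesis
        by (simp add: branches_def)
    qed
    have "\<exists>y\<in>C. \<forall>\<beta>\<in>D. y \<beta> = s \<beta>"
    proof (cases "D = UNIV")
      case True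
      then have "s \<in> C"
        using tr T(2) by (simp add: branches_def)
      then show ?thesis by auto
    next
      case False
      then obtain \<gamma> where \<gamma>: "is_limit \<gamma>" "D = {..<\<gamma>}"
        using D by (auto simp: limit_lengths_def)
      have "trunc s \<gamma> |` {..<\<alpha>} \<in> T" if "\<alpha> < \<gamma>" for \<alpha>
        using tr[of \<alpha>] that \<gamma>(2) unfolding restrict_trunc by (simp add: min_absorb2)
      then have "trunc s \<gamma> \<in> T"
        using T(1) \<gamma>(1) dom_trunc[of s \<gamma>] unfolding superclosed_tree_def lt_closed_tree_def by metis
      then obtain y where "y \<in> C" "trunc s \<gamma> \<subseteq>\<^sub>m Some \<circ> y"
        using superclosed_tree_extend[OF T(1)] T(2) by auto
      then show ?thesis
        unfolding trunc_le_iff \<gamma>(2) by auto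
    qed
    then show ?thesis
      using img by auto
  qed
  ultimately show ?thesis
    by (simp add: superclosed_coding_def)
qed

end

section \<open>Recoding by binary sequences\<close>

context uncountable_regular
begin

text \<open>
  A subcover of a partition is the whole partition.
\<close>

lemma open_partition_small:
  assumes Lin: "kappa_Lindelof \<kappa> X"
    and P: "\<And>x. x \<in> topspace X \<Longrightarrow> openin X (P x) \<and> x \<in> P x"
    and eq: "\<And>x y. x \<in> topspace X \<Longrightarrow> y \<in> P x \<Longrightarrow> P y = P x"
  shows "|P ` topspace X| <o ord_of \<kappa>"
proof -
  have "\<Union>(P ` topspace X) = topspace X"
    using P openin_subset by blast
  then obtain \<V> where \<V>: "|\<V>| <o ord_of \<kappa>" "\<V> \<subseteq> P ` topspace X" "\<Union>\<V> = topspace X"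
    using Lin[unfolded kappa_Lindelof_def, rule_format, of "P ` topspace X"] P by auto
  have "P x \<in> \<V>" if x: "x \<in> topspace X" for x
  proof -
    obtain V where V: "V \<in> \<V>" "x \<in> V"
      using \<V>(3) x by auto
    then obtain y where "y \<in> topspace X" "V = P y"
      using \<V>(2) by auto
    then show ?thesis
      using eq[of y x] V by simp
  qed
  then show ?thesis
    by (intro small_subset[OF _ \<V>(1)]) auto
qed

text \<open>
  Only fewer than \<open>\<kappa>\<close> cylinders exist on each level, so they can be numbered by ordinals below
  some \<open>\<mu> \<alpha> < \<kappa>\<close>; the number of the cylinder on the next level replaces the label.
\<close>

lemma superclosed_coding_bounded_labels:
  fixes h :: "'a \<Rightarrow> 'k \<Rightarrow> 'b"
  assumes Lin: "kappa_Lindelof \<kappa> X" and h: "superclosed_coding X h"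
  shows "\<exists>(c :: 'a \<Rightarrow> 'k \<Rightarrow> 'k) \<mu>. superclosed_coding X c \<and> (\<forall>x\<in>topspace X. \<forall>\<alpha>. c x \<alpha> < \<mu> \<alpha>)"
proof -
  let ?S = "topspace X"
  obtain succ :: "'k \<Rightarrow> 'k" where succ: "\<And>\<alpha>. {..<succ \<alpha>} = {..\<alpha>}"
    using ex_succ by metis
  then have less_succ: "\<beta> < succ \<alpha> \<longleftrightarrow> \<beta> \<le> \<alpha>" for \<alpha> \<beta>
    by blast
  define N where "N \<alpha> x = cylinder ?S h x (succ \<alpha>)" for \<alpha> x
  have N_small: "|N \<alpha> ` ?S| <o ord_of \<kappa>" for \<alpha>
  proof (rule open_partition_small[OF Lin])
    show "openin X (N \<alpha> x) \<and> x \<in> N \<alpha> x" if "x \<in> ?S" for x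
      using h that by (simp add: N_def superclosed_coding_def self_in_cylinder)
    show "N \<alpha> y = N \<alpha> x" if "y \<in> N \<alpha> x" for x y
      using that unfolding N_def by (rule cylinder_eq)
  qed
  then have "\<exists>e :: 'a set \<Rightarrow> 'k. inj_on e (N \<alpha> ` ?S)" for \<alpha>
    using small_inj by blast
  then obtain e :: "'k \<Rightarrow> 'a set \<Rightarrow> 'k" where e: "\<And>\<alpha>. inj_on (e \<alpha>) (N \<alpha> ` ?S)"
    by metis
  define c where "c x \<alpha> = e \<alpha> (N \<alpha> x)" for x \<alpha>
  have c_eq: "c y \<alpha> = c x \<alpha> \<longleftrightarrow> (\<forall>\<beta>\<le>\<alpha>. h y \<beta> = h x \<beta>)" if xy: "x \<in> ?S" "y \<in> ?S" for x y \<alpha>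
  proof
    assume "c y \<alpha> = c x \<alpha>"
    then have "N \<alpha> y = N \<alpha> x"
      using e[of \<alpha>] xy unfolding c_def by (auto dest: inj_onD)
    then have "y \<in> cylinder ?S h x (succ \<alpha>)"
      using self_in_cylinder[OF xy(2)] unfolding N_def by blast
    then show "\<forall>\<beta>\<le>\<alpha>. h y \<beta> = h x \<beta>"
      by (simp add: cylinder_def less_succ)
  next
    assume *: "\<forall>\<beta>\<le>\<alpha>. h y \<beta> = h x \<beta>"
    have "N \<alpha> y = N \<alpha> x"
      unfolding N_def by (rule cylinder_cong) (simp add: * less_succ)
    then show "c y \<alpha> = c x \<alpha>"
      by (simp add: c_def)
  qed
  have cyl: "cylinder ?S c x \<alpha> = cylinder ?S h x \<alpha>" if x: "x \<in> ?S" for x \<alpha>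
  proof (intro equalityI subsetI)
    fix y assume "y \<in> cylinder ?S c x \<alpha>"
    then show "y \<in> cylinder ?S h x \<alpha>"
      using c_eq[OF x] by (auto simp: cylinder_def)
  next
    fix y assume "y \<in> cylinder ?S h x \<alpha>"
    then show "y \<in> cylinder ?S c x \<alpha>"
      using c_eq[OF x] by (auto simp: cylinder_def)
  qed
  have "\<exists>x\<in>?S. \<forall>\<beta>\<in>D. c x \<beta> = s \<beta>"
    if D: "D \<in> limit_lengths" and s: "\<forall>\<alpha>\<in>D. \<exists>x\<in>?S. \<forall>\<beta>\<le>\<alpha>. c x \<beta> = s \<beta>" for D s
  proof -
    obtain w where w: "\<And>\<alpha>. \<alpha> \<in> D \<Longrightarrow> w \<alpha> \<in> ?S \<and> (\<forall>\<beta>\<le>\<alpha>. c (w \<alpha>) \<beta> = s \<beta>)"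
      using s by metis
    have agree: "h (w \<alpha>) \<beta> = h (w \<beta>) \<beta>" if "\<alpha> \<in> D" "\<beta> \<le> \<alpha>" for \<alpha> \<beta>
    proof -
      have \<beta>: "\<beta> \<in> D"
        by (rule limit_lengthsD(2)[OF D that])
      have "c (w \<alpha>) \<beta> = c (w \<beta>) \<beta>"
        using w[OF that(1)] w[OF \<beta>] that(2) by simp
      then show ?thesis
        using c_eq[of "w \<beta>" "w \<alpha>" \<beta>] w[OF that(1)] w[OF \<beta>] by simp
    qed
    have "\<exists>z\<in>?S. \<forall>\<beta>\<in>D. h z \<beta> = h (w \<beta>) \<beta>"
    proof -
      have "\<exists>x\<in>?S. \<forall>\<beta>\<le>\<alpha>. h x \<beta> = h (w \<beta>) \<beta>" if "\<alpha> \<in> D" for \<alpha>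
        using agree[OF that] w[OF that] by (intro bexI[of _ "w \<alpha>"]) simp_all
      then show ?thesis
        using h D unfolding superclosed_coding_def by simp
    qed
    then obtain z where z: "z \<in> ?S" "\<And>\<beta>. \<beta> \<in> D \<Longrightarrow> h z \<beta> = h (w \<beta>) \<beta>"
      by auto
    have "c z \<alpha> = s \<alpha>" if \<alpha>: "\<alpha> \<in> D" for \<alpha>
    proof -
      have "\<forall>\<beta>\<le>\<alpha>. h z \<beta> = h (w \<alpha>) \<beta>"
        using z(2) agree[OF \<alpha>] limit_lengthsD(2)[OF D \<alpha>] by simp
      then have "c z \<alpha> = c (w \<alpha>) \<alpha>"
        using c_eq[of "w \<alpha>" z \<alpha>] z(1) w[OF \<alpha>] by simp
      then show ?thesis using w[OF \<alpha>] by simp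
    qed
    then show ?thesis using z(1) by auto
  qed
  moreover have "\<exists>\<alpha>. cylinder ?S c x \<alpha> \<subseteq> U" if "openin X U" "x \<in> U" for U x
  proof -
    have "x \<in> ?S"
      using that openin_subset by blast
    then show ?thesis
      using h that unfolding superclosed_coding_def by (simp add: cyl)
  qed
  ultimately have "superclosed_coding X c"
    using h unfolding superclosed_coding_def by (simp add: cyl)
  moreover have "\<exists>\<mu>. \<forall>x\<in>?S. \<forall>\<alpha>. c x \<alpha> < \<mu> \<alpha>"
  proof -
    have "\<exists>\<mu>. \<forall>\<eta>\<in>(\<lambda>x. c x \<alpha>) ` ?S. \<eta> < \<mu>" for \<alpha>
    proof (rule small_bounded)
      have "|e \<alpha> ` N \<alpha> ` ?S| <o ord_of \<kappa>"
        using N_small by (rule small_image)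
      then show "|(\<lambda>x. c x \<alpha>) ` ?S| <o ord_of \<kappa>"
        by (simp add: c_def image_image)
    qed
    then obtain \<mu> where \<mu>: "\<And>\<alpha>. \<forall>\<eta>\<in>(\<lambda>x. c x \<alpha>) ` ?S. \<eta> < \<mu> \<alpha>"
      by metis
    then show ?thesis
      by (intro exI[of _ \<mu>]) simp
  qed
  ultimately show ?thesis by blast
qed

text \<open>
  Blocks of length \<open><\<kappa>\<close>, concatenated along \<open>\<kappa>\<close>, have order type \<open>\<kappa>\<close>: proper initial segments
  have size \<open><\<kappa>\<close> by regularity, which excludes longer order types, and shorter ones are
  excluded by counting the blocks.
\<close>

lemma ex_lexicographic_enumeration:
  fixes \<mu> :: "'k \<Rightarrow> 'k"
  shows "\<exists>\<pi> :: 'k \<Rightarrow> 'k \<times> 'k. range \<pi> = {(\<alpha>, \<eta>). \<eta> \<le> \<mu> \<alpha>} \<and>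
     (\<forall>\<xi> \<zeta>. \<xi> \<le> \<zeta> \<longleftrightarrow> fst (\<pi> \<xi>) < fst (\<pi> \<zeta>) \<or> fst (\<pi> \<xi>) = fst (\<pi> \<zeta>) \<and> snd (\<pi> \<xi>) \<le> snd (\<pi> \<zeta>))"
proof -
  define J where "J = {(\<alpha>, \<eta>). \<eta> \<le> \<mu> \<alpha>}"
  define R where "R = {(p, q). p \<in> J \<and> q \<in> J \<and> (fst p < fst q \<or> fst p = fst q \<and> snd p \<le> snd q)}"
  have FR: "Field R = J"
  proof
    show "Field R \<subseteq> J"
      by (auto simp: R_def Field_def)
    have "(p, p) \<in> R" if "p \<in> J" for p
      using that by (simp add: R_def)
    then show "J \<subseteq> Field R"
      by (meson FieldI1 subsetI)
  qed
  have "linear_order_on J R"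
    unfolding linear_order_on_def partial_order_on_def preorder_on_def
  proof (intro conjI)
    show "R \<subseteq> J \<times> J"
      by (auto simp: R_def)
    show "refl_on J R"
      by (auto simp: R_def refl_on_def)
    show "trans R"
      unfolding trans_def R_def by auto
    show "antisym R"
      unfolding antisym_def R_def by auto
    show "total_on J R"
      unfolding total_on_def R_def by auto
  qed
  moreover have "wf (R - Id)"
  proof (rule wf_subset)
    show "wf ({(\<alpha>, \<beta>::'k). \<alpha> < \<beta>} <*lex*> {(\<alpha>, \<beta>::'k). \<alpha> < \<beta>})"
      by (intro wf_lex_prod wf)
    show "R - Id \<subseteq> {(\<alpha>, \<beta>). \<alpha> < \<beta>} <*lex*> {(\<alpha>, \<beta>). \<alpha> < \<beta>}"
      by (auto simp: R_def)
  qed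
  ultimately have wo: "Well_order R"
    by (simp add: well_order_on_def FR)
  have wo_\<kappa>: "Well_order (ord_of \<kappa>)"
    using Card_order_\<kappa> by (rule card_order_on_well_order_on)
  have small: "|underS R p| <o ord_of \<kappa>" for p
  proof (rule small_subset)
    show "underS R p \<subseteq> (\<Union>\<alpha>\<in>{..fst p}. Pair \<alpha> ` {..\<mu> \<alpha>})"
    proof
      fix q assume "q \<in> underS R p"
      then have "fst q \<in> {..fst p}" "snd q \<in> {..\<mu> (fst q)}"
        by (auto simp: underS_def R_def J_def)
      then have "(fst q, snd q) \<in> (\<Union>\<alpha>\<in>{..fst p}. Pair \<alpha> ` {..\<mu> \<alpha>})"
        by blast
      then show "q \<in> (\<Union>\<alpha>\<in>{..fst p}. Pair \<alpha> ` {..\<mu> \<alpha>})"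
        by simp
    qed
    show "|\<Union>\<alpha>\<in>{..fst p}. Pair \<alpha> ` {..\<mu> \<alpha>}| <o ord_of \<kappa>"
      by (intro small_UN small_image small_atMost)
  qed
  have "\<not> ord_of \<kappa> <o R"
  proof
    assume "ord_of \<kappa> <o R"
    then obtain p where "ord_of \<kappa> =o Restr R (underS R p)"
      using ordLess_iff_ordIso_Restr[OF wo wo_\<kappa>] by auto
    then have "|UNIV :: 'k set| =o |Field (Restr R (underS R p))|"
      using card_of_cong by fastforce
    moreover have "|Field (Restr R (underS R p))| <o ord_of \<kappa>"
      by (rule small_subset[OF _ small[of p]]) (auto simp: Field_def)
    ultimately have "|UNIV :: 'k set| <o ord_of \<kappa>"
      using ordIso_ordLess_trans by blast
    then show False
      using card_UNIV_\<kappa> not_ordLess_ordIso by blast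
  qed
  moreover have "\<not> R <o ord_of \<kappa>"
  proof
    assume "R <o ord_of \<kappa>"
    moreover have "|J| \<le>o R"
      using wo FR by (intro card_of_least) simp
    ultimately have "|J| <o ord_of \<kappa>"
      by (rule ordLeq_ordLess_trans[rotated])
    then have "|fst ` J| <o ord_of \<kappa>"
      by (rule small_image)
    moreover have "fst ` J = UNIV"
      by (force simp: J_def)
    ultimately show False
      using card_UNIV_\<kappa> not_ordLess_ordIso by auto
  qed
  ultimately have "ord_of \<kappa> =o R"
    using wo wo_\<kappa> ordLeq_iff_ordLess_or_ordIso not_ordLess_iff_ordLeq by blast
  then obtain \<pi> where "iso (ord_of \<kappa>) R \<pi>"
    by (auto simp: ordIso_def)
  then have \<pi>: "bij_betw \<pi> UNIV J" "\<forall>\<xi> \<zeta>. (\<xi>, \<zeta>) \<in> ord_of \<kappa> \<longleftrightarrow> (\<pi> \<xi>, \<pi> \<zeta>) \<in> R"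
    unfolding iso_iff2 FR by simp_all
  have rng: "range \<pi> = J"
    using \<pi>(1) by (simp add: bij_betw_def)
  then have "\<pi> \<xi> \<in> J" for \<xi>
    by auto
  then have "\<xi> \<le> \<zeta> \<longleftrightarrow> fst (\<pi> \<xi>) < fst (\<pi> \<zeta>) \<or> fst (\<pi> \<xi>) = fst (\<pi> \<zeta>) \<and> snd (\<pi> \<xi>) \<le> snd (\<pi> \<zeta>)" for \<xi> \<zeta>
    using \<pi>(2)[rule_format, of \<xi> \<zeta>] by (simp add: ord_of_def R_def)
  then show ?thesis
    using rng unfolding J_def by blast
qed

text \<open>
  Each coordinate is replaced by a block of bits that encodes it in unary: bit \<open>\<eta>\<close> of block
  \<open>\<alpha>\<close> says that the label is \<open>\<eta>\<close>. Plain unary coding could create a new node inside a block,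
  namely when all bits are \<open>0\<close> up to a limit position that exhausts the labels that occur. For
  this reason one label that occurs in the cylinder is the default, and is encoded by zeros
  only. Then a sequence of zeros in an incomplete block is always realized, by the default
  label, and a bit \<open>1\<close> determines the rest of its block.
\<close>

theorem superclosed_coding_imp_binary:
  fixes h :: "'a \<Rightarrow> 'k \<Rightarrow> 'b"
  assumes Lin: "kappa_Lindelof \<kappa> X" and h: "superclosed_coding X h"
  shows "\<exists>g :: 'a \<Rightarrow> 'k \<Rightarrow> bool. superclosed_coding X g"
proof -
  let ?S = "topspace X"
  obtain c :: "'a \<Rightarrow> 'k \<Rightarrow> 'k" and \<mu> where c: "superclosed_coding X c" and \<mu>: "\<And>x \<alpha>. x \<in> ?S \<Longrightarrow> c x \<alpha> < \<mu> \<alpha>"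
    using superclosed_coding_bounded_labels[OF Lin h] by blast
  from ex_lexicographic_enumeration[of \<mu>] obtain \<pi> :: "'k \<Rightarrow> 'k \<times> 'k" where
    *: "range \<pi> = {(\<alpha>, \<eta>). \<eta> \<le> \<mu> \<alpha>} \<and>
     (\<forall>\<xi> \<zeta>. \<xi> \<le> \<zeta> \<longleftrightarrow> fst (\<pi> \<xi>) < fst (\<pi> \<zeta>) \<or> fst (\<pi> \<xi>) = fst (\<pi> \<zeta>) \<and> snd (\<pi> \<xi>) \<le> snd (\<pi> \<zeta>))" ..
  then have rng: "range \<pi> = {(\<alpha>, \<eta>). \<eta> \<le> \<mu> \<alpha>}" ..
  have \<pi>_le: "\<xi> \<le> \<zeta> \<longleftrightarrow> fst (\<pi> \<xi>) < fst (\<pi> \<zeta>) \<or> fst (\<pi> \<xi>) = fst (\<pi> \<zeta>) \<and> snd (\<pi> \<xi>) \<le> snd (\<pi> \<zeta>)" for \<xi> \<zeta>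
    using * by blast
  define blk where "blk \<xi> = fst (\<pi> \<xi>)" for \<xi>
  define pos where "pos \<xi> = snd (\<pi> \<xi>)" for \<xi>
  have le: "\<xi> \<le> \<zeta> \<longleftrightarrow> blk \<xi> < blk \<zeta> \<or> blk \<xi> = blk \<zeta> \<and> pos \<xi> \<le> pos \<zeta>" for \<xi> \<zeta>
    unfolding blk_def pos_def by (rule \<pi>_le)
  have index: "\<exists>\<xi>. blk \<xi> = \<alpha> \<and> pos \<xi> = \<eta>" if "\<eta> \<le> \<mu> \<alpha>" for \<alpha> \<eta>
  proof -
    have "(\<alpha>, \<eta>) \<in> range \<pi>"
      using rng that by simp
    then obtain \<xi> where "\<pi> \<xi> = (\<alpha>, \<eta>)"
      by (metis imageE)
    then show ?thesis
      by (intro exI[of _ \<xi>]) (simp add: blk_def pos_def)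
  qed
  have pos_le: "pos \<xi> \<le> \<mu> (blk \<xi>)" for \<xi>
  proof -
    have "\<pi> \<xi> \<in> {(\<alpha>, \<eta>). \<eta> \<le> \<mu> \<alpha>}"
      using rng rangeI by metis
    then show ?thesis
      by (auto simp: blk_def pos_def split_beta)
  qed
  \<comment> \<open>the default label of the cylinder of height \<open>\<alpha>\<close> around \<open>x\<close>: the least one that occurs in it\<close>
  define dflt where "dflt x \<alpha> = (LEAST \<eta>. \<exists>y\<in>cylinder ?S c x \<alpha>. c y \<alpha> = \<eta>)" for x \<alpha>
  have dflt_cong: "dflt y \<alpha> = dflt x \<alpha>" if "\<And>\<beta>. \<beta> < \<alpha> \<Longrightarrow> c y \<beta> = c x \<beta>" for x y \<alpha>
    unfolding dflt_def using cylinder_cong[of \<alpha> c y x ?S] that by simp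
  have dflt: "\<exists>y\<in>cylinder ?S c x \<alpha>. c y \<alpha> = dflt x \<alpha>" if "x \<in> ?S" for x \<alpha>
    unfolding dflt_def by (rule LeastI_ex) (use self_in_cylinder[OF that] in auto)
  define g where "g x \<xi> \<longleftrightarrow> c x (blk \<xi>) = pos \<xi> \<and> c x (blk \<xi>) \<noteq> dflt x (blk \<xi>)" for x \<xi>
  have g_cong: "g y \<xi> = g x \<xi>" if "\<And>\<beta>. \<beta> \<le> blk \<xi> \<Longrightarrow> c y \<beta> = c x \<beta>" for x y \<xi>
    using dflt_cong[of "blk \<xi>" y x] that by (simp add: g_def)
  \<comment> \<open>the bits of the blocks up to \<open>\<alpha>\<close> determine the labels up to \<open>\<alpha>\<close>: by induction the defaults agree\<close>
  have determined: "c y \<beta> = c x \<beta>"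
    if xy: "x \<in> ?S" "y \<in> ?S" and g: "\<And>\<xi>. blk \<xi> \<le> \<alpha> \<Longrightarrow> g y \<xi> = g x \<xi>" and \<beta>: "\<beta> \<le> \<alpha>" for x y \<alpha> \<beta>
    using \<beta>
  proof (induction \<beta> rule: less_induct)
    case (less \<beta>)
    have d: "dflt y \<beta> = dflt x \<beta>"
      using less by (intro dflt_cong) auto
    obtain \<xi> where \<xi>: "blk \<xi> = \<beta>" "pos \<xi> = c x \<beta>"
      using index[OF less_imp_le[OF \<mu>[OF xy(1)]]] by blast
    obtain \<zeta> where \<zeta>: "blk \<zeta> = \<beta>" "pos \<zeta> = c y \<beta>"
      using index[OF less_imp_le[OF \<mu>[OF xy(2)]]] by blast
    have "g y \<xi> = g x \<xi>" "g y \<zeta> = g x \<zeta>"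
      using g \<xi>(1) \<zeta>(1) less.prems by simp_all
    then show ?case
      using \<xi> \<zeta> d unfolding g_def by metis
  qed
  have "openin X (cylinder ?S g x \<xi>)" for x \<xi>
  proof (subst openin_subopen, intro ballI)
    fix y assume y: "y \<in> cylinder ?S g x \<xi>"
    obtain \<alpha> where \<alpha>: "blk \<xi> < \<alpha>"
      using ex_greater by auto
    have "z \<in> cylinder ?S g x \<xi>" if z: "z \<in> cylinder ?S c y \<alpha>" for z
    proof -
      have "g z \<zeta> = g x \<zeta>" if "\<zeta> < \<xi>" for \<zeta>
      proof -
        have "blk \<zeta> \<le> blk \<xi>"
          using le[of \<zeta> \<xi>] that by auto
        then have "g z \<zeta> = g y \<zeta>"
          using z \<alpha> by (intro g_cong) (auto simp: cylinder_def)
        then show ?thesis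
          using y that by (simp add: cylinder_def)
      qed
      then show ?thesis
        using z by (simp add: cylinder_def)
    qed
    moreover have "y \<in> ?S"
      using y by (simp add: cylinder_def)
    moreover from this have "openin X (cylinder ?S c y \<alpha>)"
      using c by (simp add: superclosed_coding_def)
    ultimately show "\<exists>T. openin X T \<and> y \<in> T \<and> T \<subseteq> cylinder ?S g x \<xi>"
      by (intro exI[of _ "cylinder ?S c y \<alpha>"]) (auto simp: self_in_cylinder)
  qed
  moreover have "\<exists>\<xi>. cylinder ?S g x \<xi> \<subseteq> U" if U: "openin X U" "x \<in> U" for U x
  proof -
    have x: "x \<in> ?S"
      using U openin_subset by blast
    obtain \<alpha> where \<alpha>: "cylinder ?S c x \<alpha> \<subseteq> U"
      using c U unfolding superclosed_coding_def by metis
    obtain \<xi> where \<xi>: "blk \<xi> = \<alpha>"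
      using index[OF order_refl, of \<alpha>] by auto
    have "y \<in> cylinder ?S c x \<alpha>" if y: "y \<in> cylinder ?S g x \<xi>" for y
    proof -
      have yS: "y \<in> ?S"
        using y by (simp add: cylinder_def)
      have "g y \<zeta> = g x \<zeta>" if "blk \<zeta> < \<alpha>" for \<zeta>
      proof -
        have "\<not> \<xi> \<le> \<zeta>"
          using that \<xi> le[of \<xi> \<zeta>] by auto
        then show ?thesis
          using y by (simp add: cylinder_def)
      qed
      then have "c y \<beta> = c x \<beta>" if "\<beta> < \<alpha>" for \<beta>
        using that by (intro determined[OF x yS, of \<beta>]) auto
      then show ?thesis
        using yS by (simp add: cylinder_def)
    qed
    then show ?thesis using \<alpha> by auto
  qed
  moreover have "\<exists>x\<in>?S. \<forall>\<xi>\<in>D. g x \<xi> = s \<xi>"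
    if D: "D \<in> limit_lengths" and s: "\<forall>\<xi>\<in>D. \<exists>x\<in>?S. \<forall>\<zeta>\<le>\<xi>. g x \<zeta> = s \<zeta>" for D s
  proof -
    have down: "\<zeta> \<in> D" if "\<xi> \<in> D" "\<zeta> \<le> \<xi>" for \<xi> \<zeta>
      by (rule limit_lengthsD(2)[OF D that])
    \<comment> \<open>the blocks that are completely contained in \<open>D\<close>\<close>
    define A where "A = {\<alpha>. \<forall>\<xi>. blk \<xi> = \<alpha> \<longrightarrow> \<xi> \<in> D}"
    have below: "\<beta> \<in> A" if "\<xi> \<in> D" "\<beta> < blk \<xi>" for \<beta> \<xi>
    proof -
      have "\<zeta> \<in> D" if "blk \<zeta> = \<beta>" for \<zeta>
        using down[OF \<open>\<xi> \<in> D\<close>, of \<zeta>] le[of \<zeta> \<xi>] that \<open>\<beta> < blk \<xi>\<close> by simp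
      then show ?thesis
        by (simp add: A_def)
    qed
    have "D \<noteq> {}"
      using D by (auto simp: limit_lengths_def is_limit_def)
    then have ne: "?S \<noteq> {}"
      using s by blast
    have A_down: "\<beta> \<in> A" if "\<alpha> \<in> A" "\<beta> \<le> \<alpha>" for \<alpha> \<beta>
    proof (cases "\<beta> = \<alpha>")
      case False
      obtain \<xi> where "blk \<xi> = \<alpha>"
        using index[OF order_refl, of \<alpha>] by auto
      then show ?thesis
        using below[of \<xi> \<beta>] that False by (auto simp: A_def)
    qed (use that in simp)
    have "\<exists>x\<in>?S. \<forall>\<xi>. blk \<xi> \<le> \<alpha> \<longrightarrow> g x \<xi> = s \<xi>" if \<alpha>: "\<alpha> \<in> A" for \<alpha>
    proof -
      obtain \<zeta> where \<zeta>: "blk \<zeta> = \<alpha>" "pos \<zeta> = \<mu> \<alpha>"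
        using index[OF order_refl, of \<alpha>] by auto
      then have "\<zeta> \<in> D"
        using \<alpha> by (simp add: A_def)
      then obtain x where x: "x \<in> ?S" "\<forall>\<xi>\<le>\<zeta>. g x \<xi> = s \<xi>"
        using s by auto
      have "\<xi> \<le> \<zeta>" if "blk \<xi> \<le> \<alpha>" for \<xi>
      proof (cases "blk \<xi> = \<alpha>")
        case True
        then show ?thesis
          using le[of \<xi> \<zeta>] pos_le[of \<xi>] \<zeta> by simp
      next
        case False
        then show ?thesis
          using le[of \<xi> \<zeta>] that \<zeta>(1) by simp
      qed
      then show ?thesis
        using x by auto
    qed
    then obtain w where w: "\<And>\<alpha>. \<alpha> \<in> A \<Longrightarrow> w \<alpha> \<in> ?S \<and> (\<forall>\<xi>. blk \<xi> \<le> \<alpha> \<longrightarrow> g (w \<alpha>) \<xi> = s \<xi>)"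
      by metis
    have w_eq: "c (w \<alpha>) \<beta> = c (w \<beta>) \<beta>" if "\<alpha> \<in> A" "\<beta> \<le> \<alpha>" for \<alpha> \<beta>
    proof -
      have \<beta>: "\<beta> \<in> A" by (rule A_down[OF that])
      show ?thesis
        by (rule determined[of _ _ \<beta>]) (use w[OF that(1)] w[OF \<beta>] that(2) in auto)
    qed
    have "\<exists>z\<in>?S. \<forall>\<beta>\<in>A. c z \<beta> = c (w \<beta>) \<beta>"
    proof (rule superclosed_coding_initial_segment[OF c ne A_down])
      fix \<alpha> assume "\<alpha> \<in> A"
      then show "\<exists>x\<in>?S. \<forall>\<beta>\<le>\<alpha>. c x \<beta> = c (w \<beta>) \<beta>"
        using w_eq w by (intro bexI[of _ "w \<alpha>"]) auto
    qed
    then obtain z where z: "z \<in> ?S" "\<And>\<beta>. \<beta> \<in> A \<Longrightarrow> c z \<beta> = c (w \<beta>) \<beta>"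
      by auto
    \<comment> \<open>\<open>z\<close> takes care of the complete blocks; at most one block is cut off by \<open>D\<close>\<close>
    have z_good: "g y \<xi> = s \<xi>" if "\<And>\<beta>. \<beta> \<le> blk \<xi> \<Longrightarrow> c y \<beta> = c z \<beta>" "blk \<xi> \<in> A" for y \<xi>
    proof -
      have "c y \<beta> = c (w (blk \<xi>)) \<beta>" if "\<beta> \<le> blk \<xi>" for \<beta>
      proof -
        have "c y \<beta> = c z \<beta>"
          by (rule \<open>\<And>\<beta>. \<beta> \<le> blk \<xi> \<Longrightarrow> c y \<beta> = c z \<beta>\<close>[OF that])
        also have "\<dots> = c (w \<beta>) \<beta>"
          by (rule z(2)[OF A_down[OF \<open>blk \<xi> \<in> A\<close> that]])
        also have "\<dots> = c (w (blk \<xi>)) \<beta>"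
          by (rule w_eq[OF \<open>blk \<xi> \<in> A\<close> that, symmetric])
        finally show ?thesis .
      qed
      then have "g y \<xi> = g (w (blk \<xi>)) \<xi>"
        by (rule g_cong)
      then show ?thesis
        using w[OF \<open>blk \<xi> \<in> A\<close>] by simp
    qed
    show ?thesis
    proof (cases "\<forall>\<xi>\<in>D. blk \<xi> \<in> A")
      case True
      then show ?thesis
        using z(1) z_good[OF refl] by (intro bexI[of _ z]) auto
    next
      case False
      then obtain \<xi>\<^sub>1 where \<xi>\<^sub>1: "\<xi>\<^sub>1 \<in> D" "blk \<xi>\<^sub>1 \<notin> A"
        by auto
      define \<alpha> where "\<alpha> = blk \<xi>\<^sub>1"
      have blk_le: "blk \<xi> \<le> \<alpha>" if "\<xi> \<in> D" for \<xi>
        using below[OF that, of \<alpha>] \<xi>\<^sub>1(2) by (auto simp: \<alpha>_def not_less[symmetric])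
      have less_A: "\<beta> \<in> A" if "\<beta> < \<alpha>" for \<beta>
        using below[OF \<xi>\<^sub>1(1)] that by (simp add: \<alpha>_def)
      show ?thesis
      proof (cases "\<exists>\<xi>\<in>D. blk \<xi> = \<alpha> \<and> s \<xi>")
        case True
        then obtain \<xi> where \<xi>: "\<xi> \<in> D" "blk \<xi> = \<alpha>" "s \<xi>"
          by auto
        obtain x where x: "x \<in> ?S" "\<forall>\<zeta>\<le>\<xi>. g x \<zeta> = s \<zeta>"
          using s \<xi>(1) by auto
        \<comment> \<open>a bit \<open>1\<close> in the incomplete block: the label is known\<close>
        have cx: "c x \<alpha> = pos \<xi>"
          using x(2) \<xi> by (auto simp: g_def)
        have "g x \<zeta> = s \<zeta>" if \<zeta>: "\<zeta> \<in> D" for \<zeta>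
        proof (cases "\<zeta> \<le> \<xi>")
          case False
          then have "\<xi> \<le> \<zeta>" "\<xi> \<noteq> \<zeta>"
            by auto
          then have b: "blk \<zeta> = \<alpha>" and p: "pos \<zeta> \<noteq> pos \<xi>"
            using le[of \<xi> \<zeta>] le[of \<zeta> \<xi>] blk_le[OF \<zeta>] \<xi>(2) False by auto
          obtain y where y: "y \<in> ?S" "\<forall>\<zeta>'\<le>\<zeta>. g y \<zeta>' = s \<zeta>'"
            using s \<zeta> by auto
          have "g y \<xi>"
            using y(2) \<open>\<xi> \<le> \<zeta>\<close> \<xi>(3) by auto
          then have "c y \<alpha> = pos \<xi>"
            using \<xi>(2) by (auto simp: g_def)
          then have "\<not> g y \<zeta>" "\<not> g x \<zeta>"
            using b p cx by (auto simp: g_def)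
          then show ?thesis
            using y(2) by auto
        qed (use x(2) in simp)
        then show ?thesis
          using x(1) by auto
      next
        case False
        \<comment> \<open>only zeros in the incomplete block: the default label realizes them\<close>
        obtain y where y: "y \<in> cylinder ?S c z \<alpha>" "c y \<alpha> = dflt z \<alpha>"
          using dflt[OF z(1)] by auto
        have eq: "c y \<beta> = c z \<beta>" if "\<beta> < \<alpha>" for \<beta>
          using y(1) that by (simp add: cylinder_def)
        have "g y \<xi> = s \<xi>" if \<xi>: "\<xi> \<in> D" for \<xi>
        proof (cases "blk \<xi> = \<alpha>")
          case True
          have "dflt y \<alpha> = dflt z \<alpha>"
            by (rule dflt_cong[OF eq])
          then have "\<not> g y \<xi>"
            using y(2) True by (simp add: g_def)
          then show ?thesis
            using False \<xi> True by auto
        next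
          case False
          then have "blk \<xi> < \<alpha>"
            using blk_le[OF \<xi>] by simp
          then show ?thesis
            using eq less_A by (intro z_good) auto
        qed
        moreover have "y \<in> ?S"
          using y(1) by (simp add: cylinder_def)
        ultimately show ?thesis by auto
      qed
    qed
  qed
  ultimately have "superclosed_coding X g"
    by (simp add: superclosed_coding_def)
  then show ?thesis by fast
qed

end

section \<open>Weak compactness and the \<open>\<kappa>\<close>-Lindelof property\<close>

context uncountable_regular
begin

text \<open>
  If a cover has no small subcover, the cylinders that are not covered by a small part of it
  form a tree of height \<open>\<kappa>\<close>. Its levels are small because \<open>\<kappa>\<close> is a strong limit and the labels
  are binary, and nonempty by regularity. A branch of it is the code of a point, and the
  member of the cover that contains this point covers one of those cylinders.
\<close>

theorem weakly_compact_imp_kappa_Lindelof: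
  fixes f :: "'a \<Rightarrow> 'k \<Rightarrow> 'k"
  assumes wc: "weakly_compact \<kappa>" and f: "superclosed_coding X f"
    and bin: "\<And>x \<alpha>. x \<in> topspace X \<Longrightarrow> f x \<alpha> \<in> {zero_ord, one_ord}"
  shows "kappa_Lindelof \<kappa> X"
  unfolding kappa_Lindelof_def
proof (intro allI impI)
  let ?S = "topspace X"
  fix \<U> assume \<U>: "(\<forall>U\<in>\<U>. openin X U) \<and> \<Union>\<U> = ?S"
  define thin where "thin B \<longleftrightarrow> (\<exists>\<V>. |\<V>| <o ord_of \<kappa> \<and> \<V> \<subseteq> \<U> \<and> B \<subseteq> \<Union>\<V>)" for B
  have thin_mono: "thin A" if "thin B" "A \<subseteq> B" for A B
    using that unfolding thin_def by (meson subset_trans)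
  have pow: "|Pow {..<\<alpha>}| <o ord_of \<kappa>" for \<alpha> :: 'k
    using wc by (simp add: weakly_compact_def strongly_inaccessible_def)
  define ones where "ones x \<alpha> = {\<beta>. \<beta> < \<alpha> \<and> f x \<beta> = one_ord}" for x \<alpha>
  have f_ones: "f x \<beta> = (if \<beta> \<in> ones x \<alpha> then one_ord else zero_ord)" if "x \<in> ?S" "\<beta> < \<alpha>" for x \<alpha> \<beta>
    using bin[OF that(1), of \<beta>] that(2) by (auto simp: ones_def)
  have thin_S: "thin ?S"
  proof (rule ccontr)
    assume not_thin: "\<not> thin ?S"
    \<comment> \<open>\<open>thin\<close> sets are those covered by a small part of the cover\<close>
    define T where "T = {trunc (f x) \<alpha> |x \<alpha>. x \<in> ?S \<and> \<not> thin (cylinder ?S f x \<alpha>)}"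
    have "is_tree \<kappa> T"
      unfolding is_tree_def
    proof (intro conjI ballI allI)
      show "T \<subseteq> seqs \<kappa>"
        using trunc_in_seqs by (auto simp: T_def)
      fix s \<alpha> assume "s \<in> T"
      then obtain x \<beta> where x: "x \<in> ?S" "\<not> thin (cylinder ?S f x \<beta>)" "s = trunc (f x) \<beta>"
        by (auto simp: T_def)
      have "\<not> thin (cylinder ?S f x (min \<beta> \<alpha>))"
        using thin_mono[OF _ cylinder_antimono[of "min \<beta> \<alpha>" \<beta> ?S f x]] x(2) by auto
      then show "s |` {..<\<alpha>} \<in> T"
        unfolding x(3) restrict_trunc using x(1) by (auto simp: T_def)
    qed
    moreover have "|level \<kappa> T \<alpha>| <o ord_of \<kappa>" for \<alpha>
    proof (rule small_subset[OF _ small_image[OF pow]])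
      let ?F = "\<lambda>B. trunc (\<lambda>\<beta>. if \<beta> \<in> B then one_ord else zero_ord) \<alpha>"
      show "level \<kappa> T \<alpha> \<subseteq> ?F ` Pow {..<\<alpha>}"
      proof
        fix s assume "s \<in> level \<kappa> T \<alpha>"
        then obtain x \<beta> where x: "x \<in> ?S" "s = trunc (f x) \<beta>" "dom s = {..<\<alpha>}"
          by (auto simp: level_def T_def)
        then have "{..<\<beta>} = {..<\<alpha>}"
          using dom_trunc by metis
        then have "\<beta> = \<alpha>"
          by (metis lessThan_iff less_irrefl neqE)
        then have "s = ?F (ones x \<alpha>)"
          unfolding x(2) trunc_eq_iff using f_ones[OF x(1)] by simp
        moreover have "ones x \<alpha> \<in> Pow {..<\<alpha>}"
          by (auto simp: ones_def)
        ultimately show "s \<in> ?F ` Pow {..<\<alpha>}"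
          by (rule image_eqI)
      qed
    qed
    moreover have "level \<kappa> T \<alpha> \<noteq> {}" for \<alpha>
    proof
      assume empty: "level \<kappa> T \<alpha> = {}"
      have thin_cyl: "thin (cylinder ?S f x \<alpha>)" if x: "x \<in> ?S" for x
      proof (rule ccontr)
        assume "\<not> thin (cylinder ?S f x \<alpha>)"
        then have "trunc (f x) \<alpha> \<in> T"
          using x by (auto simp: T_def)
        then have "trunc (f x) \<alpha> \<in> level \<kappa> T \<alpha>"
          using dom_trunc[of "f x" \<alpha>] by (simp only: level_def mem_Collect_eq simp_thms)
        then show False using empty by blast
      qed
      let ?\<P> = "(\<lambda>x. cylinder ?S f x \<alpha>) ` ?S"
      have small_P: "|?\<P>| <o ord_of \<kappa>"
      proof (rule small_subset[OF _ small_image[OF pow]])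
        let ?F = "\<lambda>B. {y \<in> ?S. \<forall>\<beta><\<alpha>. f y \<beta> = (if \<beta> \<in> B then one_ord else zero_ord)}"
        show "?\<P> \<subseteq> ?F ` Pow {..<\<alpha>}"
        proof
          fix P assume "P \<in> ?\<P>"
          then obtain x where x: "x \<in> ?S" "P = cylinder ?S f x \<alpha>" by auto
          have "P = ?F (ones x \<alpha>)"
            unfolding x(2) cylinder_def using f_ones[OF x(1)] by simp
          moreover have "ones x \<alpha> \<in> Pow {..<\<alpha>}"
            by (auto simp: ones_def)
          ultimately show "P \<in> ?F ` Pow {..<\<alpha>}"
            by (rule image_eqI)
        qed
      qed
      have "\<forall>P\<in>?\<P>. \<exists>\<V>. |\<V>| <o ord_of \<kappa> \<and> \<V> \<subseteq> \<U> \<and> P \<subseteq> \<Union>\<V>"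
        using thin_cyl unfolding thin_def by blast
      then obtain \<V> where \<V>: "\<forall>P\<in>?\<P>. |\<V> P| <o ord_of \<kappa> \<and> \<V> P \<subseteq> \<U> \<and> P \<subseteq> \<Union>(\<V> P)"
        by metis
      have "|\<Union>P\<in>?\<P>. \<V> P| <o ord_of \<kappa>"
        using small_P \<V> by (intro small_UN) auto
      moreover have "(\<Union>P\<in>?\<P>. \<V> P) \<subseteq> \<U>"
        using \<V> by blast
      moreover have "?S \<subseteq> \<Union>(\<Union>P\<in>?\<P>. \<V> P)"
      proof
        fix x assume x: "x \<in> ?S"
        then have "cylinder ?S f x \<alpha> \<in> ?\<P>" by simp
        moreover from this have "x \<in> \<Union>(\<V> (cylinder ?S f x \<alpha>))"
          using \<V> self_in_cylinder[OF x, of f \<alpha>] by blast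
        ultimately show "x \<in> \<Union>(\<Union>P\<in>?\<P>. \<V> P)" by blast
      qed
      ultimately have "thin ?S"
        unfolding thin_def by (intro exI[of _ "\<Union>P\<in>?\<P>. \<V> P"]) simp
      then show False using not_thin by simp
    qed
    ultimately have "branches \<kappa> T \<noteq> {}"
      using wc by (simp add: weakly_compact_def)
    then obtain y where "y \<in> branches \<kappa> T"
      by blast
    then have y: "trunc y \<alpha> \<in> T" for \<alpha>
      by (simp add: branches_def)
    have node: "\<exists>x\<in>?S. \<not> thin (cylinder ?S f x \<alpha>) \<and> (\<forall>\<beta><\<alpha>. f x \<beta> = y \<beta>)" for \<alpha>
    proof -
      obtain x \<beta> where x: "x \<in> ?S" "\<not> thin (cylinder ?S f x \<beta>)" "trunc y \<alpha> = trunc (f x) \<beta>"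
        using y[of \<alpha>] unfolding T_def by blast
      then have "\<alpha> = \<beta>" "\<forall>\<xi><\<alpha>. y \<xi> = f x \<xi>"
        unfolding trunc_eq_iff by simp_all
      then show ?thesis
        using x by (intro bexI[of _ x]) simp_all
    qed
    have "\<exists>z\<in>?S. f z = y"
    proof (rule superclosed_coding_UNIV[OF f])
      fix \<alpha> :: 'k
      obtain \<alpha>' where \<alpha>': "\<alpha> < \<alpha>'"
        using ex_greater by auto
      obtain x where "x \<in> ?S" "\<forall>\<beta><\<alpha>'. f x \<beta> = y \<beta>"
        using node[of \<alpha>'] by auto
      then show "\<exists>x\<in>?S. \<forall>\<beta>\<le>\<alpha>. f x \<beta> = y \<beta>"
        using \<alpha>' by (intro bexI[of _ x]) auto
    qed
    then obtain z where z: "z \<in> ?S" "f z = y"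
      by auto
    then obtain U where U: "U \<in> \<U>" "z \<in> U"
      using \<U> by blast
    then obtain \<alpha> where \<alpha>: "cylinder ?S f z \<alpha> \<subseteq> U"
      using f \<U> unfolding superclosed_coding_def by metis
    obtain x where x: "\<not> thin (cylinder ?S f x \<alpha>)" "\<forall>\<beta><\<alpha>. f x \<beta> = y \<beta>"
      using node[of \<alpha>] by auto
    have "cylinder ?S f x \<alpha> = cylinder ?S f z \<alpha>"
      by (rule cylinder_cong) (simp add: x(2) z(2))
    moreover have "|{U}| <o ord_of \<kappa>"
      by (rule small_countable) simp
    ultimately have "thin (cylinder ?S f x \<alpha>)"
      unfolding thin_def using \<alpha> U(1) by (intro exI[of _ "{U}"]) simp
    then show False using x(1) by simp
  qed
  then obtain \<V> where "|\<V>| <o ord_of \<kappa>" "\<V> \<subseteq> \<U>" "?S \<subseteq> \<Union>\<V>"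
    unfolding thin_def by blast
  moreover from this have "\<Union>\<V> = ?S"
    using \<U> by blast
  ultimately show "\<exists>\<V>. |\<V>| <o ord_of \<kappa> \<and> \<V> \<subseteq> \<U> \<and> \<Union>\<V> = ?S"
    by (intro exI[of _ \<V>]) simp
qed

section \<open>The characterization\<close>

lemma Polish_imp_lt_complete_metrizable:
  assumes "spherically_complete_Polish \<kappa> \<GG> X"
  shows "spherically_lt_complete_metrizable \<kappa> \<GG> X"
  using assms spherically_complete_any_length
  unfolding spherically_complete_Polish_def spherically_lt_complete_metrizable_def
    spherically_lt_complete_def by blast

lemma superclosed_coding_imp_Polish:
  fixes \<GG> :: "'g::linordered_ab_group_add itself" and h :: "'a \<Rightarrow> 'k \<Rightarrow> 'b"
  assumes \<GG>: "Deg \<GG> =o ord_of \<kappa>" and "Hausdorff_space X" "kappa_Lindelof \<kappa> X" "superclosed_coding X h"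
  shows "spherically_complete_Polish \<kappa> \<GG> X"
proof -
  obtain d :: "'a \<Rightarrow> 'a \<Rightarrow> 'g" where d: "compatible_metric X d" "Cauchy_complete_metric \<kappa> (topspace X) d"
    "spherically_complete (topspace X) d"
    using superclosed_coding_imp_metric[OF \<GG> assms(4,2)] by blast
  show ?thesis
    unfolding spherically_complete_Polish_def
    using metric_weight[OF \<GG> d(1) assms(3)] d by blast
qed

end

theorem theorem3p21:
  fixes \<kappa> :: "'k::wellorder itself"
    and \<GG> :: "'g::linordered_ab_group_add itself"
    and X :: "'a topology"
  assumes "standing_assumptions \<kappa>"
    and "Deg \<GG> =o ord_of \<kappa>"
    and "regular_space X" and "Hausdorff_space X"
  shows "((kappa_Lindelof \<kappa> X \<and> kappa_additive \<kappa> X \<and> SC_space \<kappa> X)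
            \<longleftrightarrow> (kappa_Lindelof \<kappa> X \<and> spherically_lt_complete_metrizable \<kappa> \<GG> X)) \<and>
         ((kappa_Lindelof \<kappa> X \<and> spherically_lt_complete_metrizable \<kappa> \<GG> X)
            \<longleftrightarrow> (kappa_Lindelof \<kappa> X \<and> spherically_complete_Polish \<kappa> \<GG> X)) \<and>
         (weakly_compact \<kappa> \<longrightarrow>
           ((kappa_Lindelof \<kappa> X \<and> kappa_additive \<kappa> X \<and> SC_space \<kappa> X)
            \<longleftrightarrow> (\<exists>C. C \<subseteq> cantor_set \<kappa> \<and> superclosed \<kappa> C \<and>
                   X homeomorphic_space subtopology (bounded_topology \<kappa>) C)))"
    (is "(?a \<longleftrightarrow> ?b) \<and> (?b \<longleftrightarrow> ?c) \<and> (weakly_compact \<kappa> \<longrightarrow> (?a \<longleftrightarrow> ?d))")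
proof -
  interpret uncountable_regular \<kappa>
    using assms(1) by unfold_locales (simp_all add: standing_assumptions_def)
  have a_coding: "\<exists>h :: 'a \<Rightarrow> 'k \<Rightarrow> 'a. superclosed_coding X h" if ?a
    using that assms(3) by (intro SC_space_imp_superclosed_coding) simp_all
  note coding_c = superclosed_coding_imp_Polish[OF assms(2,4)]
  have cb: ?b if ?c
    using that Polish_imp_lt_complete_metrizable[of \<GG> X] by simp
  have ba: ?a if ?b
    using that metrizable_imp_additive_SC_space[OF assms(2), of X] by simp
  have ac: ?c if ?a
  proof -
    obtain h :: "'a \<Rightarrow> 'k \<Rightarrow> 'a" where h: "superclosed_coding X h"
      using a_coding[OF \<open>?a\<close>] by blast
    show ?c
      using coding_c[OF _ h] \<open>?a\<close> by simp
  qed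
  have ad: ?d if ?a
  proof -
    obtain h :: "'a \<Rightarrow> 'k \<Rightarrow> 'a" where "superclosed_coding X h"
      using a_coding[OF \<open>?a\<close>] by blast
    then obtain g :: "'a \<Rightarrow> 'k \<Rightarrow> bool" where "superclosed_coding X g"
      using superclosed_coding_imp_binary[of X h] \<open>?a\<close> by blast
    then show ?d
      using assms(4) by (rule superclosed_coding_imp_superclosed_embedding)
  qed
  have dc: ?c if wc: "weakly_compact \<kappa>" and d: ?d
  proof -
    obtain C f where C: "C \<subseteq> cantor_set \<kappa>" "superclosed \<kappa> C"
      and f: "homeomorphic_map X (subtopology (bounded_topology \<kappa>) C) f"
      using d unfolding homeomorphic_space by blast
    have f_coding: "superclosed_coding X f"
      by (rule superclosed_homeomorph_imp_superclosed_coding[OF C(2) f])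
    have "f ` topspace X = C"
      using homeomorphic_imp_surjective_map[OF f] by (simp add: topspace_bounded_topology)
    then have "f x \<alpha> \<in> {zero_ord, one_ord}" if "x \<in> topspace X" for x \<alpha>
      using C(1) that unfolding cantor_set_def by blast
    then have "kappa_Lindelof \<kappa> X"
      by (rule weakly_compact_imp_kappa_Lindelof[OF wc f_coding])
    then show ?c
      using coding_c[OF _ f_coding] by simp
  qed
  show ?thesis
    using cb ba ac ad dc by blast
qed

end
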